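(* Let $\sim$ be an equivalence relation on $U$, and let $(S,U,A,C)$ be an instance of WSP in which every constraint is either of the form $(s_1,s_2,\sim)$, of the form $(s_1,s_2,\not\sim)$, or user-independent. Then the instance can be solved in time $O^*(2^{k\log k+k})$, where $k=|S|$.
   Context: An instance of WSP is a tuple $(S,U,A,C)$: $S$ a finite set of tasks ($k=|S|$), $U$ a finite set of users ($n=|U|$), $A(s)\subseteq U$ the authorization list of $s\in S$ (arbitrary), $C$ a set of constraints ($m=|C|$); a constraint is a pair $(L,\Theta)$ with $L\subseteq S$ and $\Theta$ a set of functions $L\to U$. A plan $\pi:T\to X$ ($T\subseteq S$, $X\subseteq U$) satisfies $(L,\Theta)$ if $L\setminus T\neq\emptyset$ or $\pi|_L\in\Theta$; it is eligible if it satisfies all constraints, authorized if $\pi(s)\in A(s)$ for all $s\in T$, valid if both, complete if it is a plan $S\to U$. Solving WSP means outputting a valid complete plan if one exists and reporting that none exists otherwise. For a binary relation $\rho$ on $U$, $(s,s',\rho)$ is the constraint with scope $\{s,s'\}$ satisfied exactly when $\pi(s)\mathrel\rho\pi(s')$; $\not\sim$ is the complement of $\sim$. A constraint $(L,\Theta)$ is user-independent if $\psi\circ\theta\in\Theta$ for all $\theta\in\Theta$ and all permutations $\psi$ of $U$. It is assumed each constraint and authorization can be checked in time polynomial in $n,k,m$; $O^*(h)$ means $O(q(n,k,m)h)$ for a polynomial $q$; $\log$ is base 2. *)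

theory Defs
  imports Complex_Main "HOL-Combinatorics.Permutations"
begin

section \<open>The workflow satisfiability problem\<close>

text \<open>A function from \<open>L\<close> to \<open>U\<close> is a partial map with domain \<open>L\<close> and range inside \<open>U\<close>;
  a plan is a partial map from tasks to users.\<close>

type_synonym ('s, 'u) constraint = "'s set \<times> ('s \<rightharpoonup> 'u) set"

type_synonym ('s, 'u) wsp =
  "'s set \<times> 'u set \<times> ('s \<Rightarrow> 'u set) \<times> ('s, 'u) constraint set"

definition wsp_instance :: "('s, 'u) wsp \<Rightarrow> bool" where
  "wsp_instance W \<longleftrightarrow> (case W of (S, U, A, C) \<Rightarrow>
     finite S \<and> finite U \<and> (\<forall>s\<in>S. A s \<subseteq> U) \<and>
     (\<forall>(L, \<Theta>)\<in>C. L \<subseteq> S \<and> (\<forall>\<theta>\<in>\<Theta>. dom \<theta> = L \<and> ran \<theta> \<subseteq> U)))"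

definition plan :: "'s set \<Rightarrow> 'u set \<Rightarrow> ('s \<rightharpoonup> 'u) \<Rightarrow> bool" where
  "plan S U \<pi> \<longleftrightarrow> dom \<pi> \<subseteq> S \<and> ran \<pi> \<subseteq> U"

definition satisfies :: "('s \<rightharpoonup> 'u) \<Rightarrow> ('s, 'u) constraint \<Rightarrow> bool" where
  "satisfies \<pi> c \<longleftrightarrow> fst c - dom \<pi> \<noteq> {} \<or> \<pi> |` fst c \<in> snd c"

definition eligible :: "('s, 'u) constraint set \<Rightarrow> ('s \<rightharpoonup> 'u) \<Rightarrow> bool" where
  "eligible C \<pi> \<longleftrightarrow> (\<forall>c\<in>C. satisfies \<pi> c)"

definition authorized :: "('s \<Rightarrow> 'u set) \<Rightarrow> ('s \<rightharpoonup> 'u) \<Rightarrow> bool" where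
  "authorized A \<pi> \<longleftrightarrow> (\<forall>s\<in>dom \<pi>. the (\<pi> s) \<in> A s)"

definition valid_complete_plan :: "('s, 'u) wsp \<Rightarrow> ('s \<rightharpoonup> 'u) \<Rightarrow> bool" where
  "valid_complete_plan W \<pi> \<longleftrightarrow> (case W of (S, U, A, C) \<Rightarrow>
     plan S U \<pi> \<and> dom \<pi> = S \<and> eligible C \<pi> \<and> authorized A \<pi>)"

definition rel_constraint :: "'u set \<Rightarrow> 's \<Rightarrow> 's \<Rightarrow> ('u \<times> 'u) set \<Rightarrow> ('s, 'u) constraint" where
  "rel_constraint U s s' \<rho> =
     ({s, s'}, {\<theta>. dom \<theta> = {s, s'} \<and> ran \<theta> \<subseteq> U \<and> (the (\<theta> s), the (\<theta> s')) \<in> \<rho>})"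

definition user_independent :: "'u set \<Rightarrow> ('s, 'u) constraint \<Rightarrow> bool" where
  "user_independent U c \<longleftrightarrow>
     (\<forall>\<theta>\<in>snd c. \<forall>\<psi>. \<psi> permutes U \<longrightarrow> map_option \<psi> \<circ> \<theta> \<in> snd c)"

section \<open>Model of computation\<close>

text \<open>A unit-cost random access machine in structured form. A program works on
  registers and on arrays of natural numbers, with addition and truncated subtraction
  as its only arithmetic (there is no unit-cost multiplication). Every node of an evaluated
  expression and every executed command costs one time unit. The authorization lists and
  the constraints are accessible only through queries, each of which costs
  \<open>query_time\<close> additional units.\<close>

datatype exp = Const nat | Reg nat | Cell nat exp | Add exp exp | Sub exp exp

text \<open>The first argument of the three query commands is the register that receives the
  answer. The last argument of \<open>CheckQ\<close> is the array that holds the queried plan.\<close>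

datatype com =
    Skip
  | Assign nat exp
  | Store nat exp exp
  | Seq com com
  | If exp com com
  | While exp com
  | AuthQ nat exp exp
  | ScopeQ nat exp exp
  | CheckQ nat exp nat

type_synonym state = "(nat \<Rightarrow> nat) \<times> (nat \<Rightarrow> nat \<Rightarrow> nat)"

record queries =
  auth_query :: "nat \<Rightarrow> nat \<Rightarrow> bool"
  scope_query :: "nat \<Rightarrow> nat \<Rightarrow> bool"
  check_query :: "nat \<Rightarrow> (nat \<Rightarrow> nat) \<Rightarrow> bool"
  query_time :: nat

primrec eval_exp :: "exp \<Rightarrow> state \<Rightarrow> nat" where
  "eval_exp (Const v) \<sigma> = v"
| "eval_exp (Reg x) \<sigma> = fst \<sigma> x"
| "eval_exp (Cell a e) \<sigma> = snd \<sigma> a (eval_exp e \<sigma>)"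
| "eval_exp (Add e e') \<sigma> = eval_exp e \<sigma> + eval_exp e' \<sigma>"
| "eval_exp (Sub e e') \<sigma> = eval_exp e \<sigma> - eval_exp e' \<sigma>"

primrec exp_time :: "exp \<Rightarrow> nat" where
  "exp_time (Const v) = 1"
| "exp_time (Reg x) = 1"
| "exp_time (Cell a e) = 1 + exp_time e"
| "exp_time (Add e e') = 1 + exp_time e + exp_time e'"
| "exp_time (Sub e e') = 1 + exp_time e + exp_time e'"

definition set_reg :: "nat \<Rightarrow> nat \<Rightarrow> state \<Rightarrow> state" where
  "set_reg x v \<sigma> = ((fst \<sigma>)(x := v), snd \<sigma>)"

definition set_cell :: "nat \<Rightarrow> nat \<Rightarrow> nat \<Rightarrow> state \<Rightarrow> state" where
  "set_cell a i v \<sigma> = (fst \<sigma>, (snd \<sigma>)(a := (snd \<sigma> a)(i := v)))"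

text \<open>\<open>exec Q c \<sigma> t \<sigma>'\<close>: started in state \<open>\<sigma>\<close>, command \<open>c\<close> halts in state \<open>\<sigma>'\<close> after time \<open>t\<close>.\<close>

inductive exec :: "queries \<Rightarrow> com \<Rightarrow> state \<Rightarrow> nat \<Rightarrow> state \<Rightarrow> bool" for Q :: queries where
  Skip: "exec Q Skip \<sigma> 1 \<sigma>"
| Assign: "exec Q (Assign x e) \<sigma> (1 + exp_time e) (set_reg x (eval_exp e \<sigma>) \<sigma>)"
| Store: "exec Q (Store a e e') \<sigma> (1 + exp_time e + exp_time e')
    (set_cell a (eval_exp e \<sigma>) (eval_exp e' \<sigma>) \<sigma>)"
| Seq: "exec Q c \<sigma> t \<sigma>' \<Longrightarrow> exec Q c' \<sigma>' t' \<sigma>'' \<Longrightarrow> exec Q (Seq c c') \<sigma> (1 + t + t') \<sigma>''"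
| If_True: "eval_exp e \<sigma> \<noteq> 0 \<Longrightarrow> exec Q c \<sigma> t \<sigma>' \<Longrightarrow>
    exec Q (If e c c') \<sigma> (1 + exp_time e + t) \<sigma>'"
| If_False: "eval_exp e \<sigma> = 0 \<Longrightarrow> exec Q c' \<sigma> t \<sigma>' \<Longrightarrow>
    exec Q (If e c c') \<sigma> (1 + exp_time e + t) \<sigma>'"
| While_False: "eval_exp e \<sigma> = 0 \<Longrightarrow> exec Q (While e c) \<sigma> (1 + exp_time e) \<sigma>"
| While_True: "eval_exp e \<sigma> \<noteq> 0 \<Longrightarrow> exec Q c \<sigma> t \<sigma>' \<Longrightarrow> exec Q (While e c) \<sigma>' t' \<sigma>'' \<Longrightarrow>
    exec Q (While e c) \<sigma> (1 + exp_time e + t + t') \<sigma>''"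
| AuthQ: "exec Q (AuthQ x e e') \<sigma> (1 + exp_time e + exp_time e' + query_time Q)
    (set_reg x (of_bool (auth_query Q (eval_exp e \<sigma>) (eval_exp e' \<sigma>))) \<sigma>)"
| ScopeQ: "exec Q (ScopeQ x e e') \<sigma> (1 + exp_time e + exp_time e' + query_time Q)
    (set_reg x (of_bool (scope_query Q (eval_exp e \<sigma>) (eval_exp e' \<sigma>))) \<sigma>)"
| CheckQ: "exec Q (CheckQ x e a) \<sigma> (1 + exp_time e + query_time Q)
    (set_reg x (of_bool (check_query Q (eval_exp e \<sigma>) (snd \<sigma> a))) \<sigma>)"

inductive_cases exec_SkipE: "exec Q Skip \<sigma> t \<sigma>'"
inductive_cases exec_AssignE: "exec Q (Assign x e) \<sigma> t \<sigma>'"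
inductive_cases exec_StoreE: "exec Q (Store a e e') \<sigma> t \<sigma>'"
inductive_cases exec_SeqE: "exec Q (Seq c c') \<sigma> t \<sigma>'"
inductive_cases exec_IfE: "exec Q (If e c c') \<sigma> t \<sigma>'"
inductive_cases exec_WhileE: "exec Q (While e c) \<sigma> t \<sigma>'"
inductive_cases exec_AuthQE: "exec Q (AuthQ x e e') \<sigma> t \<sigma>'"
inductive_cases exec_ScopeQE: "exec Q (ScopeQ x e e') \<sigma> t \<sigma>'"
inductive_cases exec_CheckQE: "exec Q (CheckQ x e a) \<sigma> t \<sigma>'"

lemma exec_deterministic:
  "exec Q c \<sigma> t \<sigma>' \<Longrightarrow> exec Q c \<sigma> u \<sigma>'' \<Longrightarrow> u = t \<and> \<sigma>'' = \<sigma>'"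
proof (induction arbitrary: u \<sigma>'' rule: exec.induct)
  case (Skip \<sigma>)
  then show ?case by (elim exec_SkipE) simp
next
  case (Assign x e \<sigma>)
  then show ?case by (elim exec_AssignE) simp
next
  case (Store a e e' \<sigma>)
  then show ?case by (elim exec_StoreE) simp
next
  case (Seq c \<sigma> t \<sigma>' c' t' \<tau>)
  from Seq.prems obtain v \<rho> v'
    where u: "u = 1 + v + v'" and "exec Q c \<sigma> v \<rho>" and second: "exec Q c' \<rho> v' \<sigma>''"
    by (rule exec_SeqE) simp
  then have "v = t \<and> \<rho> = \<sigma>'" by (intro Seq.IH(1))
  with u Seq.IH(2)[of v' \<sigma>''] second show ?case by simp
next
  case (If_True e \<sigma> c t \<sigma>' c')
  from If_True.prems show ?case
    by (rule exec_IfE) (use If_True.hyps(1) in \<open>auto dest!: If_True.IH\<close>)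
next
  case (If_False e \<sigma> c t \<sigma>' c')
  from If_False.prems show ?case
    by (rule exec_IfE) (use If_False.hyps(1) in \<open>auto dest!: If_False.IH\<close>)
next
  case (While_False e \<sigma> c)
  from While_False.prems show ?case
    by (rule exec_WhileE) (use While_False.hyps in force)+
next
  case (While_True e \<sigma> c t \<sigma>' t' \<tau>)
  from While_True.prems obtain v \<rho> v'
    where u: "u = 1 + exp_time e + v + v'" and "exec Q c \<sigma> v \<rho>"
      and loop: "exec Q (While e c) \<rho> v' \<sigma>''"
    by (rule exec_WhileE) (use While_True.hyps(1) in simp_all)
  then have "v = t \<and> \<rho> = \<sigma>'" by (intro While_True.IH(1))
  with u While_True.IH(2)[of v' \<sigma>''] loop show ?case by simp
next
  case (AuthQ x e e' \<sigma>)
  then show ?case by (elim exec_AuthQE) simp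
next
  case (ScopeQ x e e' \<sigma>)
  then show ?case by (elim exec_ScopeQE) simp
next
  case (CheckQ x e a \<sigma>)
  then show ?case by (elim exec_CheckQE) simp
qed

section \<open>Solving instances of the problem on the machine\<close>

text \<open>An instance is presented by arbitrary enumerations of its tasks, users and constraints,
  and the machine refers to these by their positions. An array \<open>a\<close> stands for the plan that
  assigns to the \<open>i\<close>-th task the user at position \<open>a i\<close>, and leaves the task unassigned
  if \<open>a i\<close> is not a position of a user.\<close>

definition enumerates :: "'s list \<Rightarrow> 'u list \<Rightarrow> ('s, 'u) constraint list \<Rightarrow> ('s, 'u) wsp \<Rightarrow> bool" where
  "enumerates ss us cs W \<longleftrightarrow> (case W of (S, U, A, C) \<Rightarrow>
     distinct ss \<and> set ss = S \<and> distinct us \<and> set us = U \<and> distinct cs \<and> set cs = C)"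

definition plan_of_array :: "'s list \<Rightarrow> 'u list \<Rightarrow> (nat \<Rightarrow> nat) \<Rightarrow> 's \<rightharpoonup> 'u" where
  "plan_of_array ss us a =
     map_of (map (\<lambda>i. (ss ! i, us ! a i)) (filter (\<lambda>i. a i < length us) [0..<length ss]))"

definition wsp_queries ::
  "'s list \<Rightarrow> 'u list \<Rightarrow> ('s, 'u) constraint list \<Rightarrow> ('s, 'u) wsp \<Rightarrow> nat \<Rightarrow> queries" where
  "wsp_queries ss us cs W \<tau> = (case W of (S, U, A, C) \<Rightarrow>
     \<lparr>auth_query = (\<lambda>i j. i < length ss \<and> j < length us \<and> us ! j \<in> A (ss ! i)),
      scope_query = (\<lambda>l i. l < length cs \<and> i < length ss \<and> ss ! i \<in> fst (cs ! l)),
      check_query = (\<lambda>l a. l < length cs \<and> satisfies (plan_of_array ss us a) (cs ! l)),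
      query_time = \<tau>\<rparr>)"

definition input_state :: "nat \<Rightarrow> nat \<Rightarrow> nat \<Rightarrow> state" where
  "input_state n k m = ((\<lambda>_. 0)(0 := n, 1 := k, 2 := m), \<lambda>_ _. 0)"

text \<open>Register 0 finally tells whether a plan was found; if so, array 0 holds it.\<close>

definition solution_state :: "'s list \<Rightarrow> 'u list \<Rightarrow> ('s, 'u) wsp \<Rightarrow> state \<Rightarrow> bool" where
  "solution_state ss us W \<sigma> \<longleftrightarrow>
     (if \<exists>\<pi>. valid_complete_plan W \<pi>
      then fst \<sigma> 0 \<noteq> 0 \<and> valid_complete_plan W (plan_of_array ss us (snd \<sigma> 0))
      else fst \<sigma> 0 = 0)"

inductive polynomial3 :: "(nat \<Rightarrow> nat \<Rightarrow> nat \<Rightarrow> real) \<Rightarrow> bool" where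
  const: "polynomial3 (\<lambda>n k m. r)"
| var1: "polynomial3 (\<lambda>n k m. real n)"
| var2: "polynomial3 (\<lambda>n k m. real k)"
| var3: "polynomial3 (\<lambda>n k m. real m)"
| add: "polynomial3 p \<Longrightarrow> polynomial3 q \<Longrightarrow> polynomial3 (\<lambda>n k m. p n k m + q n k m)"
| mult: "polynomial3 p \<Longrightarrow> polynomial3 q \<Longrightarrow> polynomial3 (\<lambda>n k m. p n k m * q n k m)"

text \<open>The instances in the class \<open>K\<close> are solved in time \<open>O\<^sup>*(h k)\<close> by one program \<open>P\<close>, provided
  that each query is answered in time \<open>\<tau>\<close> bounded by a polynomial \<open>p\<close> in \<open>n\<close>, \<open>k\<close>, \<open>m\<close>. The
  constant hidden in the \<open>O\<close> is part of the polynomial \<open>q\<close>.\<close>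

definition solvable_in_O_star :: "('s, 'u) wsp set \<Rightarrow> (nat \<Rightarrow> real) \<Rightarrow> bool" where
  "solvable_in_O_star K h \<longleftrightarrow>
     (\<exists>P. \<forall>p. polynomial3 p \<longrightarrow> (\<exists>q. polynomial3 q \<and>
        (\<forall>W\<in>K. \<forall>ss us cs \<tau>. wsp_instance W \<longrightarrow> enumerates ss us cs W \<longrightarrow>
           (let n = length us; k = length ss; m = length cs in
              real \<tau> \<le> p n k m \<longrightarrow>
              (\<exists>t \<sigma>. exec (wsp_queries ss us cs W \<tau>) P (input_state n k m) t \<sigma> \<and>
                 solution_state ss us W \<sigma> \<and> real t \<le> q n k m * h k)))))"

end

theory Submission
  imports Defs
begin

text \<open>Two plans with the same pattern, that is, which agree on which tasks get equal users and
  which get equivalent users, satisfy the same constraints, since an injection between sets of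
  users extends to a permutation of \<open>U\<close>. A pattern is coded by one digit below \<open>2k\<close> per task,
  so there are at most \<open>(2k)\<^sup>k\<close> of them, and the solver tries them all. A given pattern is realized
  in polynomial time by two nested bipartite matchings: an outer one of classes of tasks with
  equivalence classes of users, and, deciding adjacency in the outer one, an inner one
  of groups of tasks with the users of one equivalence class that are authorized for the group.
  Both are computed by an auction. Every plan found is verified by queries before it is
  output, so soundness is immediate.\<close>

section \<open>Loop programs\<close>

text \<open>The only loops count up to one of the input registers 0, 1 and 2, which a well-formed program
  never overwrites. Such a program denotes a total state transformer, and a polynomial bound on
  its running time can be read off the syntax.\<close>

datatype prog =
    PSkip
  | PAssign nat exp
  | PStore nat exp exp
  | PSeq prog prog (infixr ";;" 60)
  | PIf exp prog prog
  | PFor nat nat prog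
  | PAuth nat exp exp
  | PCheck nat exp nat

primrec compile :: "prog \<Rightarrow> com" where
  "compile PSkip = Skip"
| "compile (PAssign x e) = Assign x e"
| "compile (PStore a e e') = Store a e e'"
| "compile (p ;; q) = Seq (compile p) (compile q)"
| "compile (PIf e p q) = If e (compile p) (compile q)"
| "compile (PFor x r p) = Seq (Assign x (Const 0))
     (While (Sub (Reg r) (Reg x)) (Seq (compile p) (Assign x (Add (Reg x) (Const 1)))))"
| "compile (PAuth x e e') = AuthQ x e e'"
| "compile (PCheck x e a) = CheckQ x e a"

primrec for_iterate :: "nat \<Rightarrow> (state \<Rightarrow> state) \<Rightarrow> nat \<Rightarrow> state \<Rightarrow> state" where
  "for_iterate x f 0 \<sigma> = set_reg x 0 \<sigma>"
| "for_iterate x f (Suc i) \<sigma> = (let \<tau> = f (for_iterate x f i \<sigma>) in set_reg x (Suc (fst \<tau> x)) \<tau>)"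

primrec den :: "queries \<Rightarrow> prog \<Rightarrow> state \<Rightarrow> state" where
  "den Q PSkip = (\<lambda>\<sigma>. \<sigma>)"
| "den Q (PAssign x e) = (\<lambda>\<sigma>. set_reg x (eval_exp e \<sigma>) \<sigma>)"
| "den Q (PStore a e e') = (\<lambda>\<sigma>. set_cell a (eval_exp e \<sigma>) (eval_exp e' \<sigma>) \<sigma>)"
| "den Q (p ;; q) = (\<lambda>\<sigma>. den Q q (den Q p \<sigma>))"
| "den Q (PIf e p q) = (\<lambda>\<sigma>. if eval_exp e \<sigma> \<noteq> 0 then den Q p \<sigma> else den Q q \<sigma>)"
| "den Q (PFor x r p) = (\<lambda>\<sigma>. for_iterate x (den Q p) (fst \<sigma> r) \<sigma>)"
| "den Q (PAuth x e e') = (\<lambda>\<sigma>.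
     set_reg x (of_bool (auth_query Q (eval_exp e \<sigma>) (eval_exp e' \<sigma>))) \<sigma>)"
| "den Q (PCheck x e a) = (\<lambda>\<sigma>.
     set_reg x (of_bool (check_query Q (eval_exp e \<sigma>) (snd \<sigma> a))) \<sigma>)"

primrec mod_regs :: "prog \<Rightarrow> nat set" where
  "mod_regs PSkip = {}"
| "mod_regs (PAssign x e) = {x}"
| "mod_regs (PStore a e e') = {}"
| "mod_regs (p ;; q) = mod_regs p \<union> mod_regs q"
| "mod_regs (PIf e p q) = mod_regs p \<union> mod_regs q"
| "mod_regs (PFor x r p) = insert x (mod_regs p)"
| "mod_regs (PAuth x e e') = {x}"
| "mod_regs (PCheck x e a) = {x}"

primrec mod_arrs :: "prog \<Rightarrow> nat set" where
  "mod_arrs PSkip = {}"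
| "mod_arrs (PAssign x e) = {}"
| "mod_arrs (PStore a e e') = {a}"
| "mod_arrs (p ;; q) = mod_arrs p \<union> mod_arrs q"
| "mod_arrs (PIf e p q) = mod_arrs p \<union> mod_arrs q"
| "mod_arrs (PFor x r p) = mod_arrs p"
| "mod_arrs (PAuth x e e') = {}"
| "mod_arrs (PCheck x e a) = {}"

primrec wf_prog :: "prog \<Rightarrow> bool" where
  "wf_prog PSkip = True"
| "wf_prog (PAssign x e) = (2 < x)"
| "wf_prog (PStore a e e') = True"
| "wf_prog (p ;; q) = (wf_prog p \<and> wf_prog q)"
| "wf_prog (PIf e p q) = (wf_prog p \<and> wf_prog q)"
| "wf_prog (PFor x r p) = (wf_prog p \<and> 2 < x \<and> x \<notin> mod_regs p \<and> r \<le> 2)"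
| "wf_prog (PAuth x e e') = (2 < x)"
| "wf_prog (PCheck x e a) = (2 < x)"

lemma wf_prog_mod_regs: "wf_prog p \<Longrightarrow> x \<in> mod_regs p \<Longrightarrow> 2 < x"
  by (induction p) auto

lemma set_simps [simp]:
  "fst (set_reg x v \<sigma>) = (fst \<sigma>)(x := v)" "snd (set_reg x v \<sigma>) = snd \<sigma>"
  "fst (set_cell a i v \<sigma>) = fst \<sigma>" "snd (set_cell a i v \<sigma>) = (snd \<sigma>)(a := (snd \<sigma> a)(i := v))"
  by (simp_all add: set_reg_def set_cell_def)

definition agree_off :: "nat set \<Rightarrow> nat set \<Rightarrow> state \<Rightarrow> state \<Rightarrow> bool" where
  "agree_off X Y \<sigma> \<sigma>' \<longleftrightarrow>
     (\<forall>x. x \<notin> X \<longrightarrow> fst \<sigma>' x = fst \<sigma> x) \<and> (\<forall>a. a \<notin> Y \<longrightarrow> snd \<sigma>' a = snd \<sigma> a)"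

lemma agree_off_regD: "agree_off X Y \<sigma> \<sigma>' \<Longrightarrow> x \<notin> X \<Longrightarrow> fst \<sigma>' x = fst \<sigma> x"
  and agree_off_arrD: "agree_off X Y \<sigma> \<sigma>' \<Longrightarrow> a \<notin> Y \<Longrightarrow> snd \<sigma>' a = snd \<sigma> a"
  by (simp_all add: agree_off_def)

lemma agree_off_refl [simp]: "agree_off X Y \<sigma> \<sigma>"
  by (simp add: agree_off_def)

lemma agree_off_trans: "agree_off X Y \<sigma> \<sigma>' \<Longrightarrow> agree_off X Y \<sigma>' \<sigma>'' \<Longrightarrow> agree_off X Y \<sigma> \<sigma>''"
  by (simp add: agree_off_def)

lemma agree_off_mono: "agree_off X Y \<sigma> \<sigma>' \<Longrightarrow> X \<subseteq> X' \<Longrightarrow> Y \<subseteq> Y' \<Longrightarrow> agree_off X' Y' \<sigma> \<sigma>'"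
  unfolding agree_off_def by blast

lemma agree_off_set_reg [simp]: "x \<in> X \<Longrightarrow> agree_off X Y \<sigma> (set_reg x v \<sigma>)"
  by (auto simp: agree_off_def)

lemma agree_off_for_iterate:
  assumes "\<And>\<tau>. agree_off X Y \<tau> (f \<tau>)"
  shows "agree_off (insert x X) Y \<sigma> (for_iterate x f i \<sigma>)"
proof (induction i)
  case (Suc i)
  have "agree_off (insert x X) Y (for_iterate x f i \<sigma>) (for_iterate x f (Suc i) \<sigma>)"
    using assms[of "for_iterate x f i \<sigma>"] by (auto simp: agree_off_def Let_def)
  with Suc show ?case by (rule agree_off_trans)
qed simp

lemma agree_off_den: "agree_off (mod_regs p) (mod_arrs p) \<sigma> (den Q p \<sigma>)"
proof (induction p arbitrary: \<sigma>)
  case (PSeq p q)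
  have "agree_off (mod_regs (p ;; q)) (mod_arrs (p ;; q)) \<sigma> (den Q p \<sigma>)"
    by (rule agree_off_mono[OF PSeq.IH(1)]) auto
  moreover have "agree_off (mod_regs (p ;; q)) (mod_arrs (p ;; q)) (den Q p \<sigma>) (den Q (p ;; q) \<sigma>)"
    unfolding den.simps by (rule agree_off_mono[OF PSeq.IH(2)]) auto
  ultimately show ?case by (rule agree_off_trans)
next
  case (PIf e p q)
  show ?case
    using agree_off_mono[OF PIf.IH(1)] agree_off_mono[OF PIf.IH(2)] by simp
next
  case (PFor x r p)
  show ?case by (simp add: agree_off_for_iterate PFor.IH)
qed (auto simp: agree_off_def)

lemma den_reg: "x \<notin> mod_regs p \<Longrightarrow> fst (den Q p \<sigma>) x = fst \<sigma> x"
  by (rule agree_off_regD[OF agree_off_den])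

lemma den_arr: "a \<notin> mod_arrs p \<Longrightarrow> snd (den Q p \<sigma>) a = snd \<sigma> a"
  by (rule agree_off_arrD[OF agree_off_den])

lemma den_input_reg: "wf_prog p \<Longrightarrow> r \<le> 2 \<Longrightarrow> fst (den Q p \<sigma>) r = fst \<sigma> r"
  using wf_prog_mod_regs by (intro den_reg) force

lemma for_iterate_den_Suc:
  assumes "x \<notin> mod_regs p"
  shows "for_iterate x (den Q p) (Suc i) \<sigma> =
    set_reg x (Suc i) (den Q p (for_iterate x (den Q p) i \<sigma>))"
proof -
  have "fst (for_iterate x (den Q p) i \<sigma>) x = i" for i
    by (induction i) (simp_all add: Let_def den_reg assms)
  then show ?thesis by (simp add: Let_def den_reg assms)
qed

lemma for_iterate_counter: "x \<notin> mod_regs p \<Longrightarrow> fst (for_iterate x (den Q p) i \<sigma>) x = i"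
  by (cases i) (simp_all add: for_iterate_den_Suc del: for_iterate.simps(2))

lemma for_iterate_input:
  assumes "wf_prog (PFor x r p)" "y \<le> 2"
  shows "fst (for_iterate x (den Q p) i \<sigma>) y = fst \<sigma> y"
  using assms by (induction i) (auto simp: Let_def den_input_reg)

lemma den_for:
  assumes fresh: "x \<notin> mod_regs p"
    and start: "I 0 (set_reg x 0 \<sigma>)"
    and step: "\<And>i \<tau>. i < fst \<sigma> r \<Longrightarrow> I i \<tau> \<Longrightarrow> fst \<tau> x = i \<Longrightarrow>
      agree_off (insert x (mod_regs p)) (mod_arrs p) \<sigma> \<tau> \<Longrightarrow>
      I (Suc i) (set_reg x (Suc i) (den Q p \<tau>))"
  shows "I (fst \<sigma> r) (den Q (PFor x r p) \<sigma>)"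
proof -
  have "I i (for_iterate x (den Q p) i \<sigma>)" if "i \<le> fst \<sigma> r" for i
    using that
  proof (induction i)
    case 0
    show ?case using start by simp
  next
    case (Suc i)
    have "agree_off (insert x (mod_regs p)) (mod_arrs p) \<sigma> (for_iterate x (den Q p) i \<sigma>)"
      by (rule agree_off_for_iterate) (rule agree_off_den)
    then show ?case
      unfolding for_iterate_den_Suc[OF fresh]
      using Suc by (intro step) (simp_all add: for_iterate_counter[OF fresh])
  qed
  then show ?thesis by simp
qed

subsection \<open>Running time\<close>

lemma exec_while_counted:
  assumes step: "\<And>i \<sigma>. i < N \<Longrightarrow> I i \<sigma> \<Longrightarrow>
      eval_exp e \<sigma> \<noteq> 0 \<and> (\<exists>t \<sigma>'. exec Q c \<sigma> t \<sigma>' \<and> real t \<le> T \<and> I (Suc i) \<sigma>')"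
    and stop: "\<And>\<sigma>. I N \<sigma> \<Longrightarrow> eval_exp e \<sigma> = 0"
    and start: "I 0 \<sigma>"
  shows "\<exists>t \<sigma>'. exec Q (While e c) \<sigma> t \<sigma>' \<and> I N \<sigma>' \<and>
    real t \<le> real N * (1 + real (exp_time e) + T) + 1 + real (exp_time e)"
proof -
  have "\<exists>t \<sigma>'. exec Q (While e c) \<sigma> t \<sigma>' \<and> I N \<sigma>' \<and>
      real t \<le> real j * (1 + real (exp_time e) + T) + 1 + real (exp_time e)"
    if "I i \<sigma>" "i + j = N" for i j \<sigma>
    using that
  proof (induction j arbitrary: i \<sigma>)
    case 0
    then show ?case using exec.While_False[OF stop] by fastforce
  next
    case (Suc j)
    then obtain t \<tau> where body: "eval_exp e \<sigma> \<noteq> 0" "exec Q c \<sigma> t \<tau>" "real t \<le> T" "I (Suc i) \<tau>"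
      using step[of i \<sigma>] by auto
    obtain t' \<sigma>' where rest: "exec Q (While e c) \<tau> t' \<sigma>'" "I N \<sigma>'"
        "real t' \<le> real j * (1 + real (exp_time e) + T) + 1 + real (exp_time e)"
      using Suc.IH[OF body(4)] Suc.prems(2) by auto
    have "exec Q (While e c) \<sigma> (1 + exp_time e + t + t') \<sigma>'"
      by (rule exec.While_True[OF body(1,2) rest(1)])
    moreover have "real (1 + exp_time e + t + t') \<le>
        real (Suc j) * (1 + real (exp_time e) + T) + 1 + real (exp_time e)"
      using body(3) rest(3) by (simp add: algebra_simps)
    ultimately show ?case using rest(2) by blast
  qed
  from this[of 0 \<sigma> N] start show ?thesis by simp
qed

text \<open>The argument \<open>N\<close> gives the values of the input registers, and \<open>\<tau>\<close> is the query time.\<close>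

primrec cost :: "prog \<Rightarrow> (nat \<Rightarrow> real) \<Rightarrow> real \<Rightarrow> real" where
  "cost PSkip N \<tau> = 1"
| "cost (PAssign x e) N \<tau> = 1 + real (exp_time e)"
| "cost (PStore a e e') N \<tau> = 1 + real (exp_time e) + real (exp_time e')"
| "cost (p ;; q) N \<tau> = 1 + cost p N \<tau> + cost q N \<tau>"
| "cost (PIf e p q) N \<tau> = 1 + real (exp_time e) + (cost p N \<tau> + cost q N \<tau>)"
| "cost (PFor x r p) N \<tau> = 7 + N r * (9 + cost p N \<tau>)"
| "cost (PAuth x e e') N \<tau> = 1 + real (exp_time e) + real (exp_time e') + \<tau>"
| "cost (PCheck x e a) N \<tau> = 1 + real (exp_time e) + \<tau>"

lemma cost_nonneg: "(\<And>r. 0 \<le> N r) \<Longrightarrow> 0 \<le> \<tau> \<Longrightarrow> 0 \<le> cost p N \<tau>"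
  by (induction p) auto

lemma cost_mono: "(\<And>r. 0 \<le> N r) \<Longrightarrow> \<tau> \<le> \<tau>' \<Longrightarrow> cost p N \<tau> \<le> cost p N \<tau>'"
  by (induction p) (auto intro: mult_left_mono add_mono)

lemma cost_cong: "wf_prog p \<Longrightarrow> (\<And>r. r \<le> 2 \<Longrightarrow> N r = N' r) \<Longrightarrow> cost p N \<tau> = cost p N' \<tau>"
  by (induction p) auto

definition sizes :: "nat \<Rightarrow> nat \<Rightarrow> nat \<Rightarrow> nat \<Rightarrow> real" where
  "sizes n k m r = (if r = 0 then real n else if r = 1 then real k else real m)"

lemma sizes_nonneg: "0 \<le> sizes n k m r"
  by (simp add: sizes_def)

lemma polynomial3_cost:
  assumes "polynomial3 f"
  shows "polynomial3 (\<lambda>n k m. cost p (sizes n k m) (f n k m))"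
proof (induction p)
  case (PFor x r p)
  have "polynomial3 (\<lambda>n k m. sizes n k m r)"
    by (cases "r = 0"; cases "r = 1") (simp_all add: sizes_def polynomial3.intros)
  then show ?case using PFor by (simp add: polynomial3.intros)
qed (use assms in \<open>simp_all add: polynomial3.intros\<close>)

abbreviation exec_within :: "queries \<Rightarrow> prog \<Rightarrow> state \<Rightarrow> real \<Rightarrow> bool" where
  "exec_within Q p \<sigma> T \<equiv> \<exists>t. exec Q (compile p) \<sigma> t (den Q p \<sigma>) \<and> real t \<le> T"

abbreviation run_cost :: "queries \<Rightarrow> prog \<Rightarrow> state \<Rightarrow> real" where
  "run_cost Q p \<sigma> \<equiv> cost p (\<lambda>r. real (fst \<sigma> r)) (real (query_time Q))"

lemma run_cost_eq:
  "wf_prog p \<Longrightarrow> (\<And>r. r \<le> 2 \<Longrightarrow> fst \<sigma> r = fst \<sigma>' r) \<Longrightarrow> run_cost Q p \<sigma> = run_cost Q p \<sigma>'"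
  by (rule cost_cong) auto

lemma exec_compile_seq:
  assumes wf: "wf_prog p"
    and exec_first: "exec_within Q p \<sigma> (run_cost Q p \<sigma>)"
    and exec_second: "exec_within Q q (den Q p \<sigma>) (run_cost Q q (den Q p \<sigma>))" "wf_prog q"
  shows "exec_within Q (p ;; q) \<sigma> (run_cost Q (p ;; q) \<sigma>)"
proof -
  obtain t where run_first: "exec Q (compile p) \<sigma> t (den Q p \<sigma>)" "real t \<le> run_cost Q p \<sigma>"
    using exec_first by blast
  obtain u where run_second: "exec Q (compile q) (den Q p \<sigma>) u (den Q q (den Q p \<sigma>))"
      "real u \<le> run_cost Q q (den Q p \<sigma>)"
    using exec_second(1) by blast
  have "run_cost Q q (den Q p \<sigma>) = run_cost Q q \<sigma>"
    by (rule run_cost_eq[OF exec_second(2)]) (rule den_input_reg[OF wf])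
  then show ?thesis using exec.Seq[OF run_first(1) run_second(1)] run_first(2) run_second(2)
    by force
qed

lemma exec_compile_if:
  assumes exec_then: "exec_within Q p \<sigma> (run_cost Q p \<sigma>)"
    and exec_else: "exec_within Q q \<sigma> (run_cost Q q \<sigma>)"
  shows "exec_within Q (PIf e p q) \<sigma> (run_cost Q (PIf e p q) \<sigma>)"
proof -
  have nonneg: "0 \<le> run_cost Q p \<sigma>" "0 \<le> run_cost Q q \<sigma>" by (auto intro: cost_nonneg)
  show ?thesis
  proof (cases "eval_exp e \<sigma> = 0")
    case True
    obtain t where run: "exec Q (compile q) \<sigma> t (den Q q \<sigma>)" "real t \<le> run_cost Q q \<sigma>"
      using exec_else by blast
    show ?thesis using exec.If_False[OF True run(1), of "compile p"] run(2) nonneg True by force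
  next
    case False
    obtain t where run: "exec Q (compile p) \<sigma> t (den Q p \<sigma>)" "real t \<le> run_cost Q p \<sigma>"
      using exec_then by blast
    show ?thesis using exec.If_True[OF False run(1), of "compile q"] run(2) nonneg False by force
  qed
qed

lemma exec_compile_for:
  assumes wf: "wf_prog (PFor x r p)"
    and body: "\<And>\<tau>. exec_within Q p \<tau> (run_cost Q p \<tau>)"
  shows "exec_within Q (PFor x r p) \<sigma> (run_cost Q (PFor x r p) \<sigma>)"
proof -
  have fresh: "x \<notin> mod_regs p" "r \<le> 2" and wf_body: "wf_prog p" using wf by auto
  define I where "I = (\<lambda>i \<tau>. \<tau> = for_iterate x (den Q p) i \<sigma>)"
  have inputs: "fst \<tau> y = fst \<sigma> y" if "I i \<tau>" "y \<le> 2" for i \<tau> y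
    using that(1) for_iterate_input[OF wf that(2)] by (simp add: I_def)
  let ?test = "Sub (Reg r) (Reg x)" and ?incr = "Assign x (Add (Reg x) (Const 1))"
  have test: "eval_exp ?test \<tau> = fst \<sigma> r - i" if "I i \<tau>" for i \<tau>
    using that inputs[OF that fresh(2)] by (simp add: I_def for_iterate_counter[OF fresh(1)])
  have "\<exists>t \<sigma>'. exec Q (While ?test (Seq (compile p) ?incr)) (set_reg x 0 \<sigma>) t \<sigma>' \<and>
      I (fst \<sigma> r) \<sigma>' \<and> real t \<le> real (fst \<sigma> r) *
        (1 + real (exp_time ?test) + (run_cost Q p \<sigma> + 5)) + 1 + real (exp_time ?test)"
  proof (rule exec_while_counted)
    fix i \<tau> assume iterate: "i < fst \<sigma> r" "I i \<tau>"
    obtain t where run: "exec Q (compile p) \<tau> t (den Q p \<tau>)" "real t \<le> run_cost Q p \<tau>"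
      using body by blast
    have "run_cost Q p \<tau> = run_cost Q p \<sigma>" by (rule run_cost_eq[OF wf_body inputs[OF iterate(2)]])
    moreover have "I (Suc i) (set_reg x (Suc i) (den Q p \<tau>))"
      using iterate(2) for_iterate_den_Suc[OF fresh(1)] by (simp add: I_def)
    moreover have "fst (den Q p \<tau>) x = i"
      using iterate(2) by (simp add: I_def for_iterate_counter[OF fresh(1)] den_reg[OF fresh(1)])
    then have "exec Q (Seq (compile p) ?incr) \<tau> (t + 5) (set_reg x (Suc i) (den Q p \<tau>))"
      using exec.Seq[OF run(1) exec.Assign[of Q x "Add (Reg x) (Const 1)"]]
      by (simp add: eval_nat_numeral)
    moreover have "real (t + 5) \<le> run_cost Q p \<tau> + 5" using run(2) by simp
    moreover have "eval_exp ?test \<tau> \<noteq> 0" using test[OF iterate(2)] iterate(1) by simp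
    ultimately show "eval_exp ?test \<tau> \<noteq> 0 \<and> (\<exists>t \<sigma>'. exec Q (Seq (compile p) ?incr) \<tau> t \<sigma>' \<and>
        real t \<le> run_cost Q p \<sigma> + 5 \<and> I (Suc i) \<sigma>')"
      by metis
  qed (simp_all only: test diff_self_eq_0, simp add: I_def)
  then obtain t where loop: "exec Q (While ?test (Seq (compile p) ?incr)) (set_reg x 0 \<sigma>) t
        (den Q (PFor x r p) \<sigma>)" "real t \<le> 4 + real (fst \<sigma> r) * (9 + run_cost Q p \<sigma>)"
    by (auto simp: I_def algebra_simps)
  have "exec Q (compile (PFor x r p)) \<sigma> (3 + t) (den Q (PFor x r p) \<sigma>)"
    using exec.Seq[OF exec.Assign[of Q x "Const 0" \<sigma>, unfolded eval_exp.simps] loop(1)]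
    by (simp add: eval_nat_numeral)
  then show ?thesis using loop(2) by (intro exI[of _ "3 + t"]) simp
qed

lemma exec_compile: "wf_prog p \<Longrightarrow> exec_within Q p \<sigma> (run_cost Q p \<sigma>)"
proof (induction p arbitrary: \<sigma>)
  case PSkip
  show ?case using exec.Skip[of Q \<sigma>] by force
next
  case (PAssign x e)
  show ?case using exec.Assign[of Q x e \<sigma>] by force
next
  case (PStore a e e')
  show ?case using exec.Store[of Q a e e' \<sigma>] by force
next
  case (PSeq p q)
  show ?case by (rule exec_compile_seq) (use PSeq in simp_all)
next
  case (PIf e p q)
  show ?case by (rule exec_compile_if) (use PIf in simp_all)
next
  case (PFor x r p)
  show ?case by (rule exec_compile_for) (use PFor in auto)
next
  case (PAuth x e e')
  show ?case using exec.AuthQ[of Q x e e' \<sigma>] by force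
next
  case (PCheck x e a)
  show ?case using exec.CheckQ[of Q x e a \<sigma>] by force
qed

subsection \<open>Loop idioms\<close>

definition neq_exp :: "exp \<Rightarrow> exp \<Rightarrow> exp" where
  "neq_exp e e' = Add (Sub e e') (Sub e' e)"

definition eq_exp :: "exp \<Rightarrow> exp \<Rightarrow> exp" where
  "eq_exp e e' = Sub (Const 1) (neq_exp e e')"

text \<open>With truncated subtraction, \<open>e - (e - e')\<close> is the minimum of the two values.\<close>

definition conj_exp :: "exp \<Rightarrow> exp \<Rightarrow> exp" where
  "conj_exp e e' = Sub e (Sub e e')"

lemma test_exp_simps [simp]:
  "(eval_exp (neq_exp e e') \<sigma> = 0) = (eval_exp e \<sigma> = eval_exp e' \<sigma>)"
  "(eval_exp (eq_exp e e') \<sigma> = 0) = (eval_exp e \<sigma> \<noteq> eval_exp e' \<sigma>)"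
  "(eval_exp (conj_exp e e') \<sigma> = 0) = (eval_exp e \<sigma> = 0 \<or> eval_exp e' \<sigma> = 0)"
  by (auto simp: neq_exp_def eq_exp_def conj_exp_def)

definition store_loop :: "nat \<Rightarrow> nat \<Rightarrow> prog \<Rightarrow> exp \<Rightarrow> nat \<Rightarrow> exp \<Rightarrow> prog" where
  "store_loop x r p t a e = PFor x r (p ;; PIf t (PStore a (Reg x) e) PSkip)"

abbreviation fill_loop :: "nat \<Rightarrow> nat \<Rightarrow> prog \<Rightarrow> nat \<Rightarrow> exp \<Rightarrow> prog" where
  "fill_loop x r p a e \<equiv> store_loop x r p (Const 1) a e"

definition all_loop :: "nat \<Rightarrow> nat \<Rightarrow> nat \<Rightarrow> prog \<Rightarrow> exp \<Rightarrow> prog" where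
  "all_loop y x r p t = PAssign y (Const 1) ;; PFor x r (p ;; PIf t PSkip (PAssign y (Const 0)))"

text \<open>Register \<open>y\<close> keeps the value of \<open>r\<close> until the first index that passes the test.\<close>

definition argmin_loop :: "nat \<Rightarrow> nat \<Rightarrow> nat \<Rightarrow> prog \<Rightarrow> exp \<Rightarrow> (exp \<Rightarrow> exp) \<Rightarrow> prog" where
  "argmin_loop y x r p t key = PAssign y (Reg r) ;;
     PFor x r (p ;;
       PIf (conj_exp t (Add (eq_exp (Reg y) (Reg r)) (Sub (key (Reg y)) (key (Reg x)))))
       (PAssign y (Reg x)) PSkip)"

lemma loop_idiom_mods [simp]:
  "mod_regs (store_loop x r p t a e) = insert x (mod_regs p)"
  "mod_arrs (store_loop x r p t a e) = insert a (mod_arrs p)"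
  "mod_regs (all_loop y x r p t) = insert y (insert x (mod_regs p))"
  "mod_arrs (all_loop y x r p t) = mod_arrs p"
  "mod_regs (argmin_loop y x r p t key) = insert y (insert x (mod_regs p))"
  "mod_arrs (argmin_loop y x r p t key) = mod_arrs p"
  by (auto simp: store_loop_def all_loop_def argmin_loop_def)

lemma wf_loop_idioms [simp]:
  "wf_prog (store_loop x r p t a e) \<longleftrightarrow> wf_prog p \<and> 2 < x \<and> x \<notin> mod_regs p \<and> r \<le> 2"
  "wf_prog (all_loop y x r p t) \<longleftrightarrow>
     wf_prog p \<and> 2 < x \<and> 2 < y \<and> x \<noteq> y \<and> x \<notin> mod_regs p \<and> r \<le> 2"
  "wf_prog (argmin_loop y x r p t key) \<longleftrightarrow>
     wf_prog p \<and> 2 < x \<and> 2 < y \<and> x \<noteq> y \<and> x \<notin> mod_regs p \<and> r \<le> 2"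
  by (auto simp: store_loop_def all_loop_def argmin_loop_def)

lemma den_store_loop:
  assumes fresh: "x \<notin> mod_regs p" "a \<notin> mod_arrs p"
    and body: "\<And>i \<tau>. i < fst \<sigma> r \<Longrightarrow> fst \<tau> x = i \<Longrightarrow>
      agree_off (insert x (mod_regs p)) (insert a (mod_arrs p)) \<sigma> \<tau> \<Longrightarrow>
      (\<And>j. snd \<tau> a j = (if j < i \<and> T j then v j else snd \<sigma> a j)) \<Longrightarrow>
      (eval_exp t (den Q p \<tau>) \<noteq> 0 \<longleftrightarrow> T i) \<and> (T i \<longrightarrow> eval_exp e (den Q p \<tau>) = v i)"
  shows "snd (den Q (store_loop x r p t a e) \<sigma>) a j =
    (if j < fst \<sigma> r \<and> T j then v j else snd \<sigma> a j)"
proof -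
  define I where "I = (\<lambda>i (\<tau>::state). \<forall>j. snd \<tau> a j = (if j < i \<and> T j then v j else snd \<sigma> a j))"
  have "I (fst \<sigma> r) (den Q (store_loop x r p t a e) \<sigma>)"
    unfolding store_loop_def
  proof (rule den_for[where I = I])
    fix i \<tau>
    assume iterate: "i < fst \<sigma> r" "I i \<tau>" "fst \<tau> x = i"
      and "agree_off (insert x (mod_regs (p ;; PIf t (PStore a (Reg x) e) PSkip)))
        (mod_arrs (p ;; PIf t (PStore a (Reg x) e) PSkip)) \<sigma> \<tau>"
    then have "(eval_exp t (den Q p \<tau>) \<noteq> 0 \<longleftrightarrow> T i) \<and> (T i \<longrightarrow> eval_exp e (den Q p \<tau>) = v i)"
      by (intro body) (simp_all add: I_def)
    then show "I (Suc i) (set_reg x (Suc i) (den Q (p ;; PIf t (PStore a (Reg x) e) PSkip) \<tau>))"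
      using iterate fresh by (auto simp: I_def less_Suc_eq den_reg den_arr)
  qed (simp_all add: fresh I_def)
  then show ?thesis by (simp add: I_def)
qed

lemma den_fill_loop:
  assumes "x \<notin> mod_regs p" "a \<notin> mod_arrs p"
    and "\<And>i \<tau>. i < fst \<sigma> r \<Longrightarrow> fst \<tau> x = i \<Longrightarrow>
      agree_off (insert x (mod_regs p)) (insert a (mod_arrs p)) \<sigma> \<tau> \<Longrightarrow>
      eval_exp e (den Q p \<tau>) = v i"
  shows "snd (den Q (fill_loop x r p a e) \<sigma>) a j = (if j < fst \<sigma> r then v j else snd \<sigma> a j)"
  using den_store_loop[OF assms(1,2), where T = "\<lambda>_. True" and t = "Const 1"] assms(3) by simp

lemma den_all_loop:
  assumes fresh: "x \<notin> mod_regs p" "y \<notin> mod_regs p" "x \<noteq> y" "r \<noteq> y"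
    and body: "\<And>i \<tau>. i < fst \<sigma> r \<Longrightarrow> fst \<tau> x = i \<Longrightarrow>
      agree_off (insert y (insert x (mod_regs p))) (mod_arrs p) \<sigma> \<tau> \<Longrightarrow>
      eval_exp t (den Q p \<tau>) \<noteq> 0 \<longleftrightarrow> T i"
  shows "fst (den Q (all_loop y x r p t) \<sigma>) y = of_bool (\<forall>i<fst \<sigma> r. T i)"
proof -
  let ?\<sigma> = "set_reg y 1 \<sigma>" and ?body = "p ;; PIf t PSkip (PAssign y (Const 0))"
  define I where "I = (\<lambda>i (\<tau>::state). fst \<tau> y = of_bool (\<forall>j<i. T j))"
  have "I (fst ?\<sigma> r) (den Q (PFor x r ?body) ?\<sigma>)"
  proof (rule den_for[where I = I])
    fix i \<tau>
    assume iterate: "i < fst ?\<sigma> r" "I i \<tau>" "fst \<tau> x = i"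
      and "agree_off (insert x (mod_regs ?body)) (mod_arrs ?body) ?\<sigma> \<tau>"
    then have "eval_exp t (den Q p \<tau>) \<noteq> 0 \<longleftrightarrow> T i"
      using fresh by (intro body) (auto simp: agree_off_def)
    then show "I (Suc i) (set_reg x (Suc i) (den Q ?body \<tau>))"
      using iterate fresh by (auto simp: I_def less_Suc_eq den_reg)
  qed (use fresh in \<open>auto simp: I_def\<close>)
  then show ?thesis using fresh by (simp add: I_def all_loop_def)
qed

lemma is_arg_min_less_Suc:
  fixes h :: "nat \<Rightarrow> 'a :: linorder"
  assumes "if \<exists>j<i. T j then is_arg_min h (\<lambda>j. j < i \<and> T j) w else w = r"
    and "w' = (if T i \<and> (\<not> (\<exists>j<i. T j) \<or> h i < h w) then i else w)"
  shows "if \<exists>j<Suc i. T j then is_arg_min h (\<lambda>j. j < Suc i \<and> T j) w' else w' = r"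
proof (cases "\<exists>j<i. T j")
  case True
  then have "is_arg_min h (\<lambda>j. j < i \<and> T j) w" using assms(1) by simp
  then have "is_arg_min h (\<lambda>j. j < Suc i \<and> T j) w'"
    using assms(2) by (auto simp: is_arg_min_linorder less_Suc_eq)
  then show ?thesis using True less_SucI by auto
next
  case False
  then show ?thesis using assms by (auto simp: is_arg_min_linorder less_Suc_eq)
qed

lemma den_argmin_loop:
  assumes fresh: "x \<notin> mod_regs p" "y \<notin> mod_regs p" "x \<noteq> y" "r \<notin> insert y (insert x (mod_regs p))"
    and body: "\<And>i \<tau>. i < fst \<sigma> r \<Longrightarrow> fst \<tau> x = i \<Longrightarrow>
      agree_off (insert y (insert x (mod_regs p))) (mod_arrs p) \<sigma> \<tau> \<Longrightarrow>
      eval_exp t (den Q p \<tau>) \<noteq> 0 \<longleftrightarrow> T i"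
    and key: "\<And>w \<tau>. agree_off (insert y (insert x (mod_regs p))) (mod_arrs p) \<sigma> \<tau> \<Longrightarrow>
      eval_exp (key (Reg w)) \<tau> = h (fst \<tau> w)"
  defines "\<sigma>' \<equiv> den Q (argmin_loop y x r p t key) \<sigma>"
  shows "if \<exists>i<fst \<sigma> r. T i then is_arg_min h (\<lambda>i. i < fst \<sigma> r \<and> T i) (fst \<sigma>' y)
    else fst \<sigma>' y = fst \<sigma> r"
proof -
  let ?\<sigma> = "set_reg y (fst \<sigma> r) \<sigma>"
  let ?better = "Add (eq_exp (Reg y) (Reg r)) (Sub (key (Reg y)) (key (Reg x)))"
  let ?body = "p ;; PIf (conj_exp t ?better) (PAssign y (Reg x)) PSkip"
  define I where "I = (\<lambda>i (\<tau>::state). if \<exists>j<i. T j then is_arg_min h (\<lambda>j. j < i \<and> T j) (fst \<tau> y)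
    else fst \<tau> y = fst \<sigma> r)"
  have "I (fst ?\<sigma> r) (den Q (PFor x r ?body) ?\<sigma>)"
  proof (rule den_for[where I = I])
    fix i \<tau>
    assume iterate: "i < fst ?\<sigma> r" "I i \<tau>" "fst \<tau> x = i"
      and frame: "agree_off (insert x (mod_regs ?body)) (mod_arrs ?body) ?\<sigma> \<tau>"
    let ?\<tau> = "den Q p \<tau>"
    have frame: "agree_off (insert y (insert x (mod_regs p))) (mod_arrs p) \<sigma> \<tau>"
      using frame by (auto simp: agree_off_def)
    then have test: "eval_exp t ?\<tau> \<noteq> 0 \<longleftrightarrow> T i"
      using iterate fresh by (intro body) auto
    have "agree_off (insert y (insert x (mod_regs p))) (mod_arrs p) \<sigma> ?\<tau>"
      using frame agree_off_den[of p \<tau> Q] by (auto simp: agree_off_def)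
    then have "eval_exp ?better ?\<tau> \<noteq> 0 \<longleftrightarrow> fst \<tau> y = fst \<sigma> r \<or> h i < h (fst \<tau> y)"
      using key[of ?\<tau>] iterate(3) fresh frame by (auto simp: den_reg agree_off_def)
    moreover have "fst \<tau> y = fst \<sigma> r \<longleftrightarrow> \<not> (\<exists>j<i. T j)"
      using iterate(1,2) fresh(4) by (auto simp: I_def is_arg_min_def split: if_splits)
    ultimately have new: "fst (den Q ?body \<tau>) y =
        (if T i \<and> (\<not> (\<exists>j<i. T j) \<or> h i < h (fst \<tau> y)) then i else fst \<tau> y)"
      using test iterate(3) fresh by (auto simp: den_reg)
    show "I (Suc i) (set_reg x (Suc i) (den Q ?body \<tau>))"
      using is_arg_min_less_Suc[OF iterate(2)[unfolded I_def] new] fresh(3)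
      by (simp add: I_def del: den.simps)
  qed (use fresh in \<open>auto simp: I_def\<close>)
  then show ?thesis using fresh by (simp add: I_def \<sigma>'_def argmin_loop_def)
qed

section \<open>Bipartite matching by an auction\<close>

definition matching :: "('a \<Rightarrow> 'b \<Rightarrow> bool) \<Rightarrow> 'a set \<Rightarrow> 'b set \<Rightarrow> ('a \<Rightarrow> 'b) \<Rightarrow> bool" where
  "matching E A B f \<longleftrightarrow> inj_on f A \<and> f ` A \<subseteq> B \<and> (\<forall>a\<in>A. E a (f a))"

lemma matching_cong:
  assumes "\<And>a. a \<in> A \<Longrightarrow> f a = g a" "\<And>a b. a \<in> A \<Longrightarrow> b \<in> B \<Longrightarrow> E a b = F a b"
  shows "matching E A B f = matching F A B g"
proof -
  have "inj_on f A = inj_on g A" "f ` A = g ` A" using assms(1) by (auto cong: inj_on_cong)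
  then show ?thesis using assms unfolding matching_def by (metis image_subset_iff)
qed

definition auction_inv ::
  "('a \<Rightarrow> 'b \<Rightarrow> bool) \<Rightarrow> 'a set \<Rightarrow> 'b set \<Rightarrow> ('a \<rightharpoonup> 'b) \<Rightarrow> ('b \<Rightarrow> nat) \<Rightarrow> bool" where
  "auction_inv E A B mate price \<longleftrightarrow>
     dom mate \<subseteq> A \<and>
     (\<forall>a b. mate a = Some b \<longrightarrow> b \<in> B \<and> E a b) \<and>
     (\<forall>a a' b. mate a = Some b \<longrightarrow> mate a' = Some b \<longrightarrow> a = a') \<and>
     (\<forall>b\<in>B. 0 < price b \<longrightarrow> b \<in> ran mate) \<and>
     (\<forall>a b c. mate a = Some b \<longrightarrow> c \<in> B \<longrightarrow> E a c \<longrightarrow> price b \<le> price c + 1)"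

lemma auction_inv_dom: "auction_inv E A B mate price \<Longrightarrow> dom mate \<subseteq> A"
  by (simp add: auction_inv_def)

lemma auction_invD:
  assumes "auction_inv E A B mate price"
  shows "mate a = Some b \<Longrightarrow> a \<in> A" "mate a = Some b \<Longrightarrow> b \<in> B" "mate a = Some b \<Longrightarrow> E a b"
    and "mate a = Some b \<Longrightarrow> mate a' = Some b \<Longrightarrow> a = a'"
    and "b \<in> B \<Longrightarrow> 0 < price b \<Longrightarrow> \<exists>a. mate a = Some b"
    and "mate a = Some b \<Longrightarrow> c \<in> B \<Longrightarrow> E a c \<Longrightarrow> price b \<le> price c + 1"
  using assms unfolding auction_inv_def ran_def by blast+

lemma auction_inv_matching:
  assumes inv: "auction_inv E A B mate price" and "dom mate = A"
  shows "matching E A B (the \<circ> mate)"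
proof -
  have mate: "mate a = Some (the (mate a))" if "a \<in> A" for a using that assms(2) by force
  have "inj_on (the \<circ> mate) A"
    using mate auction_invD(4)[OF inv] by (intro inj_onI) (metis comp_apply)
  then show ?thesis
    using mate auction_invD(2,3)[OF inv] by (auto simp: matching_def)
qed

lemma exists_free_level:
  fixes f :: "'b \<Rightarrow> nat"
  assumes "finite X" "card X < k"
  obtains v where "1 \<le> v" "v \<le> k" "v \<notin> f ` X"
proof -
  have "card (f ` X) < card {1..k}" using card_image_le[OF assms(1), of f] assms(2) by simp
  then have "\<not> {1..k} \<subseteq> f ` X" using assms(1) by (meson card_mono finite_imageI leD)
  then obtain v where "v \<in> {1..k}" "v \<notin> f ` X" by blast
  then show ?thesis using that[of v] by simp
qed

lemma auction_inv_card_ran: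
  assumes "auction_inv E A B mate price" "finite A"
  shows "finite (ran mate)" "card (ran mate) \<le> card (dom mate)"
proof -
  have "finite (dom mate)" using auction_inv_dom[OF assms(1)] assms(2) by (rule finite_subset)
  moreover have "ran mate = (the \<circ> mate) ` dom mate" by (force simp: ran_def)
  ultimately show "finite (ran mate)" "card (ran mate) \<le> card (dom mate)"
    by (simp_all add: card_image_le)
qed

lemma auction_item_held:
  assumes "auction_inv E A B mate price" "1 \<le> v" "v \<notin> price ` ran mate" "b \<in> B" "v \<le> price b"
  obtains a where "mate a = Some b" "v < price b"
proof -
  obtain a where a: "mate a = Some b" using auction_invD(5)[OF assms(1,4)] assms(2,5) by auto
  moreover have "v \<noteq> price b" using assms(3) ranI[of mate, OF a] by blast
  ultimately show ?thesis using that assms(5) by simp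
qed

lemma auction_high_bidder_likes:
  assumes inv: "auction_inv E A B mate price" and free_level: "1 \<le> v" "v \<notin> price ` ran mate"
    and holds: "mate x = Some b" "v < price b" and likes: "c \<in> B" "E x c"
  obtains a where "mate a = Some c" "v < price c"
proof -
  have "v \<le> price c" using auction_invD(6)[OF inv holds(1) likes] holds(2) by simp
  then show ?thesis by (rule auction_item_held[OF inv free_level likes(1)]) (rule that)
qed

text \<open>Otherwise some price level \<open>v\<close> is not taken, and the bidders holding an item of
  price above \<open>v\<close>, together with \<open>a\<close>, only like the items of price above \<open>v\<close>, which are
  one too few.\<close>

lemma auction_cheap_item:
  assumes inv: "auction_inv E A B mate price" and perfect: "matching E A B M"
    and finite_A: "finite A" and unmatched: "a \<in> A" "mate a = None"
  shows "\<exists>b\<in>B. E a b \<and> price b < card A"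
proof (rule ccontr)
  assume "\<not> ?thesis"
  then have high: "card A \<le> price b" if "b \<in> B" "E a b" for b using that by force
  have "card (dom mate) < card A"
    using auction_inv_dom[OF inv] finite_A unmatched by (intro psubset_card_mono) auto
  then have "card (ran mate) < card A"
    using auction_inv_card_ran(2)[OF inv finite_A] by simp
  then obtain v where free_level: "1 \<le> v" "v \<le> card A" "v \<notin> price ` ran mate"
    by (rule exists_free_level[OF auction_inv_card_ran(1)[OF inv finite_A]])
  define X where "X = {x. \<exists>b. mate x = Some b \<and> v < price b}"
  have dearer: "X \<subseteq> A" "a \<notin> X" using unmatched(2) auction_invD(1)[OF inv] by (auto simp: X_def)
  have "finite X" using dearer(1) finite_A by (rule finite_subset)
  have "M x \<in> (the \<circ> mate) ` X" if x: "x \<in> insert a X" for x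
  proof -
    have "x \<in> A" using x dearer(1) unmatched(1) by blast
    then have likes: "M x \<in> B" "E x (M x)" using perfect unfolding matching_def by blast+
    obtain y where holder: "mate y = Some (M x)" "v < price (M x)"
    proof (cases "x = a")
      case True
      then have "v \<le> price (M x)" using high likes free_level(2) by force
      then show ?thesis by (rule auction_item_held[OF inv free_level(1,3) likes(1)]) (rule that)
    next
      case False
      then obtain b where "mate x = Some b" "v < price b" using x unfolding X_def by blast
      then show ?thesis
        by (rule auction_high_bidder_likes[OF inv free_level(1,3) _ _ likes]) (rule that)
    qed
    then have "y \<in> X" by (simp add: X_def)
    then show ?thesis using holder(1) by (intro image_eqI[of _ _ y]) simp_all
  qed
  then have "M ` insert a X \<subseteq> (the \<circ> mate) ` X" by (rule image_subsetI)
  moreover have "inj_on M A" using perfect by (simp add: matching_def)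
  then have "inj_on M (insert a X)" by (rule inj_on_subset) (use unmatched(1) dearer(1) in blast)
  ultimately have "card (insert a X) \<le> card ((the \<circ> mate) ` X)"
    by (intro card_inj_on_le[OF _ _ finite_imageI[OF \<open>finite X\<close>]])
  then show False
    using card_image_le[OF \<open>finite X\<close>, of "the \<circ> mate"]
      card_insert_disjoint[OF \<open>finite X\<close> dearer(2)]
    by linarith
qed

definition bid :: "'a \<Rightarrow> 'b \<Rightarrow> ('a \<rightharpoonup> 'b) \<Rightarrow> ('a \<rightharpoonup> 'b)" where
  "bid a b mate = (\<lambda>x. if x = a then Some b else if mate x = Some b then None else mate x)"

lemma bid_eq_Some_iff:
  "bid a b mate x = Some c \<longleftrightarrow> x = a \<and> c = b \<or> x \<noteq> a \<and> c \<noteq> b \<and> mate x = Some c"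
  by (auto simp: bid_def)

lemma auction_inv_bid:
  assumes inv: "auction_inv E A B mate price"
    and unmatched: "a \<in> A" "mate a = None" and liked: "b \<in> B" "E a b"
    and cheapest: "\<And>c. c \<in> B \<Longrightarrow> E a c \<Longrightarrow> price b \<le> price c"
  shows "auction_inv E A B (bid a b mate) (price(b := Suc (price b)))"
  unfolding auction_inv_def
proof (intro conjI allI impI ballI)
  note invD = auction_invD[OF inv]
  show "dom (bid a b mate) \<subseteq> A"
    using unmatched(1) invD(1) by (auto simp: bid_eq_Some_iff)
  show "c \<in> B" "E x c" if "bid a b mate x = Some c" for x c
    using that[unfolded bid_eq_Some_iff] liked invD(2,3)[of x c] by blast+
  show "x = y" if "bid a b mate x = Some c" "bid a b mate y = Some c" for x y c
    using that[unfolded bid_eq_Some_iff] invD(4)[of x c y] by blast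
  show "c \<in> ran (bid a b mate)" if "c \<in> B" "0 < (price(b := Suc (price b))) c" for c
  proof (cases "c = b")
    case True
    then show ?thesis by (intro ranI[of _ a]) (simp add: bid_def)
  next
    case False
    then have "0 < price c" using that(2) by simp
    then obtain x where "mate x = Some c" using invD(5)[OF \<open>c \<in> B\<close>] by blast
    then show ?thesis using False unmatched(2) by (intro ranI[of _ x]) (auto simp: bid_def)
  qed
  show "(price(b := Suc (price b))) c \<le> (price(b := Suc (price b))) d + 1"
    if "bid a b mate x = Some c" "d \<in> B" "E x d" for x c d
  proof (cases "x = a")
    case True
    then show ?thesis using cheapest[of d] that by (auto simp: bid_eq_Some_iff)
  next
    case False
    then show ?thesis using invD(6)[of x c d] that by (auto simp: bid_eq_Some_iff)
  qed
qed

text \<open>While a bidder is unmatched, each of the \<open>t\<close> bids has raised the sum of the prices by one.\<close>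

definition auction_progress ::
  "('a \<Rightarrow> 'b \<Rightarrow> bool) \<Rightarrow> 'a set \<Rightarrow> 'b set \<Rightarrow> nat \<Rightarrow> ('a \<rightharpoonup> 'b) \<Rightarrow> ('b \<Rightarrow> nat) \<Rightarrow> bool" where
  "auction_progress E A B t mate price \<longleftrightarrow> auction_inv E A B mate price \<and>
     ((\<exists>M. matching E A B M) \<longrightarrow>
        (\<forall>b\<in>B. price b \<le> card A) \<and> (dom mate \<noteq> A \<longrightarrow> t \<le> sum price B))"

lemma auction_progress_init:
  "(\<And>b. b \<in> B \<Longrightarrow> price b = 0) \<Longrightarrow> auction_progress E A B 0 Map.empty price"
  by (simp add: auction_progress_def auction_inv_def)

lemma auction_progress_matched:
  "auction_progress E A B t mate price \<Longrightarrow> A \<subseteq> dom mate \<Longrightarrow> auction_progress E A B t' mate price"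
  using auction_inv_dom unfolding auction_progress_def by blast

lemma auction_progress_stuck:
  assumes "auction_progress E A B t mate price" "a \<in> A" "\<And>b. b \<in> B \<Longrightarrow> \<not> E a b"
  shows "auction_progress E A B t' mate price"
proof -
  have "\<not> matching E A B M" for M using assms(2,3) by (auto simp: matching_def)
  then show ?thesis using assms(1) by (simp add: auction_progress_def)
qed

lemma auction_progress_bid:
  assumes prog: "auction_progress E A B t mate price" and fin: "finite A" "finite B"
    and unmatched: "a \<in> A" "mate a = None" and liked: "b \<in> B" "E a b"
    and cheapest: "\<And>c. c \<in> B \<Longrightarrow> E a c \<Longrightarrow> price b \<le> price c"
  shows "auction_progress E A B (Suc t) (bid a b mate) (price(b := Suc (price b)))"
proof -
  let ?price = "price(b := Suc (price b))"
  have inv: "auction_inv E A B mate price" using prog by (simp add: auction_progress_def)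
  have "(\<forall>c\<in>B. ?price c \<le> card A) \<and> Suc t \<le> sum ?price B" if M: "matching E A B M" for M
  proof
    have old: "\<forall>c\<in>B. price c \<le> card A" "t \<le> sum price B"
      using prog M unmatched by (auto simp: auction_progress_def)
    obtain c where "c \<in> B" "E a c" "price c < card A"
      using auction_cheap_item[OF inv M fin(1) unmatched] by blast
    then have "price b < card A" using cheapest[of c] by simp
    then show "\<forall>c\<in>B. ?price c \<le> card A" using old(1) by simp
    have "sum ?price B = Suc (sum price B)"
      using liked(1) fin(2) by (simp add: sum.remove[of B b])
    then show "Suc t \<le> sum ?price B" using old(2) by simp
  qed
  then show ?thesis
    using auction_inv_bid[OF inv unmatched liked cheapest] unfolding auction_progress_def by blast
qed

lemma auction_progress_final:
  assumes prog: "auction_progress E A B t mate price" and fin: "finite A" "finite B"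
    and enough_bids: "card B * card A \<le> t"
  shows "dom mate = A \<longleftrightarrow> (\<exists>M. matching E A B M)"
proof
  have inv: "auction_inv E A B mate price" using prog by (simp add: auction_progress_def)
  then show "\<exists>M. matching E A B M" if "dom mate = A"
    using that auction_inv_matching by blast
  assume perfect: "\<exists>M. matching E A B M"
  show "dom mate = A"
  proof (rule ccontr)
    assume ne: "dom mate \<noteq> A"
    then obtain a where unmatched: "a \<in> A" "mate a = None"
      using auction_inv_dom[OF inv] by blast
    obtain b where cheap: "b \<in> B" "price b < card A"
      using auction_cheap_item[OF inv _ fin(1) unmatched] perfect by blast
    have "\<forall>b\<in>B. price b \<le> card A" "card B * card A \<le> sum price B"
      using prog perfect ne enough_bids by (auto simp: auction_progress_def)
    moreover from this have "sum price B < sum (\<lambda>_. card A) B"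
      using cheap fin(2) by (intro sum_strict_mono_ex1) auto
    ultimately show False by simp
  qed
qed

section \<open>The auction as a loop program\<close>

text \<open>Registers are numbers here, so 1 is kept as a name instead of being rewritten to \<open>Suc 0\<close>.\<close>

declare One_nat_def [simp del]

abbreviation (input) n_reg :: nat where "n_reg \<equiv> 0"
abbreviation (input) k_reg :: nat where "k_reg \<equiv> 1"
abbreviation (input) m_reg :: nat where "m_reg \<equiv> 2"

abbreviation (input) round_reg :: "nat \<Rightarrow> nat" where "round_reg z \<equiv> z"
abbreviation (input) bid_reg :: "nat \<Rightarrow> nat" where "bid_reg z \<equiv> z + 1"
abbreviation (input) scan_reg :: "nat \<Rightarrow> nat" where "scan_reg z \<equiv> z + 2"
abbreviation (input) item_reg :: "nat \<Rightarrow> nat" where "item_reg z \<equiv> z + 3"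
abbreviation (input) bidder_reg :: "nat \<Rightarrow> nat" where "bidder_reg z \<equiv> z + 4"
abbreviation (input) choice_reg :: "nat \<Rightarrow> nat" where "choice_reg z \<equiv> z + 5"
abbreviation (input) verdict_reg :: "nat \<Rightarrow> nat" where "verdict_reg z \<equiv> z + 6"
abbreviation (input) mate_arr :: "nat \<Rightarrow> nat" where "mate_arr z \<equiv> z"
abbreviation (input) price_arr :: "nat \<Rightarrow> nat" where "price_arr z \<equiv> z + 1"

text \<open>In the array of mates, the entry \<open>n\<close> marks an unmatched bidder and \<open>n + 1\<close> a number that is
  not a bidder. The test \<open>bids\<close> recognizes the bidders in register \<open>scan_reg z\<close>, and the program
  \<open>adj\<close> decides in register \<open>e\<close> whether bidder \<open>bidder_reg z\<close> likes item \<open>item_reg z\<close>.\<close>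

definition auction_init :: "nat \<Rightarrow> exp \<Rightarrow> prog" where
  "auction_init z bids =
     fill_loop (item_reg z) n_reg PSkip (price_arr z) (Const 0) ;;
     fill_loop (scan_reg z) k_reg PSkip (mate_arr z) (Add (Reg n_reg) (Const 1)) ;;
     store_loop (scan_reg z) k_reg PSkip bids (mate_arr z) (Reg n_reg)"

definition auction_select :: "nat \<Rightarrow> prog" where
  "auction_select z = argmin_loop (bidder_reg z) (scan_reg z) k_reg PSkip
     (eq_exp (Cell (mate_arr z) (Reg (scan_reg z))) (Reg n_reg)) (\<lambda>_. Const 0)"

definition auction_choose :: "nat \<Rightarrow> prog \<Rightarrow> nat \<Rightarrow> prog" where
  "auction_choose z adj e =
     argmin_loop (choice_reg z) (item_reg z) n_reg adj (Reg e) (Cell (price_arr z))"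

definition auction_bid :: "nat \<Rightarrow> prog" where
  "auction_bid z =
     store_loop (scan_reg z) k_reg PSkip
       (eq_exp (Cell (mate_arr z) (Reg (scan_reg z))) (Reg (choice_reg z)))
       (mate_arr z) (Reg n_reg) ;;
     PStore (mate_arr z) (Reg (bidder_reg z)) (Reg (choice_reg z)) ;;
     PStore (price_arr z) (Reg (choice_reg z))
       (Add (Cell (price_arr z) (Reg (choice_reg z))) (Const 1))"

definition auction_attempt :: "nat \<Rightarrow> prog \<Rightarrow> nat \<Rightarrow> prog" where
  "auction_attempt z adj e =
     auction_choose z adj e ;; PIf (Sub (Reg n_reg) (Reg (choice_reg z))) (auction_bid z) PSkip"

definition auction_round :: "nat \<Rightarrow> prog \<Rightarrow> nat \<Rightarrow> prog" where
  "auction_round z adj e =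
     auction_select z ;; PIf (Sub (Reg k_reg) (Reg (bidder_reg z))) (auction_attempt z adj e) PSkip"

definition auction_verdict :: "nat \<Rightarrow> prog" where
  "auction_verdict z = all_loop (verdict_reg z) (scan_reg z) k_reg PSkip
     (neq_exp (Cell (mate_arr z) (Reg (scan_reg z))) (Reg n_reg))"

definition auction :: "nat \<Rightarrow> exp \<Rightarrow> prog \<Rightarrow> nat \<Rightarrow> prog" where
  "auction z bids adj e =
     auction_init z bids ;;
     PFor (round_reg z) n_reg (PFor (bid_reg z) k_reg (auction_round z adj e)) ;;
     auction_verdict z"

lemmas auction_defs = auction_def auction_init_def auction_select_def auction_choose_def
  auction_bid_def auction_attempt_def auction_round_def auction_verdict_def

lemma auction_mods:
  "mod_regs (auction z bids adj e) = {z, z + 1, z + 2, z + 3, z + 4, z + 5, z + 6} \<union> mod_regs adj"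
  "mod_arrs (auction z bids adj e) = {z, z + 1} \<union> mod_arrs adj"
  by (auto simp: auction_defs)

lemma wf_auction:
  "wf_prog adj \<Longrightarrow> 2 < z \<Longrightarrow> mod_regs adj \<inter> {z..z + 6} = {} \<Longrightarrow> wf_prog (auction z bids adj e)"
  by (auto simp: auction_defs)

definition auction_frame :: "nat \<Rightarrow> prog \<Rightarrow> state \<Rightarrow> state \<Rightarrow> bool" where
  "auction_frame z adj = agree_off ({z..z + 6} \<union> mod_regs adj) ({z, z + 1} \<union> mod_arrs adj)"

locale auction_run =
  fixes Q :: queries and z :: nat and bids :: exp and adj :: prog and e :: nat
    and E :: "nat \<Rightarrow> nat \<Rightarrow> bool" and A :: "nat set" and \<sigma>0 :: state and n k :: nat
  assumes z: "2 < z"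
    and adj_mods: "mod_regs adj \<inter> {z..z + 6} = {}" "mod_arrs adj \<inter> {z, z + 1} = {}"
    and wf_adj: "wf_prog adj"
    and sizes: "fst \<sigma>0 n_reg = n" "fst \<sigma>0 k_reg = k"
    and A: "A \<subseteq> {..<k}"
    and bids: "\<And>\<sigma>. auction_frame z adj \<sigma>0 \<sigma> \<Longrightarrow> fst \<sigma> (scan_reg z) < k \<Longrightarrow>
      eval_exp bids \<sigma> \<noteq> 0 \<longleftrightarrow> fst \<sigma> (scan_reg z) \<in> A"
    and adj: "\<And>\<sigma>. auction_frame z adj \<sigma>0 \<sigma> \<Longrightarrow> fst \<sigma> (bidder_reg z) < k \<Longrightarrow>
      fst \<sigma> (item_reg z) < n \<Longrightarrow>
      fst (den Q adj \<sigma>) e \<noteq> 0 \<longleftrightarrow> E (fst \<sigma> (bidder_reg z)) (fst \<sigma> (item_reg z))"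
begin

abbreviation framed :: "state \<Rightarrow> bool" where
  "framed \<equiv> auction_frame z adj \<sigma>0"

lemma adj_fresh:
  "0 \<notin> mod_regs adj" "1 \<notin> mod_regs adj" "z \<notin> mod_regs adj" "z + 1 \<notin> mod_regs adj"
  "z + 2 \<notin> mod_regs adj" "z + 3 \<notin> mod_regs adj" "z + 4 \<notin> mod_regs adj" "z + 5 \<notin> mod_regs adj"
  "z \<notin> mod_arrs adj" "z + 1 \<notin> mod_arrs adj"
  using wf_prog_mod_regs[OF wf_adj, of 0] wf_prog_mod_regs[OF wf_adj, of 1] adj_mods by auto

lemma framed_sizes: "framed \<sigma> \<Longrightarrow> fst \<sigma> 0 = n" "framed \<sigma> \<Longrightarrow> fst \<sigma> 1 = k"
  using z sizes adj_fresh by (auto simp: auction_frame_def agree_off_def)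

lemma framed_trans:
  assumes "framed \<sigma>" "agree_off X Y \<sigma> \<sigma>'"
    and "X \<subseteq> {z..z + 6} \<union> mod_regs adj" "Y \<subseteq> {z, z + 1} \<union> mod_arrs adj"
  shows "framed \<sigma>'"
  using agree_off_trans agree_off_mono[OF assms(2-4)] assms(1) unfolding auction_frame_def by blast

lemma framed_den:
  "framed \<sigma> \<Longrightarrow> mod_regs p \<subseteq> {z..z + 6} \<union> mod_regs adj \<Longrightarrow> mod_arrs p \<subseteq> {z, z + 1} \<union> mod_arrs adj \<Longrightarrow>
   framed (den Q p \<sigma>)"
  by (rule framed_trans[OF _ agree_off_den])

lemma framed_set_reg: "framed \<sigma> \<Longrightarrow> x \<in> {z..z + 6} \<Longrightarrow> framed (set_reg x v \<sigma>)"
  by (rule framed_trans[of \<sigma> "{x}" "{}"]) auto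

lemma framed_parts:
  assumes "framed \<sigma>"
  shows "framed (den Q (auction_select z) \<sigma>)" "framed (den Q (auction_choose z adj e) \<sigma>)"
    "framed (den Q (auction_attempt z adj e) \<sigma>)"
  by (rule framed_den[OF assms]; force simp: auction_defs)+

definition mate_code :: "(nat \<rightharpoonup> nat) \<Rightarrow> nat \<Rightarrow> nat" where
  "mate_code mate x = (if x \<in> A then case mate x of None \<Rightarrow> n | Some b \<Rightarrow> b else Suc n)"

lemma mate_code_eq_iff:
  assumes "auction_inv E A {..<n} mate price"
  shows "mate_code mate x = n \<longleftrightarrow> x \<in> A \<and> mate x = None"
    and "b < n \<Longrightarrow> mate_code mate x = b \<longleftrightarrow> mate x = Some b"
  using auction_invD(1,2)[OF assms] by (auto simp: mate_code_def split: option.splits)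

lemma mate_code_bid:
  assumes "auction_inv E A {..<n} mate price" "a \<in> A" "b < n"
  shows "mate_code (bid a b mate) x =
    (if x = a then b else if mate_code mate x = b then n else mate_code mate x)"
proof -
  have "x \<in> A" if "mate x = Some b" using auction_invD(1)[OF assms(1) that] .
  then show ?thesis
    unfolding mate_code_eq_iff(2)[OF assms(1,3)] using assms(2)
    by (auto simp: mate_code_def bid_def)
qed

definition stores_mates :: "state \<Rightarrow> (nat \<rightharpoonup> nat) \<Rightarrow> bool" where
  "stores_mates \<sigma> mate \<longleftrightarrow> (\<forall>x<k. snd \<sigma> (mate_arr z) x = mate_code mate x)"

lemma stores_mates_eq:
  "snd \<sigma>' (mate_arr z) = snd \<sigma> (mate_arr z) \<Longrightarrow> stores_mates \<sigma> mate \<Longrightarrow> stores_mates \<sigma>' mate"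
  by (simp add: stores_mates_def)

definition auction_state :: "nat \<Rightarrow> state \<Rightarrow> bool" where
  "auction_state t \<sigma> \<longleftrightarrow> framed \<sigma> \<and>
     (\<exists>mate. auction_progress E A {..<n} t mate (snd \<sigma> (price_arr z)) \<and> stores_mates \<sigma> mate)"

lemma auction_state_set_reg:
  "auction_state t \<sigma> \<Longrightarrow> x \<in> {z..z + 6} \<Longrightarrow> auction_state t (set_reg x v \<sigma>)"
  using framed_set_reg by (auto simp: auction_state_def stores_mates_def)

lemma auction_state_framed: "auction_state t \<sigma> \<Longrightarrow> framed \<sigma>"
  by (simp add: auction_state_def)

lemma den_auction_init:
  assumes "framed \<sigma>"
  shows "auction_state 0 (den Q (auction_init z bids) \<sigma>)"
proof -
  let ?free = "fill_loop (item_reg z) n_reg PSkip (price_arr z) (Const 0)"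
  let ?outside = "fill_loop (scan_reg z) k_reg PSkip (mate_arr z) (Add (Reg n_reg) (Const 1))"
  let ?unmatched = "store_loop (scan_reg z) k_reg PSkip bids (mate_arr z) (Reg n_reg)"
  define \<tau> where "\<tau> = den Q ?free \<sigma>"
  define \<rho> where "\<rho> = den Q ?outside \<tau>"
  define \<sigma>' where "\<sigma>' = den Q ?unmatched \<rho>"
  have framed: "framed \<tau>" "framed \<rho>" "framed \<sigma>'"
    unfolding \<sigma>'_def \<rho>_def \<tau>_def by (intro framed_den assms; force)+
  have "snd \<tau> (price_arr z) b = 0" if "b < n" for b
    using that framed_sizes[OF assms] unfolding \<tau>_def by (subst den_fill_loop) auto
  moreover have "snd \<sigma>' (price_arr z) = snd \<tau> (price_arr z)"
    by (simp add: \<sigma>'_def \<rho>_def den_arr)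
  ultimately have price: "auction_progress E A {..<n} 0 Map.empty (snd \<sigma>' (price_arr z))"
    by (intro auction_progress_init) simp
  have outside:
    "snd \<rho> (mate_arr z) x = (if x < fst \<tau> k_reg then Suc n else snd \<tau> (mate_arr z) x)" for x
    using z framed_sizes[OF framed(1)] unfolding \<rho>_def
    by (intro den_fill_loop) (auto simp: agree_off_def)
  have "snd \<sigma>' (mate_arr z) x =
      (if x < fst \<rho> k_reg \<and> x \<in> A then n else snd \<rho> (mate_arr z) x)" for x
    unfolding \<sigma>'_def
  proof (rule den_store_loop)
    fix i \<mu>
    assume i: "i < fst \<rho> k_reg" "fst \<mu> (scan_reg z) = i"
      and frame: "agree_off (insert (scan_reg z) (mod_regs PSkip))
        (insert (mate_arr z) (mod_arrs PSkip)) \<rho> \<mu>"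
    have "framed \<mu>" by (rule framed_trans[OF framed(2) frame]) auto
    then show "(eval_exp bids (den Q PSkip \<mu>) \<noteq> 0) = (i \<in> A) \<and>
        (i \<in> A \<longrightarrow> eval_exp (Reg n_reg) (den Q PSkip \<mu>) = n)"
      using bids[of \<mu>] i framed_sizes framed(2) by simp
  qed auto
  then have "stores_mates \<sigma>' Map.empty"
    using outside framed_sizes framed by (simp add: stores_mates_def mate_code_def)
  then have "auction_state 0 \<sigma>'" using price framed(3) by (auto simp: auction_state_def)
  then show ?thesis by (simp add: auction_init_def \<sigma>'_def \<rho>_def \<tau>_def)
qed

lemma den_auction_select:
  assumes framed: "framed \<sigma>" and inv: "auction_inv E A {..<n} mate price"
    and mates: "stores_mates \<sigma> mate"
  defines "\<sigma>' \<equiv> den Q (auction_select z) \<sigma>"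
  defines "a \<equiv> fst \<sigma>' (bidder_reg z)"
  shows "snd \<sigma>' = snd \<sigma>" and "if a < k then a \<in> A \<and> mate a = None else A \<subseteq> dom mate"
proof -
  show "snd \<sigma>' = snd \<sigma>"
    unfolding \<sigma>'_def by (rule ext, rule den_arr) (simp add: auction_select_def)
  let ?unmatched = "\<lambda>x. snd \<sigma> (mate_arr z) x = n"
  have "if \<exists>x<fst \<sigma> k_reg. ?unmatched x
    then is_arg_min (\<lambda>_. 0 :: nat) (\<lambda>x. x < fst \<sigma> k_reg \<and> ?unmatched x) a
    else a = fst \<sigma> k_reg"
    unfolding a_def \<sigma>'_def auction_select_def
    by (rule den_argmin_loop) (use z framed_sizes[OF framed] in \<open>auto simp: agree_off_def\<close>)
  then have "if a < k then ?unmatched a else \<forall>x<k. \<not> ?unmatched x"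
    using framed_sizes[OF framed] by (auto simp: is_arg_min_def split: if_splits)
  moreover have "?unmatched x \<longleftrightarrow> x \<in> A \<and> mate x = None" if "x < k" for x
    using mates that mate_code_eq_iff(1)[OF inv] by (simp add: stores_mates_def)
  ultimately show "if a < k then a \<in> A \<and> mate a = None else A \<subseteq> dom mate"
    using A by (auto split: if_splits)
qed

lemma den_auction_choose:
  assumes framed: "framed \<sigma>" and bidder: "fst \<sigma> (bidder_reg z) < k"
  defines "\<sigma>' \<equiv> den Q (auction_choose z adj e) \<sigma>" and "a \<equiv> fst \<sigma> (bidder_reg z)"
  shows "fst \<sigma>' (bidder_reg z) = a"
    and "snd \<sigma>' (mate_arr z) = snd \<sigma> (mate_arr z)" "snd \<sigma>' (price_arr z) = snd \<sigma> (price_arr z)"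
    and "if fst \<sigma>' (choice_reg z) < n
      then is_arg_min (snd \<sigma> (price_arr z)) (\<lambda>b. b < n \<and> E a b) (fst \<sigma>' (choice_reg z))
      else \<forall>b<n. \<not> E a b"
proof -
  show "fst \<sigma>' (bidder_reg z) = a" "snd \<sigma>' (mate_arr z) = snd \<sigma> (mate_arr z)"
      "snd \<sigma>' (price_arr z) = snd \<sigma> (price_arr z)"
    using adj_fresh by (simp_all add: \<sigma>'_def a_def auction_choose_def den_reg den_arr)
  have "if \<exists>b<fst \<sigma> n_reg. E a b
    then is_arg_min (snd \<sigma> (price_arr z)) (\<lambda>b. b < fst \<sigma> n_reg \<and> E a b) (fst \<sigma>' (choice_reg z))
    else fst \<sigma>' (choice_reg z) = fst \<sigma> n_reg"
    unfolding \<sigma>'_def auction_choose_def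
  proof (rule den_argmin_loop)
    fix i \<tau>
    assume i: "i < fst \<sigma> n_reg" "fst \<tau> (item_reg z) = i"
      and frame: "agree_off (insert (choice_reg z) (insert (item_reg z) (mod_regs adj)))
        (mod_arrs adj) \<sigma> \<tau>"
    have "framed \<tau>" by (rule framed_trans[OF framed frame]) auto
    moreover have "fst \<tau> (bidder_reg z) = a"
      using agree_off_regD[OF frame] adj_fresh by (simp add: a_def)
    ultimately show "(eval_exp (Reg e) (den Q adj \<tau>) \<noteq> 0) = E a i"
      using adj[of \<tau>] i bidder framed_sizes[OF framed] by (simp add: a_def)
  qed (use adj_fresh z in \<open>auto simp: agree_off_def\<close>)
  then show "if fst \<sigma>' (choice_reg z) < n
      then is_arg_min (snd \<sigma> (price_arr z)) (\<lambda>b. b < n \<and> E a b) (fst \<sigma>' (choice_reg z))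
      else \<forall>b<n. \<not> E a b"
    using framed_sizes[OF framed] by (auto simp: is_arg_min_def split: if_splits)
qed

lemma den_auction_bid:
  assumes framed: "framed \<sigma>" and inv: "auction_inv E A {..<n} mate price"
    and mates: "stores_mates \<sigma> mate"
    and a: "fst \<sigma> (bidder_reg z) = a" "a \<in> A" and b: "fst \<sigma> (choice_reg z) = b" "b < n"
  defines "\<sigma>' \<equiv> den Q (auction_bid z) \<sigma>"
  shows "stores_mates \<sigma>' (bid a b mate)"
    and "snd \<sigma>' (price_arr z) = (snd \<sigma> (price_arr z))(b := Suc (snd \<sigma> (price_arr z) b))"
proof -
  define \<tau> where "\<tau> = den Q (store_loop (scan_reg z) k_reg PSkip
    (eq_exp (Cell (mate_arr z) (Reg (scan_reg z))) (Reg (choice_reg z)))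
    (mate_arr z) (Reg n_reg)) \<sigma>"
  have \<tau>: "fst \<tau> (bidder_reg z) = a" "fst \<tau> (choice_reg z) = b"
      "snd \<tau> (price_arr z) = snd \<sigma> (price_arr z)"
    using a b by (simp_all add: \<tau>_def den_reg den_arr)
  have evicted: "snd \<tau> (mate_arr z) x = (if x < fst \<sigma> k_reg \<and> snd \<sigma> (mate_arr z) x = b then n
      else snd \<sigma> (mate_arr z) x)" for x
    unfolding \<tau>_def
    by (rule den_store_loop) (use z b framed_sizes[OF framed] in \<open>auto simp: agree_off_def\<close>)
  have \<sigma>': "snd \<sigma>' (mate_arr z) = (snd \<tau> (mate_arr z))(a := b)"
      "snd \<sigma>' (price_arr z) = (snd \<tau> (price_arr z))(b := Suc (snd \<tau> (price_arr z) b))"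
    using \<tau> by (simp_all add: \<sigma>'_def auction_bid_def \<tau>_def Suc_eq_plus1)
  then show "snd \<sigma>' (price_arr z) = (snd \<sigma> (price_arr z))(b := Suc (snd \<sigma> (price_arr z) b))"
    using \<tau> by simp
  show "stores_mates \<sigma>' (bid a b mate)"
    using evicted mates framed_sizes(2)[OF framed]
    by (simp add: stores_mates_def \<sigma>'(1) mate_code_bid[OF inv a(2) b(2)])
qed

lemma den_auction_attempt:
  assumes framed: "framed \<sigma>" and prog: "auction_progress E A {..<n} t mate (snd \<sigma> (price_arr z))"
    and mates: "stores_mates \<sigma> mate"
    and a: "fst \<sigma> (bidder_reg z) = a" "a \<in> A" "mate a = None"
  shows "auction_state (Suc t) (den Q (auction_attempt z adj e) \<sigma>)"
proof -
  have inv: "auction_inv E A {..<n} mate (snd \<sigma> (price_arr z))"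
    using prog by (simp add: auction_progress_def)
  have "a < k" using a(2) A by blast
  define \<rho> where "\<rho> = den Q (auction_choose z adj e) \<sigma>"
  define b where "b = fst \<rho> (choice_reg z)"
  have framed_\<rho>: "framed \<rho>" and framed': "framed (den Q (auction_attempt z adj e) \<sigma>)"
    using framed_parts[OF framed] by (simp_all add: \<rho>_def)
  note choose = den_auction_choose[OF framed, unfolded a(1), OF \<open>a < k\<close>, folded \<rho>_def b_def]
  have mates_\<rho>: "stores_mates \<rho> mate" using stores_mates_eq[OF choose(2) mates] .
  have attempt: "den Q (auction_attempt z adj e) \<sigma> = (if b < n then den Q (auction_bid z) \<rho> else \<rho>)"
    using framed_sizes[OF framed_\<rho>] by (simp add: auction_attempt_def \<rho>_def b_def)
  show ?thesis
  proof (cases "b < n")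
    case False
    then have "auction_progress E A {..<n} (Suc t) mate (snd \<rho> (price_arr z))"
      using auction_progress_stuck[OF prog a(2)] choose(3,4) by simp
    then show ?thesis using False attempt framed' mates_\<rho> by (auto simp: auction_state_def)
  next
    case True
    have best: "E a b" "\<And>c. c < n \<Longrightarrow> E a c \<Longrightarrow> snd \<sigma> (price_arr z) b \<le> snd \<sigma> (price_arr z) c"
      using choose(4) True by (auto simp: is_arg_min_linorder)
    note bid = den_auction_bid[OF framed_\<rho> inv mates_\<rho> choose(1) a(2) b_def[symmetric] True]
    have "finite A" using A finite_subset by blast
    then have "auction_progress E A {..<n} (Suc t) (bid a b mate)
        (snd (den Q (auction_bid z) \<rho>) (price_arr z))"
      using auction_progress_bid[OF prog _ _ a(2,3) _ best(1)] best(2) True bid(2) choose(3) by simp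
    then show ?thesis using bid(1) True attempt framed' by (auto simp: auction_state_def)
  qed
qed

lemma den_auction_round:
  assumes "auction_state t \<sigma>"
  shows "auction_state (Suc t) (den Q (auction_round z adj e) \<sigma>)"
proof -
  note framed = auction_state_framed[OF assms]
  obtain mate where prog: "auction_progress E A {..<n} t mate (snd \<sigma> (price_arr z))"
    and mates: "stores_mates \<sigma> mate"
    using assms unfolding auction_state_def by blast
  then have inv: "auction_inv E A {..<n} mate (snd \<sigma> (price_arr z))"
    by (simp add: auction_progress_def)
  define \<tau> where "\<tau> = den Q (auction_select z) \<sigma>"
  have framed_\<tau>: "framed \<tau>" using framed_parts[OF framed] by (simp add: \<tau>_def)
  note select = den_auction_select[OF framed inv mates, folded \<tau>_def]
  have mates_\<tau>: "stores_mates \<tau> mate" by (rule stores_mates_eq[OF _ mates]) (simp add: select(1))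
  have round: "den Q (auction_round z adj e) \<sigma> =
      (if fst \<tau> (bidder_reg z) < k then den Q (auction_attempt z adj e) \<tau> else \<tau>)"
    using framed_sizes[OF framed_\<tau>] by (simp add: auction_round_def \<tau>_def)
  show ?thesis
  proof (cases "fst \<tau> (bidder_reg z) < k")
    case True
    then show ?thesis
      using den_auction_attempt[OF framed_\<tau> _ mates_\<tau> refl, of t] prog select round by simp
  next
    case False
    then show ?thesis
      using framed_\<tau> mates_\<tau> select round auction_progress_matched[OF prog]
      by (auto simp: auction_state_def)
  qed
qed

lemma den_auction_rounds:
  assumes "auction_state 0 \<sigma>"
  shows "auction_state (n * k)
    (den Q (PFor (round_reg z) n_reg (PFor (bid_reg z) k_reg (auction_round z adj e))) \<sigma>)"
proof -
  let ?inner = "PFor (bid_reg z) k_reg (auction_round z adj e)"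
  have "auction_state (fst \<sigma> n_reg * k) (den Q (PFor (round_reg z) n_reg ?inner) \<sigma>)"
  proof (rule den_for[where I = "\<lambda>i. auction_state (i * k)"])
    show "auction_state (0 * k) (set_reg (round_reg z) 0 \<sigma>)"
      using assms auction_state_set_reg by simp
  next
    fix i \<tau> assume \<tau>: "auction_state (i * k) \<tau>"
    have "auction_state (i * k + fst \<tau> k_reg) (den Q ?inner \<tau>)"
    proof (rule den_for[where I = "\<lambda>j. auction_state (i * k + j)"])
      show "auction_state (i * k + 0) (set_reg (bid_reg z) 0 \<tau>)"
        using \<tau> auction_state_set_reg by simp
    next
      fix j \<rho> assume "auction_state (i * k + j) \<rho>"
      then show "auction_state (i * k + Suc j)
          (set_reg (bid_reg z) (Suc j) (den Q (auction_round z adj e) \<rho>))"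
        using den_auction_round auction_state_set_reg by simp
    qed (use adj_fresh in \<open>auto simp: auction_defs\<close>)
    then show "auction_state (Suc i * k) (set_reg (round_reg z) (Suc i) (den Q ?inner \<tau>))"
      using framed_sizes(2)[OF auction_state_framed[OF \<tau>]] auction_state_set_reg
      by (simp add: add.commute)
  qed (use adj_fresh in \<open>auto simp: auction_defs\<close>)
  then show ?thesis
    using framed_sizes(1)[OF auction_state_framed[OF assms]] by simp
qed

lemma den_auction_verdict:
  assumes "framed \<sigma>"
  shows "fst (den Q (auction_verdict z) \<sigma>) (verdict_reg z) =
    of_bool (\<forall>x<k. snd \<sigma> (mate_arr z) x \<noteq> n)"
proof -
  have "fst (den Q (auction_verdict z) \<sigma>) (verdict_reg z) =
      of_bool (\<forall>x<fst \<sigma> k_reg. snd \<sigma> (mate_arr z) x \<noteq> n)"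
    unfolding auction_verdict_def
    by (rule den_all_loop) (use z framed_sizes[OF assms] in \<open>auto simp: agree_off_def\<close>)
  then show ?thesis using framed_sizes[OF assms] by simp
qed

lemma den_auction:
  defines "\<sigma>' \<equiv> den Q (auction z bids adj e) \<sigma>0"
  shows "fst \<sigma>' (verdict_reg z) \<noteq> 0 \<longleftrightarrow> (\<exists>M. matching E A {..<n} M)"
    and "\<exists>M. matching E A {..<n} M \<Longrightarrow> matching E A {..<n} (snd \<sigma>' (mate_arr z))"
proof -
  define \<tau> where "\<tau> = den Q (auction_init z bids ;;
    PFor (round_reg z) n_reg (PFor (bid_reg z) k_reg (auction_round z adj e))) \<sigma>0"
  have "framed \<sigma>0" by (simp add: auction_frame_def)
  then have \<tau>: "auction_state (n * k) \<tau>"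
    unfolding \<tau>_def den.simps(4) by (intro den_auction_rounds den_auction_init)
  then obtain mate where prog: "auction_progress E A {..<n} (n * k) mate (snd \<tau> (price_arr z))"
    and mates: "stores_mates \<tau> mate"
    unfolding auction_state_def by blast
  have inv: "auction_inv E A {..<n} mate (snd \<tau> (price_arr z))"
    using prog by (simp add: auction_progress_def)
  have \<sigma>': "\<sigma>' = den Q (auction_verdict z) \<tau>"
    by (simp add: \<sigma>'_def \<tau>_def auction_def)
  have "card A \<le> k" using card_mono[OF _ A] by simp
  then have matched: "dom mate = A \<longleftrightarrow> (\<exists>M. matching E A {..<n} M)"
    using auction_progress_final[OF prog] A finite_subset by auto
  have "(\<forall>x<k. snd \<tau> (mate_arr z) x \<noteq> n) \<longleftrightarrow> dom mate = A"
    using mates mate_code_eq_iff(1)[OF inv] auction_inv_dom[OF inv] A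
    by (auto simp: stores_mates_def)
  then show "fst \<sigma>' (verdict_reg z) \<noteq> 0 \<longleftrightarrow> (\<exists>M. matching E A {..<n} M)"
    using den_auction_verdict[OF auction_state_framed[OF \<tau>]] matched by (simp add: \<sigma>')
  assume "\<exists>M. matching E A {..<n} M"
  then have "dom mate = A" using matched by blast
  moreover have "snd \<sigma>' (mate_arr z) x = (the \<circ> mate) x" if "x \<in> A" for x
  proof -
    have "x < k" "x \<in> dom mate" using that A \<open>dom mate = A\<close> by auto
    then show ?thesis
      using that mates by (auto simp: stores_mates_def \<sigma>' den_arr auction_verdict_def mate_code_def)
  qed
  ultimately show "matching E A {..<n} (snd \<sigma>' (mate_arr z))"
    using auction_inv_matching[OF inv] matching_cong[of A _ "the \<circ> mate"] by metis
qed

end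

section \<open>Patterns of plans\<close>

definition least_rep :: "(nat \<Rightarrow> 'c) \<Rightarrow> nat \<Rightarrow> nat" where
  "least_rep h i = (LEAST j. h j = h i)"

lemma least_rep_same: "h (least_rep h i) = h i"
  unfolding least_rep_def by (rule LeastI) (rule refl)

lemma least_rep_le: "least_rep h i \<le> i"
  unfolding least_rep_def by (rule Least_le) (rule refl)

lemma least_rep_eq_iff: "least_rep h i = least_rep h j \<longleftrightarrow> h i = h j"
  using least_rep_same[of h i] least_rep_same[of h j] by (metis least_rep_def)

lemma inj_on_least_reps: "inj_on h {i. least_rep h i = i}"
  by (rule inj_onI) (metis (mono_tags) least_rep_eq_iff mem_Collect_eq)

lemma least_rep_finer:
  assumes "\<And>i j. f i = f j \<Longrightarrow> h i = h j"
  shows "least_rep f (least_rep h i) = least_rep h i"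
proof (rule antisym[OF least_rep_le])
  have "h (least_rep f (least_rep h i)) = h i"
    using assms[OF least_rep_same[of f "least_rep h i"]] least_rep_same[of h i] by simp
  then show "least_rep h i \<le> least_rep f (least_rep h i)"
    unfolding least_rep_def[of h i] by (rule Least_le)
qed

definition digit_arrays :: "nat \<Rightarrow> nat \<Rightarrow> (nat \<Rightarrow> nat) set" where
  "digit_arrays b k = {D. (\<forall>i<k. D i < b) \<and> (\<forall>i\<ge>k. D i = 0)}"

text \<open>A digit array \<open>D\<close> with digits below \<open>2 * k\<close> describes a pattern: \<open>D i < k\<close> says that task \<open>i\<close>
  has the same user as task \<open>D i\<close>, and \<open>D i = c + k\<close> that \<open>i\<close> leads the group of the tasks of its
  user, which lies in the same class as the user of task \<open>c\<close>, the leader of that class.\<close>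

locale solver_input =
  fixes Q :: queries and n k m :: nat
  assumes check_query_cong: "(\<And>i. i < k \<Longrightarrow> P i = P' i) \<Longrightarrow> check_query Q l P = check_query Q l P'"
begin

definition group_leaders :: "(nat \<Rightarrow> nat) \<Rightarrow> nat \<Rightarrow> nat set" where
  "group_leaders D c = {a. a < k \<and> D a = c + k}"

definition class_leaders :: "(nat \<Rightarrow> nat) \<Rightarrow> nat set" where
  "class_leaders D = {c. c < k \<and> D c = c + k}"

definition group_fits :: "(nat \<Rightarrow> nat) \<Rightarrow> (nat \<Rightarrow> nat) \<Rightarrow> nat \<Rightarrow> nat \<Rightarrow> nat \<Rightarrow> bool" where
  "group_fits D cls e a u \<longleftrightarrow> cls u = e \<and> (\<forall>i<k. i = a \<or> D i = a \<longrightarrow> auth_query Q i u)"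

definition class_fits :: "(nat \<Rightarrow> nat) \<Rightarrow> (nat \<Rightarrow> nat) \<Rightarrow> nat \<Rightarrow> nat \<Rightarrow> bool" where
  "class_fits D cls c e \<longleftrightarrow> (\<exists>M. matching (group_fits D cls e) (group_leaders D c) {..<n} M)"

definition realizes :: "(nat \<Rightarrow> nat) \<Rightarrow> (nat \<Rightarrow> nat) \<Rightarrow> (nat \<Rightarrow> nat) \<Rightarrow> (nat \<Rightarrow> nat) \<Rightarrow> bool" where
  "realizes D cls g P \<longleftrightarrow> inj_on g (class_leaders D) \<and>
     (\<forall>c\<in>class_leaders D. matching (group_fits D cls (g c)) (group_leaders D c) {..<n} P) \<and>
     (\<forall>i<k. D i < k \<longrightarrow> k \<le> D (D i) \<longrightarrow> P i = P (D i))"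

definition accepted :: "(nat \<Rightarrow> nat) \<Rightarrow> bool" where
  "accepted P \<longleftrightarrow> (\<forall>i<k. auth_query Q i (P i)) \<and> (\<forall>l<m. check_query Q l P)"

definition succeeds :: "(nat \<Rightarrow> nat) \<Rightarrow> (nat \<Rightarrow> nat) \<Rightarrow> bool" where
  "succeeds D cls \<longleftrightarrow> (\<exists>M. matching (class_fits D cls) (class_leaders D) {..<n} M) \<and>
     (\<forall>g P. realizes D cls g P \<longrightarrow> accepted P)"

lemma succeeds_cong:
  assumes "\<And>u. u < n \<Longrightarrow> cls u = cls' u"
  shows "succeeds D cls = succeeds D cls'"
proof -
  have "matching (group_fits D cls e) A {..<n} M = matching (group_fits D cls' e) A {..<n} M"
    for e A M
    using assms by (intro matching_cong) (simp_all add: group_fits_def)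
  then have "class_fits D cls = class_fits D cls'" "realizes D cls = realizes D cls'"
    by (simp_all add: class_fits_def realizes_def fun_eq_iff)
  then show ?thesis by (simp add: succeeds_def)
qed

definition pattern :: "(nat \<Rightarrow> nat) \<Rightarrow> (nat \<Rightarrow> nat) \<Rightarrow> nat \<Rightarrow> nat" where
  "pattern cls f i = (if i < k then
     if least_rep f i = i then least_rep (cls \<circ> f) i + k else least_rep f i else 0)"

lemma pattern_digits: "pattern cls f \<in> digit_arrays (2 * k) k"
proof -
  have "pattern cls f i < 2 * k" if "i < k" for i
    using that least_rep_le[of f i] least_rep_le[of "cls \<circ> f" i] by (simp add: pattern_def)
  then show ?thesis by (simp add: digit_arrays_def pattern_def)
qed

lemma group_leaders_pattern:
  "group_leaders (pattern cls f) c = {a. a < k \<and> least_rep f a = a \<and> least_rep (cls \<circ> f) a = c}"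
proof (rule set_eqI)
  fix a
  show "a \<in> group_leaders (pattern cls f) c \<longleftrightarrow>
      a \<in> {a. a < k \<and> least_rep f a = a \<and> least_rep (cls \<circ> f) a = c}"
    using least_rep_le[of f a] by (auto simp: group_leaders_def pattern_def)
qed

lemma class_leaders_pattern:
  "class_leaders (pattern cls f) = {c. c < k \<and> least_rep (cls \<circ> f) c = c}"
proof -
  have "least_rep f c = c" if "least_rep (cls \<circ> f) c = c" for c
    using least_rep_finer[of f "cls \<circ> f" c] that by simp
  moreover have "class_leaders (pattern cls f) = {c. c < k \<and> c \<in> group_leaders (pattern cls f) c}"
    by (auto simp: class_leaders_def group_leaders_def)
  ultimately show ?thesis unfolding group_leaders_pattern by blast
qed

lemma pattern_leaders:
  assumes "i < k"
  shows "least_rep f i \<in> group_leaders (pattern cls f) (least_rep (cls \<circ> f) i)"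
    and "least_rep (cls \<circ> f) i \<in> class_leaders (pattern cls f)"
proof -
  have idem: "least_rep h (least_rep h j) = least_rep h j" for h :: "nat \<Rightarrow> nat" and j
    by (rule least_rep_finer)
  have "least_rep (cls \<circ> f) (least_rep f i) = least_rep (cls \<circ> f) i"
    using least_rep_same[of f i] by (simp add: least_rep_eq_iff)
  then show "least_rep f i \<in> group_leaders (pattern cls f) (least_rep (cls \<circ> f) i)"
    using assms least_rep_le[of f i] idem by (simp add: group_leaders_pattern)
  show "least_rep (cls \<circ> f) i \<in> class_leaders (pattern cls f)"
    using assms least_rep_le[of "cls \<circ> f" i] idem by (simp add: class_leaders_pattern)
qed

lemma pattern_same_user:
  assumes "i < k" "a < k" "pattern cls f i = a"
  shows "f i = f a"
  using assms least_rep_same[of f i] by (auto simp: pattern_def split: if_splits)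

lemma pattern_class_fits:
  assumes authorized: "\<And>i. i < k \<Longrightarrow> f i < n \<and> auth_query Q i (f i)"
    and leader: "c \<in> class_leaders (pattern cls f)"
  shows "class_fits (pattern cls f) cls c (cls (f c))"
proof -
  let ?L = "group_leaders (pattern cls f) c"
  have "inj_on f ?L"
    by (rule inj_on_subset[OF inj_on_least_reps]) (auto simp: group_leaders_pattern)
  moreover have "f a < n \<and> group_fits (pattern cls f) cls (cls (f c)) a (f a)" if a: "a \<in> ?L" for a
  proof -
    have "a < k" "least_rep (cls \<circ> f) a = c" using a by (simp_all add: group_leaders_pattern)
    then have "cls (f a) = cls (f c)" using least_rep_same[of "cls \<circ> f" a] by simp
    moreover have "auth_query Q i (f a)" if "i < k" "i = a \<or> pattern cls f i = a" for i
      using authorized[OF that(1)] that(2) pattern_same_user[OF that(1) \<open>a < k\<close>, of cls f] by auto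
    ultimately show ?thesis using authorized[OF \<open>a < k\<close>] by (simp add: group_fits_def)
  qed
  ultimately have "matching (group_fits (pattern cls f) cls (cls (f c))) ?L {..<n} f"
    by (auto simp: matching_def)
  then show ?thesis unfolding class_fits_def by blast
qed

lemma pattern_class_matching:
  assumes "\<And>i. i < k \<Longrightarrow> f i < n \<and> auth_query Q i (f i)" and "\<And>u. u < n \<Longrightarrow> cls u < n"
  shows "matching (class_fits (pattern cls f) cls) (class_leaders (pattern cls f)) {..<n} (cls \<circ> f)"
proof -
  have "inj_on (cls \<circ> f) (class_leaders (pattern cls f))"
    by (rule inj_on_subset[OF inj_on_least_reps]) (auto simp: class_leaders_pattern)
  moreover have "(cls \<circ> f) ` class_leaders (pattern cls f) \<subseteq> {..<n}"
    using assms by (auto simp: class_leaders_def)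
  ultimately show ?thesis
    using pattern_class_fits[OF assms(1)] by (simp add: matching_def)
qed

context
  fixes cls f g P :: "nat \<Rightarrow> nat"
  assumes realizes: "realizes (pattern cls f) cls g P"
begin

lemma realizes_same_group:
  assumes "i < k"
  shows "P i = P (least_rep f i)"
proof (cases "least_rep f i = i")
  case False
  then have "pattern cls f i = least_rep f i" using assms by (simp add: pattern_def)
  moreover have "least_rep f i < k" "k \<le> pattern cls f (least_rep f i)"
    using pattern_leaders(1)[OF assms, of f cls] by (simp_all add: group_leaders_def)
  ultimately show ?thesis using realizes assms by (simp add: realizes_def)
qed simp

lemma realizes_group_matching:
  "i < k \<Longrightarrow> matching (group_fits (pattern cls f) cls (g (least_rep (cls \<circ> f) i)))
     (group_leaders (pattern cls f) (least_rep (cls \<circ> f) i)) {..<n} P"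
  using realizes pattern_leaders(2) by (simp add: realizes_def)

lemma realizes_fits:
  assumes "i < k"
  shows "P i < n" "auth_query Q i (P i)" "cls (P i) = g (least_rep (cls \<circ> f) i)"
proof -
  let ?a = "least_rep f i"
  have "P ?a < n" and fits: "group_fits (pattern cls f) cls (g (least_rep (cls \<circ> f) i)) ?a (P ?a)"
    using realizes_group_matching[OF assms] pattern_leaders(1)[OF assms, of f cls]
    by (auto simp: matching_def)
  then show "P i < n" "cls (P i) = g (least_rep (cls \<circ> f) i)"
    using realizes_same_group[OF assms] by (simp_all add: group_fits_def)
  have "i = ?a \<or> pattern cls f i = ?a" using assms by (simp add: pattern_def)
  then show "auth_query Q i (P i)"
    using fits assms realizes_same_group[OF assms] unfolding group_fits_def by metis
qed

lemma realizes_same_class_iff: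
  assumes "i < k" "j < k"
  shows "cls (P i) = cls (P j) \<longleftrightarrow> cls (f i) = cls (f j)"
proof -
  have "inj_on g (class_leaders (pattern cls f))" using realizes by (simp add: realizes_def)
  then have "cls (P i) = cls (P j) \<longleftrightarrow> least_rep (cls \<circ> f) i = least_rep (cls \<circ> f) j"
    using realizes_fits(3) assms pattern_leaders(2) by (simp add: inj_on_eq_iff)
  then show ?thesis by (simp add: least_rep_eq_iff)
qed

lemma realizes_same_user_iff:
  assumes "i < k" "j < k"
  shows "P i = P j \<longleftrightarrow> f i = f j"
proof
  assume eq: "P i = P j"
  then have "least_rep (cls \<circ> f) i = least_rep (cls \<circ> f) j"
    using realizes_same_class_iff[OF assms] by (simp add: least_rep_eq_iff)
  then have "least_rep f j \<in> group_leaders (pattern cls f) (least_rep (cls \<circ> f) i)"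
    using pattern_leaders(1)[OF assms(2), of f cls] by simp
  moreover have "P (least_rep f i) = P (least_rep f j)"
    using eq realizes_same_group assms by simp
  moreover have "inj_on P (group_leaders (pattern cls f) (least_rep (cls \<circ> f) i))"
    using realizes_group_matching[OF assms(1)] by (simp add: matching_def)
  ultimately have "least_rep f i = least_rep f j"
    using pattern_leaders(1)[OF assms(1)] by (auto dest: inj_onD)
  then show "f i = f j" by (simp add: least_rep_eq_iff)
next
  assume "f i = f j"
  then show "P i = P j"
    using realizes_same_group[OF assms(1)] realizes_same_group[OF assms(2)]
      least_rep_eq_iff[of f i j]
    by simp
qed

end

end

section \<open>Realizing a pattern\<close>

abbreviation (input) plan_arr :: nat where "plan_arr \<equiv> 0"
abbreviation (input) digit_arr :: nat where "digit_arr \<equiv> 1"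
abbreviation (input) class_arr :: nat where "class_arr \<equiv> 2"

abbreviation (input) found_reg :: nat where "found_reg \<equiv> 4"
abbreviation (input) leader_reg :: nat where "leader_reg \<equiv> 12"
abbreviation (input) user_class_reg :: nat where "user_class_reg \<equiv> 13"
abbreviation (input) fits_reg :: nat where "fits_reg \<equiv> 14"
abbreviation (input) member_reg :: nat where "member_reg \<equiv> 15"
abbreviation (input) answer_reg :: nat where "answer_reg \<equiv> 16"
abbreviation (input) task_reg :: nat where "task_reg \<equiv> 18"
abbreviation (input) copy_reg :: nat where "copy_reg \<equiv> 19"

text \<open>The base addresses of the two auctions.\<close>

abbreviation (input) groups :: nat where "groups \<equiv> 30"
abbreviation (input) classes :: nat where "classes \<equiv> 50"

definition leads_exp :: "nat \<Rightarrow> nat \<Rightarrow> exp" where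
  "leads_exp x y = eq_exp (Cell digit_arr (Reg x)) (Add (Reg y) (Reg k_reg))"

definition group_adj :: prog where
  "group_adj =
     PIf (eq_exp (Cell class_arr (Reg (item_reg groups))) (Reg user_class_reg))
       (all_loop fits_reg member_reg k_reg
         (PIf (Add (eq_exp (Reg member_reg) (Reg (bidder_reg groups)))
                   (eq_exp (Cell digit_arr (Reg member_reg)) (Reg (bidder_reg groups))))
           (PAuth answer_reg (Reg member_reg) (Reg (item_reg groups)))
           (PAssign answer_reg (Const 1)))
         (Reg answer_reg))
       (PAssign fits_reg (Const 0))"

definition group_auction :: prog where
  "group_auction = auction groups (leads_exp (scan_reg groups) leader_reg) group_adj fits_reg"

definition class_adj :: prog where
  "class_adj = PAssign leader_reg (Reg (bidder_reg classes)) ;;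
     PAssign user_class_reg (Reg (item_reg classes)) ;; group_auction"

definition class_auction :: prog where
  "class_auction = auction classes (leads_exp (scan_reg classes) (scan_reg classes))
     class_adj (verdict_reg groups)"

definition copy_mates :: prog where
  "copy_mates = store_loop copy_reg k_reg PSkip (leads_exp copy_reg leader_reg)
     plan_arr (Cell (mate_arr groups) (Reg copy_reg))"

definition assign_class :: prog where
  "assign_class = PAssign leader_reg (Reg task_reg) ;;
     PAssign user_class_reg (Cell (mate_arr classes) (Reg task_reg)) ;; group_auction ;; copy_mates"

definition assign_leaders :: prog where
  "assign_leaders =
     PFor task_reg k_reg (PIf (leads_exp task_reg task_reg) assign_class PSkip)"

definition assign_followers :: prog where
  "assign_followers = store_loop task_reg k_reg PSkip
     (conj_exp (Sub (Reg k_reg) (Cell digit_arr (Reg task_reg)))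
       (Sub (Add (Cell digit_arr (Cell digit_arr (Reg task_reg))) (Const 1)) (Reg k_reg)))
     plan_arr (Cell plan_arr (Cell digit_arr (Reg task_reg)))"

definition verify :: prog where
  "verify = all_loop found_reg task_reg k_reg
       (PAuth answer_reg (Reg task_reg) (Cell plan_arr (Reg task_reg))) (Reg answer_reg) ;;
     PIf (Reg found_reg)
       (all_loop found_reg task_reg m_reg
         (PCheck answer_reg (Reg task_reg) plan_arr) (Reg answer_reg))
       PSkip"

definition realize :: prog where
  "realize = PIf (Reg found_reg) PSkip
     (class_auction ;; assign_leaders ;; assign_followers ;; verify)"

lemma group_auction_mods:
  "mod_regs group_auction = {14, 15, 16, 30, 31, 32, 33, 34, 35, 36}"
  "mod_arrs group_auction = {30, 31}"
  by (auto simp: group_auction_def auction_mods group_adj_def)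

lemma class_auction_mods:
  "mod_regs class_auction = {50, 51, 52, 53, 54, 55, 56, 12, 13} \<union> mod_regs group_auction"
  "mod_arrs class_auction = {50, 51} \<union> mod_arrs group_auction"
  by (auto simp: class_auction_def auction_mods class_adj_def)

lemma assign_mods:
  "mod_regs assign_class = {12, 13, 19} \<union> mod_regs group_auction"
  "mod_arrs assign_class = {0} \<union> mod_arrs group_auction"
  "mod_regs assign_leaders = {18} \<union> mod_regs assign_class"
  "mod_arrs assign_leaders = mod_arrs assign_class"
  "mod_regs assign_followers = {18}" "mod_arrs assign_followers = {0}"
  by (auto simp: copy_mates_def assign_class_def assign_leaders_def assign_followers_def)

lemma verify_mods: "mod_regs verify = {4, 16, 18}" "mod_arrs verify = {}"
  by (auto simp: verify_def)

lemmas realize_part_mods = class_auction_mods assign_mods verify_mods group_auction_mods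

lemma realize_mods:
  "mod_regs realize =
    {4, 12, 13, 14, 15, 16, 18, 19, 30, 31, 32, 33, 34, 35, 36, 50, 51, 52, 53, 54, 55, 56}"
  "mod_arrs realize = {0, 30, 31, 50, 51}"
  by (auto simp: realize_def realize_part_mods)

lemma wf_group_adj: "wf_prog group_adj"
  by (simp add: group_adj_def)

lemma wf_group_auction: "wf_prog group_auction"
  unfolding group_auction_def by (rule wf_auction) (auto simp: wf_group_adj group_adj_def)

lemma wf_class_adj: "wf_prog class_adj"
  by (simp add: class_adj_def wf_group_auction)

lemma wf_class_auction: "wf_prog class_auction"
  unfolding class_auction_def
  by (rule wf_auction[OF wf_class_adj]) (auto simp: class_adj_def group_auction_mods)

lemma wf_realize: "wf_prog realize"
  by (simp add: realize_def assign_leaders_def assign_class_def copy_mates_def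
      assign_followers_def verify_def wf_class_auction wf_group_auction group_auction_mods)

context solver_input
begin

definition loaded :: "(nat \<Rightarrow> nat) \<Rightarrow> (nat \<Rightarrow> nat) \<Rightarrow> state \<Rightarrow> bool" where
  "loaded D cls \<sigma> \<longleftrightarrow> fst \<sigma> n_reg = n \<and> fst \<sigma> k_reg = k \<and> fst \<sigma> m_reg = m \<and>
     snd \<sigma> digit_arr = D \<and> snd \<sigma> class_arr = cls"

lemma loadedD:
  assumes "loaded D cls \<sigma>"
  shows "fst \<sigma> 0 = n" "fst \<sigma> 1 = k" "fst \<sigma> 2 = m" "snd \<sigma> 1 = D" "snd \<sigma> 2 = cls"
  using assms by (simp_all add: loaded_def)

lemma loaded_agree_off:
  "loaded D cls \<sigma> \<Longrightarrow> agree_off X Y \<sigma> \<sigma>' \<Longrightarrow> X \<inter> {0, 1, 2} = {} \<Longrightarrow> Y \<inter> {1, 2} = {} \<Longrightarrow> loaded D cls \<sigma>'"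
  by (auto simp: loaded_def agree_off_def)

lemma loaded_den:
  "loaded D cls \<sigma> \<Longrightarrow> mod_regs p \<inter> {0, 1, 2} = {} \<Longrightarrow> mod_arrs p \<inter> {1, 2} = {} \<Longrightarrow>
   loaded D cls (den Q p \<sigma>)"
  by (rule loaded_agree_off[OF _ agree_off_den])

lemma eval_leads_exp:
  assumes "loaded D cls \<sigma>" "fst \<sigma> x < k"
  shows "eval_exp (leads_exp x y) \<sigma> \<noteq> 0 \<longleftrightarrow> fst \<sigma> x \<in> group_leaders D (fst \<sigma> y)"
    and "eval_exp (leads_exp x x) \<sigma> \<noteq> 0 \<longleftrightarrow> fst \<sigma> x \<in> class_leaders D"
  using assms by (simp_all add: leads_exp_def loaded_def group_leaders_def class_leaders_def)

lemma den_group_adj: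
  assumes "loaded D cls \<sigma>"
  shows "fst (den Q group_adj \<sigma>) fits_reg \<noteq> 0 \<longleftrightarrow>
    group_fits D cls (fst \<sigma> user_class_reg) (fst \<sigma> (bidder_reg groups)) (fst \<sigma> (item_reg groups))"
proof -
  let ?a = "fst \<sigma> (bidder_reg groups)" and ?u = "fst \<sigma> (item_reg groups)"
  let ?check = "PIf (Add (eq_exp (Reg member_reg) (Reg (bidder_reg groups)))
      (eq_exp (Cell digit_arr (Reg member_reg)) (Reg (bidder_reg groups))))
    (PAuth answer_reg (Reg member_reg) (Reg (item_reg groups))) (PAssign answer_reg (Const 1))"
  have "fst (den Q (all_loop fits_reg member_reg k_reg ?check (Reg answer_reg)) \<sigma>) fits_reg =
      of_bool (\<forall>i<fst \<sigma> k_reg. i = ?a \<or> D i = ?a \<longrightarrow> auth_query Q i ?u)"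
    by (rule den_all_loop) (use assms in \<open>auto simp: agree_off_def loaded_def\<close>)
  then show ?thesis
    using loadedD[OF assms] by (simp add: group_adj_def group_fits_def del: den.simps(6))
qed

lemma den_group_auction:
  assumes loaded: "loaded D cls \<sigma>" and leader: "fst \<sigma> leader_reg = c"
    and user_class: "fst \<sigma> user_class_reg = e"
  defines "\<sigma>' \<equiv> den Q group_auction \<sigma>"
  shows "fst \<sigma>' (verdict_reg groups) \<noteq> 0 \<longleftrightarrow> class_fits D cls c e"
    and "class_fits D cls c e \<Longrightarrow>
      matching (group_fits D cls e) (group_leaders D c) {..<n} (snd \<sigma>' (mate_arr groups))"
proof -
  interpret auction_run Q groups "leads_exp (scan_reg groups) leader_reg" group_adj fits_reg
    "group_fits D cls e" "group_leaders D c" \<sigma> n k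
  proof unfold_locales
    fix \<tau> assume frame: "auction_frame groups group_adj \<sigma> \<tau>"
    then have \<tau>: "loaded D cls \<tau>" "fst \<tau> leader_reg = c" "fst \<tau> user_class_reg = e"
      using loaded leader user_class
        by (auto simp: auction_frame_def group_adj_def agree_off_def loaded_def)
    show "eval_exp (leads_exp (scan_reg groups) leader_reg) \<tau> \<noteq> 0 \<longleftrightarrow>
        fst \<tau> (scan_reg groups) \<in> group_leaders D c" if "fst \<tau> (scan_reg groups) < k"
      using eval_leads_exp(1)[OF \<tau>(1) that] \<tau>(2) by simp
    show "fst (den Q group_adj \<tau>) fits_reg \<noteq> 0 \<longleftrightarrow>
        group_fits D cls e (fst \<tau> (bidder_reg groups)) (fst \<tau> (item_reg groups))"
      using den_group_adj[OF \<tau>(1)] \<tau>(3) by simp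
  qed (use loadedD[OF loaded] in \<open>auto simp: wf_group_adj group_leaders_def\<close>,
      auto simp: group_adj_def)
  show "fst \<sigma>' (verdict_reg groups) \<noteq> 0 \<longleftrightarrow> class_fits D cls c e"
    using den_auction(1) by (simp add: \<sigma>'_def group_auction_def class_fits_def)
  show "class_fits D cls c e \<Longrightarrow>
      matching (group_fits D cls e) (group_leaders D c) {..<n} (snd \<sigma>' (mate_arr groups))"
    using den_auction(2) by (simp add: \<sigma>'_def group_auction_def class_fits_def)
qed

lemma den_class_auction:
  assumes loaded: "loaded D cls \<sigma>"
    and class_matching: "matching (class_fits D cls) (class_leaders D) {..<n} M"
  shows "matching (class_fits D cls) (class_leaders D) {..<n}
    (snd (den Q class_auction \<sigma>) (mate_arr classes))"
proof -
  interpret auction_run Q classes "leads_exp (scan_reg classes) (scan_reg classes)"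
    class_adj "verdict_reg groups" "class_fits D cls" "class_leaders D" \<sigma> n k
  proof unfold_locales
    fix \<tau> assume frame: "auction_frame classes class_adj \<sigma> \<tau>"
    then have \<tau>: "loaded D cls \<tau>"
      using loaded
      by (auto simp: auction_frame_def class_adj_def group_auction_mods agree_off_def loaded_def)
    show "eval_exp (leads_exp (scan_reg classes) (scan_reg classes)) \<tau> \<noteq> 0 \<longleftrightarrow>
        fst \<tau> (scan_reg classes) \<in> class_leaders D" if "fst \<tau> (scan_reg classes) < k"
      by (rule eval_leads_exp(2)[OF \<tau> that])
    let ?\<rho> = "set_reg user_class_reg (fst \<tau> (item_reg classes))
      (set_reg leader_reg (fst \<tau> (bidder_reg classes)) \<tau>)"
    have "loaded D cls ?\<rho>" using \<tau> by (simp add: loaded_def)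
    then show "fst (den Q class_adj \<tau>) (verdict_reg groups) \<noteq> 0 \<longleftrightarrow>
        class_fits D cls (fst \<tau> (bidder_reg classes)) (fst \<tau> (item_reg classes))"
      using den_group_auction(1)[of D cls ?\<rho>] by (simp add: class_adj_def)
  qed (use loadedD[OF loaded] in \<open>auto simp: wf_class_adj class_leaders_def\<close>,
      auto simp: class_adj_def group_auction_mods)
  show ?thesis
    using den_auction(2) class_matching unfolding class_auction_def by blast
qed

lemma den_copy_mates:
  assumes loaded: "loaded D cls \<sigma>"
  shows "snd (den Q copy_mates \<sigma>) plan_arr x =
    (if x \<in> group_leaders D (fst \<sigma> leader_reg) then snd \<sigma> (mate_arr groups) x
     else snd \<sigma> plan_arr x)"
proof -
  let ?leaders = "group_leaders D (fst \<sigma> leader_reg)"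
  have "snd (den Q copy_mates \<sigma>) plan_arr x = (if x < fst \<sigma> k_reg \<and> x \<in> ?leaders
      then snd \<sigma> (mate_arr groups) x else snd \<sigma> plan_arr x)"
    unfolding copy_mates_def
  proof (rule den_store_loop)
    fix i \<tau>
    assume index: "i < fst \<sigma> k_reg" "fst \<tau> copy_reg = i"
      and "agree_off (insert copy_reg (mod_regs PSkip)) (insert plan_arr (mod_arrs PSkip)) \<sigma> \<tau>"
    then have "loaded D cls \<tau>" "fst \<tau> leader_reg = fst \<sigma> leader_reg"
        "snd \<tau> (mate_arr groups) = snd \<sigma> (mate_arr groups)"
      using loaded by (auto simp: loaded_def agree_off_def)
    then show "(eval_exp (leads_exp copy_reg leader_reg) (den Q PSkip \<tau>) \<noteq> 0 \<longleftrightarrow> i \<in> ?leaders) \<and>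
        (i \<in> ?leaders \<longrightarrow> eval_exp (Cell (mate_arr groups) (Reg copy_reg)) (den Q PSkip \<tau>) =
          snd \<sigma> (mate_arr groups) i)"
      using index loadedD[OF loaded] eval_leads_exp(1)[of D cls \<tau> copy_reg leader_reg] by simp
  qed simp_all
  then show ?thesis using loadedD[OF loaded] by (simp add: group_leaders_def)
qed

lemma den_assign_class:
  assumes loaded: "loaded D cls \<sigma>" and leader: "fst \<sigma> task_reg = c"
    and user_class: "snd \<sigma> (mate_arr classes) c = e" and fits: "class_fits D cls c e"
  defines "P \<equiv> snd (den Q assign_class \<sigma>) plan_arr"
  shows "matching (group_fits D cls e) (group_leaders D c) {..<n} P"
    and "c' \<noteq> c \<Longrightarrow>
      matching F (group_leaders D c') B P = matching F (group_leaders D c') B (snd \<sigma> plan_arr)"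
proof -
  define \<tau> where "\<tau> = set_reg user_class_reg e (set_reg leader_reg c \<sigma>)"
  define \<rho> where "\<rho> = den Q group_auction \<tau>"
  have "loaded D cls \<tau>" using loaded by (simp add: \<tau>_def loaded_def)
  then have \<rho>: "loaded D cls \<rho>" and mates:
      "matching (group_fits D cls e) (group_leaders D c) {..<n} (snd \<rho> (mate_arr groups))"
    using den_group_auction(2)[OF _ _ _ fits] unfolding \<rho>_def
    by (auto simp: group_auction_mods \<tau>_def intro: loaded_den)
  have frame: "fst \<rho> leader_reg = c" "snd \<rho> plan_arr = snd \<sigma> plan_arr"
    by (simp_all add: \<rho>_def \<tau>_def den_reg den_arr group_auction_mods)
  have "P = snd (den Q copy_mates \<rho>) plan_arr"
    using leader user_class by (simp add: P_def assign_class_def \<rho>_def \<tau>_def)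
  then have P: "P x = (if x \<in> group_leaders D c then snd \<rho> (mate_arr groups) x
      else snd \<sigma> plan_arr x)" for x
    using den_copy_mates[OF \<rho>, of x] frame by simp
  then show "matching (group_fits D cls e) (group_leaders D c) {..<n} P"
    using mates matching_cong[of "group_leaders D c" P] by simp
  assume "c' \<noteq> c"
  then have "P x = snd \<sigma> plan_arr x" if "x \<in> group_leaders D c'" for x
    using that P by (simp add: group_leaders_def)
  then show
    "matching F (group_leaders D c') B P = matching F (group_leaders D c') B (snd \<sigma> plan_arr)"
    by (rule matching_cong) simp_all
qed

lemma den_assign_leaders:
  assumes loaded: "loaded D cls \<sigma>"
    and g: "snd \<sigma> (mate_arr classes) = g" "\<And>c. c \<in> class_leaders D \<Longrightarrow> class_fits D cls c (g c)"
  shows "\<forall>c\<in>class_leaders D. matching (group_fits D cls (g c)) (group_leaders D c) {..<n}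
    (snd (den Q assign_leaders \<sigma>) plan_arr)"
proof -
  let ?body = "PIf (leads_exp task_reg task_reg) assign_class PSkip"
  let ?assigned = "\<lambda>P c. matching (group_fits D cls (g c)) (group_leaders D c) {..<n} P"
  define I where "I = (\<lambda>i (\<tau>::state). \<forall>c\<in>class_leaders D. c < i \<longrightarrow> ?assigned (snd \<tau> plan_arr) c)"
  have "I (fst \<sigma> k_reg) (den Q assign_leaders \<sigma>)"
    unfolding assign_leaders_def
  proof (rule den_for[where I = I])
    fix i \<tau>
    assume i: "i < fst \<sigma> k_reg" "I i \<tau>" "fst \<tau> task_reg = i"
      and frame: "agree_off (insert task_reg (mod_regs ?body)) (mod_arrs ?body) \<sigma> \<tau>"
    have \<tau>: "loaded D cls \<tau>" "snd \<tau> (mate_arr classes) = g"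
      using loaded frame g(1)
      by (auto simp: loaded_def agree_off_def assign_mods group_auction_mods)
    have leads: "eval_exp (leads_exp task_reg task_reg) \<tau> \<noteq> 0 \<longleftrightarrow> i \<in> class_leaders D"
      using i(1,3) loadedD[OF loaded] eval_leads_exp(2)[OF \<tau>(1)] by simp
    show "I (Suc i) (set_reg task_reg (Suc i) (den Q ?body \<tau>))"
    proof (cases "i \<in> class_leaders D")
      case False
      then show ?thesis using leads i(2) by (auto simp: I_def less_Suc_eq)
    next
      case True
      have e: "snd \<tau> (mate_arr classes) i = g i" using \<tau>(2) by simp
      show ?thesis
        using den_assign_class[OF \<tau>(1) i(3) e g(2)[OF True]] i(2) leads True
        by (auto simp: I_def less_Suc_eq)
    qed
  qed (simp_all add: I_def assign_mods group_auction_mods)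
  then show ?thesis
    using loadedD[OF loaded] by (auto simp: I_def class_leaders_def)
qed

lemma den_assign_followers:
  assumes loaded: "loaded D cls \<sigma>"
  defines "P \<equiv> snd \<sigma> plan_arr" and "P' \<equiv> snd (den Q assign_followers \<sigma>) plan_arr"
  shows "P' i = (if i < k \<and> D i < k \<and> k \<le> D (D i) then P (D i) else P i)"
proof -
  have "P' i = (if i < fst \<sigma> k_reg \<and> D i < k \<and> k \<le> D (D i) then P (D i) else P i)"
    unfolding P'_def P_def assign_followers_def
    by (rule den_store_loop) (use loaded in \<open>auto simp: loaded_def agree_off_def\<close>)
  then show ?thesis using loadedD[OF loaded] by simp
qed

lemma den_verify:
  assumes loaded: "loaded D cls \<sigma>"
  shows "fst (den Q verify \<sigma>) found_reg \<noteq> 0 \<longleftrightarrow> accepted (snd \<sigma> plan_arr)"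
proof -
  let ?p = "all_loop found_reg task_reg k_reg
    (PAuth answer_reg (Reg task_reg) (Cell plan_arr (Reg task_reg))) (Reg answer_reg)"
  let ?q = "all_loop found_reg task_reg m_reg
    (PCheck answer_reg (Reg task_reg) plan_arr) (Reg answer_reg)"
  define \<tau> where "\<tau> = den Q ?p \<sigma>"
  have "fst \<tau> found_reg = of_bool (\<forall>i<fst \<sigma> k_reg. auth_query Q i (snd \<sigma> plan_arr i))"
    unfolding \<tau>_def by (rule den_all_loop) (auto simp: agree_off_def)
  moreover have
    "fst (den Q ?q \<tau>) found_reg = of_bool (\<forall>l<fst \<tau> m_reg. check_query Q l (snd \<tau> plan_arr))"
    by (rule den_all_loop) (auto simp: agree_off_def)
  moreover have "fst \<tau> m_reg = m" "snd \<tau> plan_arr = snd \<sigma> plan_arr"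
    using loadedD[OF loaded] by (simp_all add: \<tau>_def den_reg den_arr)
  ultimately show ?thesis
    using loadedD[OF loaded] by (auto simp: verify_def accepted_def \<tau>_def)
qed

lemma realizes_assigned:
  assumes loaded: "loaded D cls \<sigma>"
    and class_matching: "matching (class_fits D cls) (class_leaders D) {..<n} M"
  shows "\<exists>g. realizes D cls g
    (snd (den Q (class_auction ;; assign_leaders ;; assign_followers) \<sigma>) plan_arr)"
proof -
  define \<tau> where "\<tau> = den Q class_auction \<sigma>"
  define \<rho> where "\<rho> = den Q assign_leaders \<tau>"
  define g where "g = snd \<tau> (mate_arr classes)"
  let ?P = "snd (den Q assign_followers \<rho>) plan_arr"
  have loaded': "loaded D cls \<tau>" "loaded D cls \<rho>"
    using loaded unfolding \<rho>_def \<tau>_def by (intro loaded_den; simp add: realize_part_mods)+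
  have g: "matching (class_fits D cls) (class_leaders D) {..<n} g"
    using den_class_auction[OF loaded class_matching] by (simp add: g_def \<tau>_def)
  then have leaders: "\<forall>c\<in>class_leaders D.
      matching (group_fits D cls (g c)) (group_leaders D c) {..<n} (snd \<rho> plan_arr)"
    using den_assign_leaders[OF loaded'(1) g_def[symmetric]] by (simp add: \<rho>_def matching_def)
  note followers = den_assign_followers[OF loaded'(2)]
  have "?P x = snd \<rho> plan_arr x" if "x \<in> group_leaders D c" for x c
    using that followers[of x] by (simp add: group_leaders_def)
  then have "\<forall>c\<in>class_leaders D. matching (group_fits D cls (g c)) (group_leaders D c) {..<n} ?P"
    using leaders matching_cong[of _ ?P "snd \<rho> plan_arr"] by blast
  moreover have "\<forall>i<k. D i < k \<longrightarrow> k \<le> D (D i) \<longrightarrow> ?P i = ?P (D i)"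
    using followers by auto
  ultimately have "realizes D cls g ?P" using g by (simp add: realizes_def matching_def)
  then show ?thesis unfolding den.simps(4) \<rho>_def \<tau>_def by blast
qed

lemma den_realize:
  assumes "loaded D cls \<sigma>"
  defines "\<sigma>' \<equiv> den Q realize \<sigma>"
  shows "fst \<sigma> found_reg \<noteq> 0 \<Longrightarrow> \<sigma>' = \<sigma>"
    and "fst \<sigma> found_reg = 0 \<Longrightarrow> fst \<sigma>' found_reg \<noteq> 0 \<Longrightarrow> accepted (snd \<sigma>' plan_arr)"
    and "succeeds D cls \<Longrightarrow> fst \<sigma>' found_reg \<noteq> 0"
proof -
  show skip: "fst \<sigma> found_reg \<noteq> 0 \<Longrightarrow> \<sigma>' = \<sigma>" by (simp add: \<sigma>'_def realize_def)
  define \<tau> where "\<tau> = den Q (class_auction ;; assign_leaders ;; assign_followers) \<sigma>"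
  have "loaded D cls \<tau>"
    using assms(1) unfolding \<tau>_def by (intro loaded_den) (simp_all add: realize_part_mods)
  then have found: "fst \<sigma>' found_reg \<noteq> 0 \<longleftrightarrow> accepted (snd \<tau> plan_arr)"
      "snd \<sigma>' plan_arr = snd \<tau> plan_arr"
    if "fst \<sigma> found_reg = 0"
    using den_verify[of D cls \<tau>] that
      by (simp_all add: \<sigma>'_def realize_def \<tau>_def den_arr verify_mods)
  then show "fst \<sigma> found_reg = 0 \<Longrightarrow> fst \<sigma>' found_reg \<noteq> 0 \<Longrightarrow> accepted (snd \<sigma>' plan_arr)" by simp
  assume "succeeds D cls"
  then have "accepted (snd \<tau> plan_arr)"
    using realizes_assigned[OF assms(1)] unfolding succeeds_def \<tau>_def by blast
  then show "fst \<sigma>' found_reg \<noteq> 0" using found skip by (cases "fst \<sigma> found_reg = 0") simp_all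
qed

end

section \<open>Recovering the equivalence relation\<close>

text \<open>The equivalence relation is not part of the input. It is recovered from a relational
  constraint \<open>l\<close> with scope \<open>{i, j}\<close>: a pair of users is equivalent if and only if the answer
  to the plan that assigns it to \<open>i\<close> and \<open>j\<close> is the answer for two equal users. Since the machine
  cannot tell which constraints are relational, it tries them all.\<close>

abbreviation (input) constraint_reg :: nat where "constraint_reg \<equiv> 5"
abbreviation (input) first_reg :: nat where "first_reg \<equiv> 6"
abbreviation (input) second_reg :: nat where "second_reg \<equiv> 7"
abbreviation (input) user_reg :: nat where "user_reg \<equiv> 8"
abbreviation (input) other_reg :: nat where "other_reg \<equiv> 9"
abbreviation (input) pair_reg :: nat where "pair_reg \<equiv> 10"
abbreviation (input) equal_reg :: nat where "equal_reg \<equiv> 11"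
abbreviation (input) rep_reg :: nat where "rep_reg \<equiv> 17"
abbreviation (input) fill_reg :: nat where "fill_reg \<equiv> 20"
abbreviation (input) probe_arr :: nat where "probe_arr \<equiv> 3"

definition probe :: "nat \<Rightarrow> nat \<Rightarrow> nat \<Rightarrow> prog" where
  "probe y x x' = fill_loop fill_reg k_reg PSkip probe_arr (Reg n_reg) ;;
     PStore probe_arr (Reg first_reg) (Reg x) ;; PStore probe_arr (Reg second_reg) (Reg x') ;;
     PCheck y (Reg constraint_reg) probe_arr"

definition find_class :: prog where
  "find_class = argmin_loop rep_reg other_reg n_reg
     (probe pair_reg user_reg other_reg ;; probe equal_reg user_reg user_reg)
     (eq_exp (Reg pair_reg) (Reg equal_reg)) (\<lambda>e. e)"

definition recover_classes :: prog where
  "recover_classes = fill_loop user_reg n_reg find_class class_arr (Reg rep_reg)"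

definition unify_classes :: prog where
  "unify_classes = fill_loop user_reg n_reg PSkip class_arr (Const 0)"

definition search :: prog where
  "search = (unify_classes ;; realize) ;;
     PFor constraint_reg m_reg (PFor first_reg k_reg (PFor second_reg k_reg
       (recover_classes ;; realize)))"

lemma probe_mods: "mod_regs (probe y x x') = {fill_reg, y}" "mod_arrs (probe y x x') = {probe_arr}"
  by (auto simp: probe_def)

lemma class_program_mods:
  "mod_regs find_class = {9, 10, 11, 17, 20}" "mod_arrs find_class = {3}"
  "mod_regs recover_classes = {8, 9, 10, 11, 17, 20}" "mod_arrs recover_classes = {2, 3}"
  "mod_regs unify_classes = {8}" "mod_arrs unify_classes = {2}"
  by (auto simp: find_class_def recover_classes_def unify_classes_def probe_mods)

lemma wf_search: "wf_prog search"
  by (simp add: search_def recover_classes_def find_class_def unify_classes_def probe_def wf_realize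
      realize_mods)

context solver_input
begin

definition probed_class :: "nat \<Rightarrow> nat \<Rightarrow> nat \<Rightarrow> nat \<Rightarrow> nat" where
  "probed_class l i j u = (LEAST v.
     check_query Q l ((\<lambda>_. n)(i := u, j := v)) = check_query Q l ((\<lambda>_. n)(i := u, j := u)))"

definition class_maps :: "(nat \<Rightarrow> nat) set" where
  "class_maps = insert (\<lambda>_. 0) {probed_class l i j |l i j. l < m \<and> i < k \<and> j < k}"

lemma den_probe:
  assumes "fst \<sigma> n_reg = n" "fst \<sigma> k_reg = k" "fill_reg \<notin> {x, x'}"
  shows "fst (den Q (probe y x x') \<sigma>) y = of_bool (check_query Q (fst \<sigma> constraint_reg)
    ((\<lambda>_. n)(fst \<sigma> first_reg := fst \<sigma> x, fst \<sigma> second_reg := fst \<sigma> x')))"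
proof -
  define \<tau> where "\<tau> = den Q (fill_loop fill_reg k_reg PSkip probe_arr (Reg n_reg)) \<sigma>"
  have "snd \<tau> probe_arr i = (if i < fst \<sigma> k_reg then n else snd \<sigma> probe_arr i)" for i
    unfolding \<tau>_def by (rule den_fill_loop) (use assms in \<open>auto simp: agree_off_def\<close>)
  then have "check_query Q l ((snd \<tau> probe_arr)(i := u, j := v)) =
      check_query Q l ((\<lambda>_. n)(i := u, j := v))" for l i j u v
    using assms(2) by (intro check_query_cong) simp
  moreover have "fst \<tau> w = fst \<sigma> w" if "w \<noteq> fill_reg" for w
    using that by (simp add: \<tau>_def den_reg)
  ultimately show ?thesis
    using assms(3) by (simp add: probe_def \<tau>_def[symmetric])
qed

lemma is_arg_min_less_eq_Least:
  fixes w :: nat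
  assumes "is_arg_min (\<lambda>v. v) (\<lambda>v. v < N \<and> T v) w"
  shows "w = (LEAST v. T v)"
proof (rule Least_equality[symmetric])
  have w: "w < N" "T w" "\<And>v. v < N \<Longrightarrow> T v \<Longrightarrow> w \<le> v"
    using assms by (auto simp: is_arg_min_linorder)
  show "T w" by (rule w(2))
  show "w \<le> v" if "T v" for v using w(1) w(3)[OF _ that] by (cases "v < N") auto
qed

lemma den_find_class:
  assumes sizes: "fst \<sigma> n_reg = n" "fst \<sigma> k_reg = k" and user: "fst \<sigma> user_reg = u" "u < n"
    and lij: "fst \<sigma> constraint_reg = l" "fst \<sigma> first_reg = i" "fst \<sigma> second_reg = j"
  shows "fst (den Q find_class \<sigma>) rep_reg = probed_class l i j u"
proof -
  let ?answer = "\<lambda>v. check_query Q l ((\<lambda>_. n)(i := u, j := v))"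
  let ?probes = "probe pair_reg user_reg other_reg ;; probe equal_reg user_reg user_reg"
  have loop: "if \<exists>v<fst \<sigma> n_reg. ?answer v = ?answer u
    then is_arg_min (\<lambda>v. v) (\<lambda>v. v < fst \<sigma> n_reg \<and> ?answer v = ?answer u)
        (fst (den Q find_class \<sigma>) rep_reg)
    else fst (den Q find_class \<sigma>) rep_reg = fst \<sigma> n_reg"
    unfolding find_class_def
  proof (rule den_argmin_loop)
    fix v \<tau>
    assume v: "fst \<tau> other_reg = v"
      and "agree_off (insert rep_reg (insert other_reg (mod_regs ?probes))) (mod_arrs ?probes) \<sigma> \<tau>"
    then have \<tau>: "fst \<tau> n_reg = n" "fst \<tau> k_reg = k" "fst \<tau> constraint_reg = l"
        "fst \<tau> first_reg = i" "fst \<tau> second_reg = j" "fst \<tau> user_reg = u"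
      using sizes user(1) lij by (simp_all add: agree_off_def probe_mods)
    define \<rho> where "\<rho> = den Q (probe pair_reg user_reg other_reg) \<tau>"
    have \<rho>: "fst \<rho> x = fst \<tau> x" if "x \<notin> {fill_reg, pair_reg}" for x
      using that by (simp add: \<rho>_def den_reg probe_mods)
    have "fst \<rho> pair_reg = of_bool (?answer v)"
      using den_probe[of \<tau> user_reg other_reg pair_reg] \<tau> v by (simp add: \<rho>_def)
    moreover have
      "fst (den Q (probe equal_reg user_reg user_reg) \<rho>) equal_reg = of_bool (?answer u)"
      using den_probe[of \<rho> user_reg user_reg equal_reg] \<tau> \<rho> by simp
    ultimately show "eval_exp (eq_exp (Reg pair_reg) (Reg equal_reg)) (den Q ?probes \<tau>) \<noteq> 0 \<longleftrightarrow>
        ?answer v = ?answer u"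
      by (simp add: \<rho>_def[symmetric] den_reg probe_mods)
  qed (simp_all add: probe_mods)
  have "\<exists>v<fst \<sigma> n_reg. ?answer v = ?answer u" using user(2) sizes(1) by blast
  with loop have "is_arg_min (\<lambda>v. v) (\<lambda>v. v < n \<and> ?answer v = ?answer u)
      (fst (den Q find_class \<sigma>) rep_reg)"
    unfolding sizes(1) by (simp only: if_True)
  then show ?thesis unfolding probed_class_def by (rule is_arg_min_less_eq_Least)
qed

lemma den_recover_classes:
  assumes "fst \<sigma> n_reg = n" "fst \<sigma> k_reg = k" "u < n"
  shows "snd (den Q recover_classes \<sigma>) class_arr u =
    probed_class (fst \<sigma> constraint_reg) (fst \<sigma> first_reg) (fst \<sigma> second_reg) u"
proof -
  let ?class = "probed_class (fst \<sigma> constraint_reg) (fst \<sigma> first_reg) (fst \<sigma> second_reg)"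
  have "snd (den Q recover_classes \<sigma>) class_arr u =
      (if u < fst \<sigma> n_reg then ?class u else snd \<sigma> class_arr u)"
    unfolding recover_classes_def
  proof (rule den_fill_loop)
    fix v \<tau>
    assume v: "v < fst \<sigma> n_reg" "fst \<tau> user_reg = v"
      and frame: "agree_off (insert user_reg (mod_regs find_class))
        (insert class_arr (mod_arrs find_class)) \<sigma> \<tau>"
    have "fst (den Q find_class \<tau>) rep_reg = ?class v"
      by (rule den_find_class) (use v assms frame in \<open>auto simp: agree_off_def class_program_mods\<close>)
    then show "eval_exp (Reg rep_reg) (den Q find_class \<tau>) = ?class v" by simp
  qed (simp_all add: class_program_mods)
  then show ?thesis using assms by simp
qed

lemma den_unify_classes:
  "u < fst \<sigma> n_reg \<Longrightarrow> snd (den Q unify_classes \<sigma>) class_arr u = 0"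
  unfolding unify_classes_def
  by (subst den_fill_loop) auto

definition searching :: "(nat \<Rightarrow> nat) \<Rightarrow> state \<Rightarrow> bool" where
  "searching D \<sigma> \<longleftrightarrow> loaded D (snd \<sigma> class_arr) \<sigma> \<and>
     (fst \<sigma> found_reg \<noteq> 0 \<longrightarrow> accepted (snd \<sigma> plan_arr))"

lemma searching_sizes:
  "searching D \<sigma> \<Longrightarrow> fst \<sigma> 0 = n" "searching D \<sigma> \<Longrightarrow> fst \<sigma> 1 = k" "searching D \<sigma> \<Longrightarrow> fst \<sigma> 2 = m"
  by (simp_all add: searching_def loaded_def)

lemma searching_agree_off:
  "searching D \<sigma> \<Longrightarrow> agree_off X Y \<sigma> \<sigma>' \<Longrightarrow> X \<inter> {0, 1, 2, found_reg} = {} \<Longrightarrow>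
   Y \<inter> {plan_arr, digit_arr} = {} \<Longrightarrow> searching D \<sigma>'"
  by (auto simp: searching_def loaded_def agree_off_def)

definition finds :: "(nat \<Rightarrow> nat) \<Rightarrow> prog \<Rightarrow> (state \<Rightarrow> bool) \<Rightarrow> bool" where
  "finds D p G \<longleftrightarrow> (\<forall>\<sigma>. searching D \<sigma> \<longrightarrow> searching D (den Q p \<sigma>) \<and>
     (fst \<sigma> found_reg \<noteq> 0 \<or> G \<sigma> \<longrightarrow> fst (den Q p \<sigma>) found_reg \<noteq> 0))"

lemma findsD:
  assumes "finds D p G" "searching D \<sigma>"
  shows "searching D (den Q p \<sigma>)"
    and "fst \<sigma> found_reg \<noteq> 0 \<Longrightarrow> fst (den Q p \<sigma>) found_reg \<noteq> 0"
    and "G \<sigma> \<Longrightarrow> fst (den Q p \<sigma>) found_reg \<noteq> 0"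
  using assms unfolding finds_def by blast+

lemma finds_weaken:
  "finds D p G \<Longrightarrow> (\<And>\<sigma>. searching D \<sigma> \<Longrightarrow> G' \<sigma> \<Longrightarrow> G \<sigma>) \<Longrightarrow> finds D p G'"
  unfolding finds_def by blast

lemma finds_seq:
  assumes finds_first: "finds D p G" and finds_second: "finds D q H"
    and stable: "\<And>\<sigma> \<sigma>'. agree_off (mod_regs p) (mod_arrs p) \<sigma> \<sigma>' \<Longrightarrow> H \<sigma> \<Longrightarrow> H \<sigma>'"
  shows "finds D (p ;; q) (\<lambda>\<sigma>. G \<sigma> \<or> H \<sigma>)"
  unfolding finds_def den.simps(4)
proof (intro allI impI)
  fix \<sigma> assume "searching D \<sigma>"
  note first = findsD[OF finds_first this]
  note second = findsD[OF finds_second first(1)]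
  have "H (den Q p \<sigma>)" if "H \<sigma>" using stable[OF agree_off_den that] .
  then show "searching D (den Q q (den Q p \<sigma>)) \<and>
      (fst \<sigma> found_reg \<noteq> 0 \<or> G \<sigma> \<or> H \<sigma> \<longrightarrow> fst (den Q q (den Q p \<sigma>)) found_reg \<noteq> 0)"
    using first second by blast
qed

lemma finds_after:
  assumes finds: "finds D q G"
    and mods: "mod_regs p \<inter> {0, 1, 2, found_reg} = {}" "mod_arrs p \<inter> {plan_arr, digit_arr} = {}"
    and goal: "\<And>\<sigma>. searching D \<sigma> \<Longrightarrow> G' \<sigma> \<Longrightarrow> G (den Q p \<sigma>)"
  shows "finds D (p ;; q) G'"
proof -
  have "searching D (den Q p \<sigma>)" if "searching D \<sigma>" for \<sigma>
    using searching_agree_off[OF that agree_off_den mods] .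
  moreover have "fst (den Q p \<sigma>) found_reg = fst \<sigma> found_reg" for \<sigma>
    using mods(1) by (intro den_reg) blast
  ultimately show ?thesis using findsD[OF finds] goal unfolding finds_def den.simps(4) by metis
qed

lemma finds_for:
  assumes finds_body: "finds D p G" and fresh: "x \<notin> mod_regs p" "x \<notin> {0, 1, 2, found_reg}"
    and stable: "\<And>\<sigma> \<sigma>'. agree_off (mod_regs p) (mod_arrs p) \<sigma> \<sigma>' \<Longrightarrow> G \<sigma> \<Longrightarrow> G \<sigma>'"
  shows "finds D (PFor x r p) (\<lambda>\<sigma>. \<exists>i<fst \<sigma> r. G (set_reg x i \<sigma>))"
  unfolding finds_def
proof (intro allI impI)
  fix \<sigma> assume \<sigma>: "searching D \<sigma>"
  have set_x: "searching D (set_reg x v \<tau>)" if "searching D \<tau>" for \<tau> v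
    by (rule searching_agree_off[OF that agree_off_set_reg[OF insertI1, of _ "{}" "{}"]])
      (use fresh(2) in auto)
  define I where "I = (\<lambda>i (\<tau>::state). searching D \<tau> \<and>
    (fst \<sigma> found_reg \<noteq> 0 \<or> (\<exists>j<i. G (set_reg x j \<sigma>)) \<longrightarrow> fst \<tau> found_reg \<noteq> 0))"
  have "I (fst \<sigma> r) (den Q (PFor x r p) \<sigma>)"
  proof (rule den_for[where I = I, OF fresh(1)])
    show "I 0 (set_reg x 0 \<sigma>)" using set_x[OF \<sigma>] fresh(2) by (simp add: I_def)
  next
    fix i \<tau>
    assume iterate: "I i \<tau>" "fst \<tau> x = i"
      and frame: "agree_off (insert x (mod_regs p)) (mod_arrs p) \<sigma> \<tau>"
    have "G \<tau>" if "G (set_reg x i \<sigma>)"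
      by (rule stable[OF _ that]) (use frame iterate(2) in \<open>auto simp: agree_off_def\<close>)
    moreover have "searching D \<tau>" using iterate(1) by (simp add: I_def)
    note findsD[OF finds_body this]
    ultimately show "I (Suc i) (set_reg x (Suc i) (den Q p \<tau>))"
      using iterate(1) set_x fresh(2) by (auto simp: I_def less_Suc_eq)
  qed
  then show "searching D (den Q (PFor x r p) \<sigma>) \<and> (fst \<sigma> found_reg \<noteq> 0 \<or>
      (\<exists>i<fst \<sigma> r. G (set_reg x i \<sigma>)) \<longrightarrow> fst (den Q (PFor x r p) \<sigma>) found_reg \<noteq> 0)"
    by (simp add: I_def)
qed

lemma finds_realize: "finds D realize (\<lambda>\<sigma>. succeeds D (snd \<sigma> class_arr))"
  unfolding finds_def
proof (intro allI impI)
  fix \<sigma> assume \<sigma>: "searching D \<sigma>"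
  then have loaded: "loaded D (snd \<sigma> class_arr) \<sigma>" by (simp add: searching_def)
  then have "loaded D (snd \<sigma> class_arr) (den Q realize \<sigma>)"
    by (rule loaded_den) (simp_all add: realize_mods)
  moreover have "snd (den Q realize \<sigma>) class_arr = snd \<sigma> class_arr"
    by (simp add: den_arr realize_mods)
  ultimately show "searching D (den Q realize \<sigma>) \<and> (fst \<sigma> found_reg \<noteq> 0 \<or>
      succeeds D (snd \<sigma> class_arr) \<longrightarrow> fst (den Q realize \<sigma>) found_reg \<noteq> 0)"
    using \<sigma> den_realize[OF loaded] unfolding searching_def by (cases "fst \<sigma> found_reg = 0") auto
qed

lemma finds_unify_classes: "finds D (unify_classes ;; realize) (\<lambda>_. succeeds D (\<lambda>_. 0))"
proof (rule finds_after[OF finds_realize])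
  fix \<sigma> assume "searching D \<sigma>" "succeeds D (\<lambda>_. 0)"
  then show "succeeds D (snd (den Q unify_classes \<sigma>) class_arr)"
    using den_unify_classes[of _ \<sigma>] searching_sizes(1) by (subst succeeds_cong) auto
qed (simp_all add: class_program_mods)

lemma finds_recover_classes:
  "finds D (recover_classes ;; realize)
     (\<lambda>\<sigma>. succeeds D (probed_class (fst \<sigma> constraint_reg) (fst \<sigma> first_reg) (fst \<sigma> second_reg)))"
proof (rule finds_after[OF finds_realize])
  fix \<sigma>
  assume "searching D \<sigma>"
    "succeeds D (probed_class (fst \<sigma> constraint_reg) (fst \<sigma> first_reg) (fst \<sigma> second_reg))"
  then show "succeeds D (snd (den Q recover_classes \<sigma>) class_arr)"
    using den_recover_classes[of \<sigma>] searching_sizes by (subst succeeds_cong) auto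
qed (simp_all add: class_program_mods)

lemma finds_search: "finds D search (\<lambda>_. \<exists>cls\<in>class_maps. succeeds D cls)"
proof -
  let ?p7 = "PFor second_reg k_reg (recover_classes ;; realize)"
  let ?p6 = "PFor first_reg k_reg ?p7"
  let ?hit = "\<lambda>l i j. succeeds D (probed_class l i j)"
  note mods = class_program_mods realize_mods
  have "finds D ?p7 (\<lambda>\<sigma>. \<exists>j<fst \<sigma> k_reg. ?hit (fst \<sigma> constraint_reg) (fst \<sigma> first_reg) j)"
    by (rule finds_weaken[OF finds_for[OF finds_recover_classes]]) (auto simp: mods agree_off_def)
  then have "finds D ?p6 (\<lambda>\<sigma>. \<exists>i<fst \<sigma> k_reg. \<exists>j<fst \<sigma> k_reg. ?hit (fst \<sigma> constraint_reg) i j)"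
    by (rule finds_weaken[OF finds_for]) (auto simp: mods agree_off_def)
  then have "finds D (PFor constraint_reg m_reg ?p6)
      (\<lambda>\<sigma>. \<exists>l<fst \<sigma> m_reg. \<exists>i<fst \<sigma> k_reg. \<exists>j<fst \<sigma> k_reg. ?hit l i j)"
    by (rule finds_weaken[OF finds_for]) (auto simp: mods agree_off_def)
  then have "finds D search (\<lambda>\<sigma>. succeeds D (\<lambda>_. 0) \<or>
      (\<exists>l<fst \<sigma> m_reg. \<exists>i<fst \<sigma> k_reg. \<exists>j<fst \<sigma> k_reg. ?hit l i j))"
    unfolding search_def
    by (rule finds_seq[OF finds_unify_classes]) (auto simp: mods agree_off_def)
  then show ?thesis
    by (rule finds_weaken) (auto simp: class_maps_def searching_sizes)
qed

end

section \<open>Enumerating the patterns\<close>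

definition digit_value :: "nat \<Rightarrow> nat \<Rightarrow> (nat \<Rightarrow> nat) \<Rightarrow> nat" where
  "digit_value b k D = (\<Sum>i<k. D i * b ^ i)"

lemma digit_value_Suc: "digit_value b (Suc i) D = digit_value b i D + D i * b ^ i"
  by (simp add: digit_value_def)

lemma digit_value_upd: "i \<le> j \<Longrightarrow> digit_value b i (D(j := v)) = digit_value b i D"
  by (simp add: digit_value_def)

lemma digit_value_less:
  assumes "\<And>i. i < k \<Longrightarrow> D i < b"
  shows "digit_value b k D < b ^ k"
  using assms
proof (induction k)
  case (Suc k)
  then have "digit_value b (Suc k) D < b ^ k + D k * b ^ k" by (simp add: digit_value_Suc)
  also have "\<dots> = Suc (D k) * b ^ k" by simp
  also have "\<dots> \<le> b * b ^ k" using Suc.prems[of k] by (intro mult_le_mono1) simp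
  finally show ?case by simp
qed (simp add: digit_value_def)

lemma digit_value_inj:
  assumes "\<And>i. i < k \<Longrightarrow> D i < b" "\<And>i. i < k \<Longrightarrow> D' i < b"
    and "digit_value b k D = digit_value b k D'" "i < k"
  shows "D i = D' i"
  using assms
proof (induction k)
  case (Suc k)
  have top: "digit_value b (Suc k) F div b ^ k = F k"
      "digit_value b (Suc k) F mod b ^ k = digit_value b k F"
    if "\<And>i. i < Suc k \<Longrightarrow> F i < b" for F
  proof -
    have less: "digit_value b k F < b ^ k" by (rule digit_value_less) (use that in simp)
    then have "b ^ k \<noteq> 0" by linarith
    then show "digit_value b (Suc k) F div b ^ k = F k"
        "digit_value b (Suc k) F mod b ^ k = digit_value b k F"
      using less by (simp_all add: digit_value_Suc)
  qed
  have "D k = D' k" "digit_value b k D = digit_value b k D'"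
    using top[of D] top[of D'] Suc.prems by auto
  then show ?case using Suc by (cases "i = k") auto
qed simp

lemma digit_arrays_value_inj: "inj_on (digit_value b k) (digit_arrays b k)"
proof (rule inj_onI, rule ext)
  fix D D' i
  assume "D \<in> digit_arrays b k" "D' \<in> digit_arrays b k" "digit_value b k D = digit_value b k D'"
  then show "D i = D' i"
    using digit_value_inj[of k D b D' i] by (cases "i < k") (auto simp: digit_arrays_def)
qed

abbreviation (input) carry_reg :: nat where "carry_reg \<equiv> 3"

definition incr_digit :: prog where
  "incr_digit = PIf (Reg carry_reg)
     (PIf (Sub (Sub (Add (Reg k_reg) (Reg k_reg)) (Const 1)) (Cell digit_arr (Reg task_reg)))
        (PStore digit_arr (Reg task_reg) (Add (Cell digit_arr (Reg task_reg)) (Const 1)) ;;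
         PAssign carry_reg (Const 0))
        (PStore digit_arr (Reg task_reg) (Const 0)))
     PSkip"

definition count_up :: prog where
  "count_up = PAssign carry_reg (Const 1) ;; PFor task_reg k_reg incr_digit"

definition solver :: com where
  "solver = Seq (While (Sub (Const 1) (Reg carry_reg)) (compile (search ;; count_up)))
     (Assign 0 (Reg found_reg))"

lemma count_up_mods:
  "mod_regs incr_digit = {carry_reg}" "mod_arrs incr_digit = {digit_arr}"
  "mod_regs count_up = {carry_reg, task_reg}" "mod_arrs count_up = {digit_arr}"
  by (auto simp: incr_digit_def count_up_def)

lemma wf_count_up: "wf_prog count_up"
  by (simp add: incr_digit_def count_up_def)

lemma den_incr_digit:
  fixes Q :: queries
  assumes size: "fst \<sigma> k_reg = k" and position: "fst \<sigma> task_reg = i"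
    and digit: "snd \<sigma> digit_arr i = d" "d < 2 * k"
    and carry: "fst \<sigma> carry_reg = c" "c \<le> 1"
  defines "\<sigma>' \<equiv> den Q incr_digit \<sigma>"
  shows "snd \<sigma>' digit_arr = (snd \<sigma> digit_arr)(i := (d + c) mod (2 * k))"
    and "fst \<sigma>' carry_reg = (d + c) div (2 * k)"
proof -
  consider "c = 0" | "c = 1" "d + 1 < 2 * k" | "c = 1" "d + 1 = 2 * k"
    using carry(2) digit(2) by linarith
  then have "snd \<sigma>' digit_arr = (snd \<sigma> digit_arr)(i := (d + c) mod (2 * k)) \<and>
      fst \<sigma>' carry_reg = (d + c) div (2 * k)"
    by cases (use size position digit carry in \<open>auto simp: \<sigma>'_def incr_digit_def\<close>)
  then show "snd \<sigma>' digit_arr = (snd \<sigma> digit_arr)(i := (d + c) mod (2 * k))"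
    "fst \<sigma>' carry_reg = (d + c) div (2 * k)" by simp_all
qed

lemma digit_value_carry:
  assumes "digit_value b i E + c * b ^ i = Suc (digit_value b i D)"
  shows "digit_value b (Suc i) (E(i := (D i + c) mod b)) + (D i + c) div b * b ^ Suc i =
    Suc (digit_value b (Suc i) D)"
proof -
  have split: "s mod b * b ^ i + s div b * b ^ Suc i = s * b ^ i" for s
  proof -
    have "s mod b * b ^ i + s div b * b ^ Suc i = (s div b * b + s mod b) * b ^ i"
      by (simp only: distrib_left power_Suc ac_simps)
    then show ?thesis by simp
  qed
  have "digit_value b (Suc i) (E(i := (D i + c) mod b)) + (D i + c) div b * b ^ Suc i =
      digit_value b i E + (D i + c) * b ^ i"
    using split[of "D i + c"] by (simp add: digit_value_Suc digit_value_upd)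
  then show ?thesis using assms by (simp add: digit_value_Suc add_mult_distrib)
qed

lemma den_count_up:
  fixes Q :: queries
  assumes size: "fst \<sigma> k_reg = k" and digits: "snd \<sigma> digit_arr = D" "D \<in> digit_arrays (2 * k) k"
  defines "\<sigma>' \<equiv> den Q count_up \<sigma>"
  shows "snd \<sigma>' digit_arr \<in> digit_arrays (2 * k) k" and "fst \<sigma>' carry_reg \<le> 1"
    and "digit_value (2 * k) k (snd \<sigma>' digit_arr) + fst \<sigma>' carry_reg * (2 * k) ^ k =
      Suc (digit_value (2 * k) k D)"
proof -
  define b where "b = 2 * k"
  define I where "I = (\<lambda>i (\<tau>::state). snd \<tau> digit_arr \<in> digit_arrays b k \<and>
    fst \<tau> carry_reg \<le> 1 \<and> (\<forall>j\<ge>i. snd \<tau> digit_arr j = D j) \<and>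
    digit_value b i (snd \<tau> digit_arr) + fst \<tau> carry_reg * b ^ i =
      Suc (digit_value b i D))"
  let ?\<sigma> = "set_reg carry_reg 1 \<sigma>"
  have "I (fst ?\<sigma> k_reg) (den Q (PFor task_reg k_reg incr_digit) ?\<sigma>)"
  proof (rule den_for[where I = I])
    fix i \<tau>
    assume iterate: "i < fst ?\<sigma> k_reg" "I i \<tau>" "fst \<tau> task_reg = i"
      and "agree_off (insert task_reg (mod_regs incr_digit)) (mod_arrs incr_digit) ?\<sigma> \<tau>"
    then have k_\<tau>: "fst \<tau> k_reg = k" and "i < k"
      using size by (simp_all add: agree_off_def count_up_mods)
    then have digit: "snd \<tau> digit_arr i = D i" "D i < b" and carry: "fst \<tau> carry_reg \<le> 1"
      and prefix: "digit_value b i (snd \<tau> digit_arr) + fst \<tau> carry_reg * b ^ i =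
        Suc (digit_value b i D)"
      using iterate(2) digits(2) by (auto simp: I_def b_def digit_arrays_def)
    have "(D i + fst \<tau> carry_reg) div b \<le> 1" "(D i + fst \<tau> carry_reg) mod b < b"
      using digit(2) carry by (auto intro: less_Suc_eq_le[THEN iffD1] simp: div_less_iff_less_mult)
    then show "I (Suc i) (set_reg task_reg (Suc i) (den Q incr_digit \<tau>))"
      using iterate(2) \<open>i < k\<close>
        den_incr_digit[OF k_\<tau> iterate(3) digit[unfolded b_def] refl carry, of Q, folded b_def]
        digit_value_carry[OF prefix]
      by (simp add: I_def digit_arrays_def)
  qed (use digits in \<open>simp_all add: I_def b_def digit_value_def count_up_mods\<close>)
  then have "I k \<sigma>'" using size by (simp add: \<sigma>'_def count_up_def)
  then show "snd \<sigma>' digit_arr \<in> digit_arrays (2 * k) k" "fst \<sigma>' carry_reg \<le> 1"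
    "digit_value (2 * k) k (snd \<sigma>' digit_arr) + fst \<sigma>' carry_reg * (2 * k) ^ k =
      Suc (digit_value (2 * k) k D)"
    by (simp_all add: I_def b_def)
qed

context solver_input
begin

abbreviation "pattern_count \<equiv> (2 * k) ^ k"

definition hits :: "(nat \<Rightarrow> nat) \<Rightarrow> bool" where
  "hits D \<longleftrightarrow> (\<exists>cls\<in>class_maps. succeeds D cls)"

text \<open>The first \<open>t\<close> digit arrays have been tried; the carry is set after the last one.\<close>

definition tried :: "nat \<Rightarrow> state \<Rightarrow> bool" where
  "tried t \<sigma> \<longleftrightarrow> (let D = snd \<sigma> digit_arr in
     D \<in> digit_arrays (2 * k) k \<and> searching D \<sigma> \<and> fst \<sigma> carry_reg \<le> 1 \<and>
     digit_value (2 * k) k D + fst \<sigma> carry_reg * pattern_count = t \<and>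
     (\<forall>D'\<in>digit_arrays (2 * k) k. digit_value (2 * k) k D' < t \<longrightarrow> hits D' \<longrightarrow> fst \<sigma> found_reg \<noteq> 0))"

lemma tried_carry:
  assumes "tried t \<sigma>"
  shows "fst \<sigma> carry_reg = 0 \<longleftrightarrow> t < pattern_count"
proof -
  have "digit_value (2 * k) k (snd \<sigma> digit_arr) < pattern_count"
    using assms by (intro digit_value_less) (simp add: tried_def Let_def digit_arrays_def)
  moreover have "fst \<sigma> carry_reg = 0 \<or> fst \<sigma> carry_reg = 1"
    using assms by (auto simp: tried_def Let_def le_Suc_eq One_nat_def)
  ultimately show ?thesis using assms by (auto simp: tried_def Let_def)
qed

lemma tried_Suc:
  assumes tried: "tried t \<sigma>" and remaining: "t < pattern_count"
  shows "tried (Suc t) (den Q (search ;; count_up) \<sigma>)"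
proof -
  let ?D = "snd \<sigma> digit_arr"
  have digits: "?D \<in> digit_arrays (2 * k) k" "searching ?D \<sigma>" "digit_value (2 * k) k ?D = t"
    using tried tried_carry[OF tried] remaining by (simp_all add: tried_def Let_def)
  define \<tau> where "\<tau> = den Q search \<sigma>"
  define \<sigma>' where "\<sigma>' = den Q count_up \<tau>"
  note search = findsD[OF finds_search digits(2), folded \<tau>_def hits_def]
  have \<tau>: "fst \<tau> k_reg = k" "snd \<tau> digit_arr = ?D"
    using search(1) by (simp_all add: searching_def loaded_def)
  note count = den_count_up[OF \<tau> digits(1), of Q, folded \<sigma>'_def]
  have regs: "fst \<sigma>' x = fst \<tau> x" if "x \<notin> {carry_reg, task_reg}" for x
    using that by (simp add: \<sigma>'_def den_reg count_up_mods)
  have arrs: "snd \<sigma>' a = snd \<tau> a" if "a \<noteq> digit_arr" for a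
    using that by (simp add: \<sigma>'_def den_arr count_up_mods)
  have "searching (snd \<sigma>' digit_arr) \<sigma>'"
    using regs arrs search(1) by (simp add: searching_def loaded_def)
  moreover have "fst \<sigma>' found_reg \<noteq> 0"
    if "D' \<in> digit_arrays (2 * k) k" "digit_value (2 * k) k D' < Suc t" "hits D'" for D'
  proof (cases "digit_value (2 * k) k D' = t")
    case True
    then have "D' = ?D" using digit_arrays_value_inj that(1) digits(1,3) by (metis inj_onD)
    then show ?thesis using search(3) that(3) regs by simp
  next
    case False
    then have "fst \<sigma> found_reg \<noteq> 0" using that tried by (auto simp: tried_def Let_def)
    then show ?thesis using search(2) regs by simp
  qed
  ultimately have "tried (Suc t) \<sigma>'" using count digits(3) by (simp add: tried_def Let_def)
  then show ?thesis by (simp add: \<sigma>'_def \<tau>_def)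
qed

definition round_cost :: real where
  "round_cost = cost (search ;; count_up) (sizes n k m) (query_time Q)"

lemma run_cost_round: "tried t \<sigma> \<Longrightarrow> run_cost Q (search ;; count_up) \<sigma> = round_cost"
  unfolding round_cost_def
  by (rule cost_cong)
    (auto simp: wf_search wf_count_up tried_def Let_def sizes_def searching_def loaded_def
      le_Suc_eq numeral_2_eq_2 One_nat_def)

lemma tried_input_state: "tried 0 (input_state n k m)"
  by (simp add: tried_def Let_def input_state_def digit_arrays_def digit_value_def
      searching_def loaded_def)

lemma exec_solver:
  "\<exists>t \<sigma>. exec Q solver (input_state n k m) t \<sigma> \<and>
     (fst \<sigma> 0 \<noteq> 0 \<longrightarrow> accepted (snd \<sigma> plan_arr)) \<and>
     (\<forall>D\<in>digit_arrays (2 * k) k. hits D \<longrightarrow> fst \<sigma> 0 \<noteq> 0) \<and>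
     real t \<le> (round_cost + 11) * real pattern_count"
proof -
  let ?test = "Sub (Const 1) (Reg carry_reg)" and ?round = "search ;; count_up"
  have "\<exists>t \<sigma>. exec Q (While ?test (compile ?round)) (input_state n k m) t \<sigma> \<and>
      tried pattern_count \<sigma> \<and> real t \<le> real pattern_count *
        (1 + real (exp_time ?test) + round_cost) + 1 + real (exp_time ?test)"
  proof (rule exec_while_counted[where I = tried])
    fix t \<sigma> assume remaining: "t < pattern_count" "tried t \<sigma>"
    have "exec_within Q ?round \<sigma> round_cost"
      using exec_compile[of ?round Q \<sigma>] run_cost_round[OF remaining(2)]
        by (simp add: wf_search wf_count_up)
    moreover have "eval_exp ?test \<sigma> \<noteq> 0" using tried_carry[OF remaining(2)] remaining(1) by simp
    ultimately show "eval_exp ?test \<sigma> \<noteq> 0 \<and>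
        (\<exists>u \<sigma>'. exec Q (compile ?round) \<sigma> u \<sigma>' \<and> real u \<le> round_cost \<and> tried (Suc t) \<sigma>')"
      using tried_Suc[OF remaining(2,1)] by blast
  next
    fix \<sigma> assume "tried pattern_count \<sigma>"
    then show "eval_exp ?test \<sigma> = 0" using tried_carry[of pattern_count \<sigma>] by simp
  qed (rule tried_input_state)
  then obtain t \<sigma> where run: "exec Q (While ?test (compile ?round)) (input_state n k m) t \<sigma>"
      "tried pattern_count \<sigma>" "real t \<le> real pattern_count * (4 + round_cost) + 4"
    by auto
  have "exec Q solver (input_state n k m) (t + 3) (set_reg 0 (fst \<sigma> found_reg) \<sigma>)"
    using exec.Seq[OF run(1) exec.Assign[of Q 0 "Reg found_reg"]]
    by (simp add: solver_def numeral_3_eq_3 One_nat_def)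
  moreover have "0 < pattern_count" by (cases "k = 0") simp_all
  then have "1 \<le> real pattern_count" by linarith
  then have "real (t + 3) \<le> (round_cost + 11) * real pattern_count"
    using run(3) by (simp add: algebra_simps)
  moreover have "fst \<sigma> found_reg \<noteq> 0 \<longrightarrow> accepted (snd \<sigma> plan_arr)"
    using run(2) by (simp add: tried_def Let_def searching_def)
  moreover have "\<forall>D\<in>digit_arrays (2 * k) k. hits D \<longrightarrow> fst \<sigma> found_reg \<noteq> 0"
    using run(2) digit_value_less[of k _ "2 * k"] by (auto simp: tried_def Let_def digit_arrays_def)
  ultimately show ?thesis
    by (intro exI[of _ "t + 3"] exI[of _ "set_reg 0 (fst \<sigma> found_reg) \<sigma>"]) simp
qed

end

section \<open>Plans and constraints\<close>

lemma plan_of_array_eq_Some_iff: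
  assumes "distinct ss"
  shows "plan_of_array ss us a s = Some u \<longleftrightarrow>
    (\<exists>i<length ss. s = ss ! i \<and> a i < length us \<and> u = us ! a i)"
proof -
  let ?is = "filter (\<lambda>i. a i < length us) [0..<length ss]"
  have "inj_on ((!) ss) (set ?is)" using assms by (intro inj_on_nth) auto
  then have "distinct (map fst (map (\<lambda>i. (ss ! i, us ! a i)) ?is))"
    by (simp add: distinct_map comp_def)
  then show ?thesis
    unfolding plan_of_array_def by (subst map_of_eq_Some_iff) auto
qed

lemma plan_of_array_cong:
  assumes "\<And>i. i < length ss \<Longrightarrow> a i = b i"
  shows "plan_of_array ss us a = plan_of_array ss us b"
proof -
  have "filter (\<lambda>i. a i < length us) [0..<length ss] = filter (\<lambda>i. b i < length us) [0..<length ss]"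
    using assms by (intro filter_cong) auto
  then show ?thesis
    using assms unfolding plan_of_array_def by (intro arg_cong[of _ _ map_of] map_cong) auto
qed

lemma permutes_extend:
  assumes "finite U" "X \<subseteq> U" "inj_on h X" "h ` X \<subseteq> U"
  shows "\<exists>\<psi>. \<psi> permutes U \<and> (\<forall>x\<in>X. \<psi> x = h x)"
proof -
  have "card (U - X) = card (U - h ` X)"
    using assms by (simp add: card_Diff_subset card_image finite_subset)
  then obtain g where g: "bij_betw g (U - X) (U - h ` X)"
    using assms(1) finite_same_card_bij[of "U - X" "U - h ` X"] by auto
  define \<psi> where "\<psi> = (\<lambda>x. if x \<in> X then h x else if x \<in> U then g x else x)"
  have "bij_betw \<psi> X (h ` X)"
    using assms(3) by (auto simp: \<psi>_def bij_betw_def inj_on_def)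
  moreover have "bij_betw \<psi> (U - X) (U - h ` X)"
    using g by (rule bij_betw_cong[THEN iffD1, rotated]) (simp add: \<psi>_def)
  ultimately have "bij_betw \<psi> (X \<union> (U - X)) (h ` X \<union> (U - h ` X))"
    by (rule bij_betw_combine) auto
  moreover have "X \<union> (U - X) = U" "h ` X \<union> (U - h ` X) = U" using assms by auto
  ultimately have "\<psi> permutes U" using assms(2) by (intro bij_imp_permutes) (auto simp: \<psi>_def)
  then show ?thesis by (intro exI[of _ \<psi>]) (simp add: \<psi>_def)
qed

lemma same_kernel_permutation:
  fixes \<pi> \<pi>' :: "'s \<rightharpoonup> 'u"
  assumes finite_U: "finite U" and dom: "dom \<pi>' = dom \<pi>" and ran: "ran \<pi> \<subseteq> U" "ran \<pi>' \<subseteq> U"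
    and same: "\<And>s s'. s \<in> dom \<pi> \<Longrightarrow> s' \<in> dom \<pi> \<Longrightarrow> \<pi>' s = \<pi>' s' \<longleftrightarrow> \<pi> s = \<pi> s'"
  shows "\<exists>\<psi>. \<psi> permutes U \<and> \<pi>' = map_option \<psi> \<circ> \<pi>"
proof -
  have "\<pi>' s = \<pi>' s'" if "\<pi> s = \<pi> s'" for s s'
  proof (cases "s \<in> dom \<pi>")
    case True
    then have "s' \<in> dom \<pi>" using that by (simp add: dom_def)
    then show ?thesis using True that same by blast
  next
    case False
    then have "s \<notin> dom \<pi>'" "s' \<notin> dom \<pi>'" using that dom by (simp_all add: domIff)
    then show ?thesis by (simp add: domIff)
  qed
  then obtain g where factor: "\<pi>' = g \<circ> \<pi>" using function_factors_left[of \<pi> \<pi>'] by blast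
  define h where "h u = the (g (Some u))" for u
  have h_plan: "\<pi>' s = Some (h u)" if "\<pi> s = Some u" for s u
  proof -
    have "s \<in> dom \<pi>'" using that dom by blast
    then show ?thesis using that by (auto simp: h_def factor)
  qed
  have "inj_on h (ran \<pi>)"
  proof (rule inj_onI)
    fix u v assume "u \<in> ran \<pi>" "v \<in> ran \<pi>" and "h u = h v"
    moreover from this obtain s s' where "\<pi> s = Some u" "\<pi> s' = Some v" by (auto simp: ran_def)
    ultimately show "u = v" using h_plan same[of s s'] by (simp add: domI)
  qed
  moreover have "h ` ran \<pi> \<subseteq> U" using h_plan ran(2) by (fastforce simp: ran_def)
  ultimately obtain \<psi> where \<psi>: "\<psi> permutes U" "\<forall>u\<in>ran \<pi>. \<psi> u = h u"
    using permutes_extend[OF finite_U ran(1)] by blast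
  have "\<pi>' s = (map_option \<psi> \<circ> \<pi>) s" for s
  proof (cases "\<pi> s")
    case None
    then show ?thesis using dom by auto
  next
    case (Some u)
    then show ?thesis using h_plan[OF Some] \<psi>(2) by (simp add: ranI)
  qed
  then show ?thesis using \<psi>(1) by blast
qed

lemma user_independent_satisfies:
  assumes ui: "user_independent U c" and finite_U: "finite U"
    and dom: "dom \<pi>' = dom \<pi>" and ran: "ran \<pi> \<subseteq> U" "ran \<pi>' \<subseteq> U"
    and same: "\<And>s s'. s \<in> dom \<pi> \<Longrightarrow> s' \<in> dom \<pi> \<Longrightarrow> \<pi>' s = \<pi>' s' \<longleftrightarrow> \<pi> s = \<pi> s'"
    and sat: "satisfies \<pi> c"
  shows "satisfies \<pi>' c"
proof (cases "fst c \<subseteq> dom \<pi>")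
  case False
  then show ?thesis using dom by (auto simp: satisfies_def)
next
  case True
  obtain \<psi> where \<psi>: "\<psi> permutes U" "\<pi>' = map_option \<psi> \<circ> \<pi>"
    using same_kernel_permutation[OF finite_U dom ran same] by blast
  have "\<pi> |` fst c \<in> snd c" using sat True by (auto simp: satisfies_def)
  then have "map_option \<psi> \<circ> (\<pi> |` fst c) \<in> snd c" using ui \<psi>(1) by (auto simp: user_independent_def)
  moreover have "map_option \<psi> \<circ> (\<pi> |` fst c) = \<pi>' |` fst c"
    by (auto simp: \<psi>(2) restrict_map_def fun_eq_iff)
  ultimately show ?thesis by (simp add: satisfies_def)
qed

lemma satisfies_rel_constraint:
  assumes "s \<in> dom \<pi>" "s' \<in> dom \<pi>" "ran \<pi> \<subseteq> U"
  shows "satisfies \<pi> (rel_constraint U s s' R) \<longleftrightarrow> (the (\<pi> s), the (\<pi> s')) \<in> R"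
  using assms
  by (auto simp: satisfies_def rel_constraint_def ran_def restrict_map_def split: if_splits)

lemma rel_constraint_loop_user_independent:
  assumes "R = E \<or> R = U \<times> U - E" "refl_on U E"
  shows "user_independent U (rel_constraint U s s R)"
  unfolding user_independent_def
proof (intro ballI allI impI)
  fix \<theta> \<psi> assume \<theta>: "\<theta> \<in> snd (rel_constraint U s s R)" and \<psi>: "\<psi> permutes U"
  then obtain u where u: "\<theta> = [s \<mapsto> u]" "u \<in> U" "(u, u) \<in> R"
    by (fastforce simp: rel_constraint_def dom_eq_singleton_conv)
  moreover have "\<psi> u \<in> U" using \<psi> u(2) by (simp add: permutes_in_image)
  ultimately show "map_option \<psi> \<circ> \<theta> \<in> snd (rel_constraint U s s R)"
    using assms by (auto simp: rel_constraint_def refl_on_def)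
qed

section \<open>Correctness of the solver\<close>

definition solver_factor :: "(nat \<Rightarrow> nat \<Rightarrow> nat \<Rightarrow> real) \<Rightarrow> nat \<Rightarrow> nat \<Rightarrow> nat \<Rightarrow> real" where
  "solver_factor p n k m = cost (search ;; count_up) (sizes n k m) (p n k m) + 11"

lemma polynomial3_solver_factor: "polynomial3 p \<Longrightarrow> polynomial3 (solver_factor p)"
  unfolding solver_factor_def[abs_def]
  by (intro polynomial3.add polynomial3.const polynomial3_cost)

locale presented_instance =
  fixes ss :: "'s list" and us :: "'u list" and cs :: "('s, 'u) constraint list"
    and S :: "'s set" and U :: "'u set" and A :: "'s \<Rightarrow> 'u set" and C :: "('s, 'u) constraint set"
    and R :: "('u \<times> 'u) set" and \<tau> :: nat
  assumes inst: "wsp_instance (S, U, A, C)" and enum: "enumerates ss us cs (S, U, A, C)"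
    and R: "equiv U R"
    and C: "\<forall>c\<in>C. (\<exists>s1 s2. c = rel_constraint U s1 s2 R) \<or>
      (\<exists>s1 s2. c = rel_constraint U s1 s2 (U \<times> U - R)) \<or> user_independent U c"
begin

abbreviation "n \<equiv> length us"
abbreviation "k \<equiv> length ss"
abbreviation "m \<equiv> length cs"
abbreviation "Q \<equiv> wsp_queries ss us cs (S, U, A, C) \<tau>"
abbreviation "array_plan \<equiv> plan_of_array ss us"

lemma lists: "distinct ss" "set ss = S" "distinct us" "set us = U" "set cs = C"
  using enum by (simp_all add: enumerates_def)

lemma task_index: "s \<in> S \<Longrightarrow> \<exists>i<k. s = ss ! i"
  using lists(2) by (metis in_set_conv_nth)

lemma finite_U: "finite U"
  using lists(4) by auto

lemma query_simps:
  "auth_query Q i j \<longleftrightarrow> i < k \<and> j < n \<and> us ! j \<in> A (ss ! i)"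
  "check_query Q l a \<longleftrightarrow> l < m \<and> satisfies (array_plan a) (cs ! l)"
  "query_time Q = \<tau>"
  by (simp_all add: wsp_queries_def)

sublocale solver_input Q n k m
proof
  fix P P' :: "nat \<Rightarrow> nat" and l
  assume "\<And>i. i < k \<Longrightarrow> P i = P' i"
  then show "check_query Q l P = check_query Q l P'"
    using plan_of_array_cong[of ss P P' us] by (simp add: query_simps)
qed

lemma ran_array_plan: "ran (array_plan P) \<subseteq> U"
  using lists(4) by (auto simp: ran_def plan_of_array_eq_Some_iff[OF lists(1)])

lemma array_plan_nth:
  assumes "i < k" "P i < n"
  shows "array_plan P (ss ! i) = Some (us ! P i)"
  unfolding plan_of_array_eq_Some_iff[OF lists(1)] using assms by blast

lemma dom_array_plan: "dom (array_plan P) = S \<longleftrightarrow> (\<forall>i<k. P i < n)"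
proof -
  have dom: "dom (array_plan P) = (!) ss ` {i. i < k \<and> P i < n}"
    by (auto simp: dom_def plan_of_array_eq_Some_iff[OF lists(1)])
  have S: "S = (!) ss ` {..<k}"
    using lists(2) nth_image[of k ss] by (simp add: lessThan_atLeast0)
  have "inj_on ((!) ss) {..<k}" using lists(1) by (intro inj_on_nth) auto
  then have "dom (array_plan P) = S \<longleftrightarrow> {i. i < k \<and> P i < n} = {..<k}"
    unfolding dom S by (intro inj_on_image_eq_iff[of _ "{..<k}"]) auto
  then show ?thesis by auto
qed

lemma accepted_iff_valid: "accepted P \<longleftrightarrow> valid_complete_plan (S, U, A, C) (array_plan P)"
proof -
  have "eligible C (array_plan P) \<longleftrightarrow> (\<forall>l<m. satisfies (array_plan P) (cs ! l))"
    unfolding eligible_def using all_set_conv_all_nth[of cs] lists(5) by simp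
  then have "eligible C (array_plan P) \<longleftrightarrow> (\<forall>l<m. check_query Q l P)"
    by (simp add: query_simps)
  moreover have "authorized A (array_plan P) \<longleftrightarrow> (\<forall>i<k. P i < n \<longrightarrow> us ! P i \<in> A (ss ! i))"
    by (auto simp: authorized_def dom_def plan_of_array_eq_Some_iff[OF lists(1)] array_plan_nth)
  moreover have "valid_complete_plan (S, U, A, C) (array_plan P) \<longleftrightarrow>
      (\<forall>i<k. P i < n) \<and> eligible C (array_plan P) \<and> authorized A (array_plan P)"
    using ran_array_plan dom_array_plan[of P] by (auto simp: valid_complete_plan_def plan_def)
  ultimately show ?thesis by (auto simp: accepted_def query_simps)
qed

lemma array_plan_surj:
  assumes "dom \<pi> = S" "ran \<pi> \<subseteq> U"
  obtains f where "\<pi> = array_plan f"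
proof -
  have "\<exists>j<n. \<pi> (ss ! i) = Some (us ! j)" if "i < k" for i
  proof -
    obtain u where u: "\<pi> (ss ! i) = Some u" using \<open>i < k\<close> assms(1) lists(2) nth_mem by blast
    then have "u \<in> set us" using assms(2) lists(4) by (auto simp: ran_def)
    then show ?thesis using u by (metis in_set_conv_nth)
  qed
  then obtain f where f: "\<And>i. i < k \<Longrightarrow> f i < n \<and> \<pi> (ss ! i) = Some (us ! f i)" by metis
  have "\<pi> s = array_plan f s" for s
  proof (cases "s \<in> S")
    case True
    then obtain i where "i < k" "s = ss ! i" using task_index by blast
    then show ?thesis using f array_plan_nth by simp
  next
    case False
    moreover have "dom (array_plan f) = S" using f dom_array_plan by blast
    ultimately show ?thesis using assms(1) by (metis domIff)
  qed
  then show ?thesis using that by blast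
qed

lemma nonindependent_constraint:
  assumes "c \<in> C" "\<not> user_independent U c"
  obtains R' i j where "R' = R \<or> R' = U \<times> U - R" "i < k" "j < k" "i \<noteq> j"
    "c = rel_constraint U (ss ! i) (ss ! j) R'"
proof -
  obtain s s' R' where c: "c = rel_constraint U s s' R'" "R' = R \<or> R' = U \<times> U - R"
    using C assms by blast
  have "fst c \<subseteq> S" using inst assms(1) by (cases c) (auto simp: wsp_instance_def)
  then have "s \<in> S" "s' \<in> S" using c(1) by (simp_all add: rel_constraint_def)
  then obtain i j where ij: "i < k" "s = ss ! i" "j < k" "s' = ss ! j"
    using task_index by blast
  have "refl_on U R" using R by (auto elim: equivE)
  then have "i \<noteq> j"
    using rel_constraint_loop_user_independent[OF c(2), of s] assms(2) ij c(1) by auto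
  then show ?thesis using that[OF c(2) ij(1,3)] c(1) ij(2,4) by simp
qed

definition respects_constraints :: "(nat \<Rightarrow> nat) \<Rightarrow> bool" where
  "respects_constraints cls \<longleftrightarrow> (\<forall>c\<in>C. user_independent U c) \<or>
     (\<forall>u<n. \<forall>v<n. cls u = cls v \<longleftrightarrow> (us ! u, us ! v) \<in> R)"

lemma accepted_same_pattern:
  assumes accepted: "accepted f" and cls: "respects_constraints cls"
    and auth: "\<And>i. i < k \<Longrightarrow> auth_query Q i (P i)"
    and users: "\<And>i j. i < k \<Longrightarrow> j < k \<Longrightarrow> P i = P j \<longleftrightarrow> f i = f j"
    and classes: "\<And>i j. i < k \<Longrightarrow> j < k \<Longrightarrow> cls (P i) = cls (P j) \<longleftrightarrow> cls (f i) = cls (f j)"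
  shows "accepted P"
proof -
  have less: "f i < n" "P i < n" if "i < k" for i
    using accepted auth[OF that] that by (auto simp: accepted_def query_simps)
  have dom: "dom (array_plan f) = S" "dom (array_plan P) = S" using less dom_array_plan by auto
  have same: "array_plan P s = array_plan P s' \<longleftrightarrow> array_plan f s = array_plan f s'"
    if tasks: "s \<in> dom (array_plan f)" "s' \<in> dom (array_plan f)" for s s'
  proof -
    obtain i j where "i < k" "s = ss ! i" "j < k" "s' = ss ! j"
      using tasks task_index unfolding dom by blast
    then show ?thesis using users less lists(3) by (simp add: array_plan_nth nth_eq_iff_index_eq)
  qed
  have "satisfies (array_plan P) c" if c: "c \<in> C" "satisfies (array_plan f) c" for c
  proof (cases "user_independent U c")
    case True
    then show ?thesis
      by (rule user_independent_satisfies[OF _ finite_U _ ran_array_plan ran_array_plan same c(2)])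
        (simp_all only: dom)
  next
    case False
    then obtain R' i j where c': "R' = R \<or> R' = U \<times> U - R" "i < k" "j < k"
        "c = rel_constraint U (ss ! i) (ss ! j) R'"
      using nonindependent_constraint[OF c(1)] by metis
    have "\<forall>u<n. \<forall>v<n. cls u = cls v \<longleftrightarrow> (us ! u, us ! v) \<in> R"
      using cls c(1) False by (auto simp: respects_constraints_def)
    then have "(us ! P i, us ! P j) \<in> R' \<longleftrightarrow> (us ! f i, us ! f j) \<in> R'"
      using classes[OF c'(2,3)] less c'(1-3) lists(4) by auto
    moreover have sat: "satisfies (array_plan h) c \<longleftrightarrow> (us ! h i, us ! h j) \<in> R'"
      if "h i < n" "h j < n" for h
      using that c'(2,3) ran_array_plan array_plan_nth
      by (simp add: c'(4) satisfies_rel_constraint domI)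
    ultimately show ?thesis using c(2) less c'(2,3) by simp
  qed
  then show ?thesis using accepted auth nth_mem[of _ cs] lists(5)
    by (simp add: accepted_def query_simps)
qed

lemma succeeds_pattern:
  assumes accepted: "accepted f" and cls: "respects_constraints cls" "\<And>u. u < n \<Longrightarrow> cls u < n"
  shows "succeeds (pattern cls f) cls"
  unfolding succeeds_def
proof (intro conjI allI impI)
  have "f i < n \<and> auth_query Q i (f i)" if "i < k" for i
    using accepted that by (simp add: accepted_def query_simps)
  then show "\<exists>M. matching (class_fits (pattern cls f) cls) (class_leaders (pattern cls f)) {..<n} M"
    using pattern_class_matching cls(2) by blast
next
  fix g P assume realizes: "realizes (pattern cls f) cls g P"
  show "accepted P"
    using accepted_same_pattern[OF accepted cls(1)] realizes_fits(2)[OF realizes]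
      realizes_same_user_iff[OF realizes] realizes_same_class_iff[OF realizes] by blast
qed

lemma Least_cong_le:
  fixes u :: nat
  assumes "\<And>v. v \<le> u \<Longrightarrow> F v = G v" "F u"
  shows "(LEAST v. F v) = (LEAST v. G v)"
proof (rule Least_equality)
  have "G u" using assms by simp
  then have "(LEAST v. G v) \<le> u" "G (LEAST v. G v)" by (auto intro: Least_le LeastI)
  then show "F (LEAST v. G v)" using assms(1) by simp
  show "(LEAST v. G v) \<le> v" if "F v" for v
  proof (cases "v \<le> u")
    case True
    then show ?thesis using that assms(1) by (simp add: Least_le)
  qed (use \<open>(LEAST v. G v) \<le> u\<close> in simp)
qed

lemma probed_class_eq_least_rep:
  assumes constraint: "l < m" "cs ! l = rel_constraint U (ss ! i) (ss ! j) R'"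
    and R': "R' = R \<or> R' = U \<times> U - R"
    and scope: "i < k" "j < k" "i \<noteq> j" and user: "u < n"
  shows "probed_class l i j u = least_rep (\<lambda>v. R `` {us ! v}) u"
  unfolding probed_class_def least_rep_def
proof (rule Least_cong_le)
  fix v assume "v \<le> u"
  have check: "check_query Q l ((\<lambda>_. n)(i := u, j := w)) \<longleftrightarrow> (us ! u, us ! w) \<in> R'" if "w < n" for w
    using that constraint scope user ran_array_plan array_plan_nth[of i] array_plan_nth[of j]
    by (simp add: query_simps satisfies_rel_constraint domI)
  have in_U: "us ! u \<in> U" "us ! v \<in> U" using user \<open>v \<le> u\<close> lists(4) by auto
  have "(us ! u, us ! u) \<in> R" using R in_U(1) by (auto elim: equivE dest: refl_onD)
  then have "((us ! u, us ! v) \<in> R' \<longleftrightarrow> (us ! u, us ! u) \<in> R') \<longleftrightarrow> (us ! u, us ! v) \<in> R"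
    using R' in_U by auto
  also have "\<dots> \<longleftrightarrow> R `` {us ! v} = R `` {us ! u}"
    using eq_equiv_class_iff[OF R in_U] by blast
  finally show "check_query Q l ((\<lambda>_. n)(i := u, j := v)) =
      check_query Q l ((\<lambda>_. n)(i := u, j := u))
      \<longleftrightarrow> R `` {us ! v} = R `` {us ! u}"
    using check user \<open>v \<le> u\<close> by simp
qed simp

lemma respecting_class_map:
  "\<exists>cls\<in>class_maps. respects_constraints cls \<and> (\<forall>u<n. cls u < n)"
proof (cases "\<forall>c\<in>C. user_independent U c")
  case True
  then show ?thesis
    by (intro bexI[of _ "\<lambda>_. 0"]) (auto simp: respects_constraints_def class_maps_def)
next
  case False
  then obtain c R' i j where c: "c \<in> C" "c = rel_constraint U (ss ! i) (ss ! j) R'"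
    and R': "R' = R \<or> R' = U \<times> U - R" and ij: "i < k" "j < k" "i \<noteq> j"
    using nonindependent_constraint by metis
  obtain l where l: "l < m" "cs ! l = c" using c(1) lists(5) by (metis in_set_conv_nth)
  let ?cls = "probed_class l i j"
  have cls: "?cls u = least_rep (\<lambda>v. R `` {us ! v}) u" if "u < n" for u
    using probed_class_eq_least_rep[OF l(1) _ R' ij that] l(2) c(2) by simp
  have "?cls u = ?cls v \<longleftrightarrow> (us ! u, us ! v) \<in> R" if "u < n" "v < n" for u v
    using cls that eq_equiv_class_iff[OF R, of "us ! u" "us ! v"] lists(4)
    by (auto simp: least_rep_eq_iff)
  then have "respects_constraints ?cls" by (simp add: respects_constraints_def)
  moreover have "?cls u < n" if "u < n" for u
    using cls[OF that] least_rep_le[of _ u] that by (metis le_less_trans)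
  moreover have "?cls \<in> class_maps" using l(1) ij by (auto simp: class_maps_def)
  ultimately show ?thesis by blast
qed

lemma hits_if_solvable:
  assumes "valid_complete_plan (S, U, A, C) \<pi>"
  shows "\<exists>D\<in>digit_arrays (2 * k) k. hits D"
proof -
  have "dom \<pi> = S" "ran \<pi> \<subseteq> U" using assms by (simp_all add: valid_complete_plan_def plan_def)
  then obtain f where "\<pi> = array_plan f" by (rule array_plan_surj)
  then have f: "accepted f" using assms accepted_iff_valid by simp
  obtain cls where cls: "cls \<in> class_maps" "respects_constraints cls" "\<And>u. u < n \<Longrightarrow> cls u < n"
    using respecting_class_map by blast
  have "hits (pattern cls f)" using succeeds_pattern[OF f cls(2,3)] cls(1) by (auto simp: hits_def)
  then show ?thesis using pattern_digits by blast
qed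

lemma solver_correct:
  assumes "real \<tau> \<le> p n k m"
  shows "\<exists>t \<sigma>. exec Q solver (input_state n k m) t \<sigma> \<and> solution_state ss us (S, U, A, C) \<sigma> \<and>
    real t \<le> solver_factor p n k m * real ((2 * k) ^ k)"
proof -
  obtain t \<sigma> where run: "exec Q solver (input_state n k m) t \<sigma>"
      "real t \<le> (round_cost + 11) * real pattern_count"
    and sound: "fst \<sigma> 0 \<noteq> 0 \<longrightarrow> accepted (snd \<sigma> plan_arr)"
    and complete: "\<forall>D\<in>digit_arrays (2 * k) k. hits D \<longrightarrow> fst \<sigma> 0 \<noteq> 0"
    using exec_solver by blast
  have "fst \<sigma> 0 \<noteq> 0 \<longleftrightarrow> (\<exists>\<pi>. valid_complete_plan (S, U, A, C) \<pi>)"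
    using sound complete hits_if_solvable accepted_iff_valid by blast
  then have "solution_state ss us (S, U, A, C) \<sigma>"
    using sound accepted_iff_valid by (auto simp: solution_state_def)
  moreover have "round_cost + 11 \<le> solver_factor p n k m"
    unfolding round_cost_def solver_factor_def query_simps(3)
    using assms by (intro add_right_mono cost_mono sizes_nonneg)
  then have "real t \<le> solver_factor p n k m * real ((2 * k) ^ k)"
    by (intro order_trans[OF run(2)] mult_right_mono) simp_all
  ultimately show ?thesis using run(1) by blast
qed

end

lemma solvable_in_O_starI:
  assumes "\<And>p. polynomial3 p \<Longrightarrow> polynomial3 (q p)"
    and "\<And>p W ss us cs \<tau>. W \<in> K \<Longrightarrow> wsp_instance W \<Longrightarrow> enumerates ss us cs W \<Longrightarrow>
      real \<tau> \<le> p (length us) (length ss) (length cs) \<Longrightarrow>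
      \<exists>t \<sigma>. exec (wsp_queries ss us cs W \<tau>) P
          (input_state (length us) (length ss) (length cs)) t \<sigma> \<and>
        solution_state ss us W \<sigma> \<and> real t \<le> q p (length us) (length ss) (length cs) * h (length ss)"
  shows "solvable_in_O_star K h"
  unfolding solvable_in_O_star_def Let_def using assms by blast

lemma two_powr_pattern_count: "2 powr (real k * log 2 (real k) + real k) = real ((2 * k) ^ k)"
proof (cases "k = 0")
  case False
  then have "2 powr (real k * log 2 (real k)) = real k ^ k"
    by (simp add: mult.commute[of "real k"] powr_powr[symmetric] powr_realpow)
  then show ?thesis by (simp add: powr_add powr_realpow power_mult_distrib)
qed simp

theorem theorem23:
  shows "solvable_in_O_star
    {(S :: 's set, U :: 'u set, A, C).
       \<exists>R. equiv U R \<and>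
         (\<forall>c\<in>C. (\<exists>s1 s2. c = rel_constraint U s1 s2 R) \<or>
                (\<exists>s1 s2. c = rel_constraint U s1 s2 (U \<times> U - R)) \<or>
                user_independent U c)}
    (\<lambda>k. 2 powr (real k * log 2 (real k) + real k))"
  (is "solvable_in_O_star ?K _")
  unfolding two_powr_pattern_count
proof (rule solvable_in_O_starI[where P = solver and q = solver_factor])
  fix p :: "nat \<Rightarrow> nat \<Rightarrow> nat \<Rightarrow> real" and W ss us cs \<tau>
  assume W: "W \<in> ?K" "wsp_instance W" "enumerates ss us cs W"
    and \<tau>: "real \<tau> \<le> p (length us) (length ss) (length cs)"
  from W obtain S U A C R where eq: "W = (S, U, A, C)"
    and presented: "presented_instance ss us cs S U A C R"
    by (auto simp: presented_instance_def)
  show "\<exists>t \<sigma>. exec (wsp_queries ss us cs W \<tau>) solver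
        (input_state (length us) (length ss) (length cs)) t \<sigma> \<and> solution_state ss us W \<sigma> \<and>
      real t \<le> solver_factor p (length us) (length ss) (length cs) *
        real ((2 * length ss) ^ length ss)"
    unfolding eq
    by (rule presented_instance.solver_correct[of ss us cs S U A C R \<tau> p, OF presented \<tau>])
qed (rule polynomial3_solver_factor)

end
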